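(* Let $(M,g)$ be an oriented Riemannian $3$-manifold (not necessarily compact). Then the Cotton tensor $\mathfrak{Cott}(g)=*\,d^\nabla\mathfrak{Sch}$ is a symmetric bilinear form.
   Context: $\nabla$ is the Levi-Civita connection of $g$, $R_{X,Y}=[\nabla_X,\nabla_Y]-\nabla_{[X,Y]}$ the curvature, $\mathfrak{Ric}(U,V)=\mathrm{tr}[X\mapsto R_{X,U}V]$ the Ricci tensor, $\mathfrak{scal}=\mathrm{tr}_g\mathfrak{Ric}$. The Schouten tensor is $\mathfrak{Sch}:=\mathfrak{Ric}-\frac{\mathfrak{scal}}{4}g$, viewed also as an endomorphism of $TM$ (a $TM$-valued $1$-form) via $g$. The Cotton form is the $TM$-valued $2$-form $\mathfrak{cott}:=d^\nabla\mathfrak{Sch}$, i.e. $(d^\nabla\mathfrak{Sch})(X,Y)=(\nabla_X\mathfrak{Sch})(Y)-(\nabla_Y\mathfrak{Sch})(X)$. The Cotton tensor is the bilinear form $\mathfrak{Cott}(g):=*\,d^\nabla\mathfrak{Sch}$, with the Hodge star $*$ acting on the $2$-form part: for an oriented orthonormal frame $S_1,S_2,S_3$ and $(i,j,k)$ a cyclic permutation of $(1,2,3)$, $*(S^j\wedge S^k)=S^i$, so $\mathfrak{Cott}(S_i,Z)=\langle (d^\nabla\mathfrak{Sch})(S_j,S_k),Z\rangle$. *)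

theory Defs
  imports "HOL-Analysis.Analysis" "HOL-Library.Function_Algebras"
begin

text \<open>
  Tangent vectors and vector fields are represented by functions; the pointwise operations of
  \<^theory>\<open>HOL-Library.Function_Algebras\<close> together with the following instance make
  them elements of real vector spaces.
\<close>

instantiation "fun" :: (type, real_vector) real_vector
begin

definition scaleR_fun_def: "scaleR a f = (\<lambda>x. scaleR a (f x))"

instance
  by standard (auto simp: scaleR_fun_def plus_fun_def algebra_simps)

end


section \<open>Smooth maps\<close>

text \<open>The predicates below are meant for open sets \<open>S\<close> in a finite-dimensional space.\<close>

primrec Ck_on :: "nat \<Rightarrow> ('a::real_normed_vector \<Rightarrow> 'b::real_normed_vector) \<Rightarrow> 'a set \<Rightarrow> bool"
where
  "Ck_on 0 f S \<longleftrightarrow> continuous_on S f"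
| "Ck_on (Suc k) f S \<longleftrightarrow>
     f differentiable_on S \<and> (\<forall>v. Ck_on k (\<lambda>x. frechet_derivative f (at x) v) S)"

definition smooth_on :: "('a::real_normed_vector \<Rightarrow> 'b::real_normed_vector) \<Rightarrow> 'a set \<Rightarrow> bool"
  where "smooth_on f S \<longleftrightarrow> (\<forall>k. Ck_on k f S)"


section \<open>Smooth manifolds\<close>

text \<open>
  A chart is a pair of its domain and its coordinate map; the values of the coordinate map
  outside the domain are irrelevant.
\<close>

type_synonym ('a, 'n) chart = "'a set \<times> ('a \<Rightarrow> real ^ 'n)"

definition is_chart :: "'a topology \<Rightarrow> ('a, 'n::finite) chart \<Rightarrow> bool" where
  "is_chart M c \<longleftrightarrow>
     openin M (fst c) \<and> open (snd c ` fst c) \<and>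
     homeomorphic_map (subtopology M (fst c)) (top_of_set (snd c ` fst c)) (snd c)"

definition chart_inv :: "('a, 'n) chart \<Rightarrow> real ^ 'n \<Rightarrow> 'a" where
  "chart_inv c = inv_into (fst c) (snd c)"

definition transition :: "('a, 'n) chart \<Rightarrow> ('a, 'n) chart \<Rightarrow> real ^ 'n \<Rightarrow> real ^ 'n" where
  "transition c d = snd d \<circ> chart_inv c"

definition jacobian ::
  "('a, 'n::finite) chart \<Rightarrow> ('a, 'n) chart \<Rightarrow> 'a \<Rightarrow> real ^ 'n \<Rightarrow> real ^ 'n" where
  "jacobian c d p = frechet_derivative (transition c d) (at (snd c p))"

text \<open>
  A tangent vector at \<open>p\<close> is the family of its coordinate vectors in all charts around \<open>p\<close>,
  related by the Jacobians of the chart transitions (and zero on all other charts, so that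
  equality of tangent vectors is equality of functions).
\<close>

type_synonym ('a, 'n) tangent_vector = "('a, 'n) chart \<Rightarrow> real ^ 'n"
type_synonym ('a, 'n) vector_field = "'a \<Rightarrow> ('a, 'n) tangent_vector"

locale smooth_manifold =
  fixes M :: "'a topology" and A :: "('a, 'n::finite) chart set"
  assumes hausdorff: "Hausdorff_space M"
    and second_countable: "second_countable M"
    and charts: "\<And>c. c \<in> A \<Longrightarrow> is_chart M c"
    and cover: "(\<Union>c\<in>A. fst c) = topspace M"
    and smooth_transition:
      "\<And>c d. c \<in> A \<Longrightarrow> d \<in> A \<Longrightarrow> smooth_on (transition c d) (snd c ` (fst c \<inter> fst d))"
begin

definition charts_at :: "'a \<Rightarrow> ('a, 'n) chart set" where
  "charts_at p = {c \<in> A. p \<in> fst c}"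

definition chart_at :: "'a \<Rightarrow> ('a, 'n) chart" where
  "chart_at p = (SOME c. c \<in> charts_at p)"

definition tangent_space :: "'a \<Rightarrow> ('a, 'n) tangent_vector set" where
  "tangent_space p =
     {v. (\<forall>c. c \<notin> charts_at p \<longrightarrow> v c = 0) \<and>
         (\<forall>c\<in>charts_at p. \<forall>d\<in>charts_at p. v d = jacobian c d p (v c))}"

definition tangent_of_coords :: "('a, 'n) chart \<Rightarrow> 'a \<Rightarrow> real ^ 'n \<Rightarrow> ('a, 'n) tangent_vector" where
  "tangent_of_coords c p x = (\<lambda>d. if d \<in> charts_at p then jacobian c d p x else 0)"

text \<open>Trace of an endomorphism of the tangent space, via its matrix in a coordinate basis.\<close>

definition tangent_trace ::
  "'a \<Rightarrow> (('a, 'n) tangent_vector \<Rightarrow> ('a, 'n) tangent_vector) \<Rightarrow> real" where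
  "tangent_trace p F =
     trace (matrix (\<lambda>x. F (tangent_of_coords (chart_at p) p x) (chart_at p)))"

definition symmetric_bilinear_form ::
  "'a \<Rightarrow> (('a, 'n) tangent_vector \<Rightarrow> ('a, 'n) tangent_vector \<Rightarrow> real) \<Rightarrow> bool" where
  "symmetric_bilinear_form p h \<longleftrightarrow>
     (\<forall>u\<in>tangent_space p. \<forall>v\<in>tangent_space p. \<forall>w\<in>tangent_space p.
        h (u + v) w = h u w + h v w \<and> h u (v + w) = h u v + h u w) \<and>
     (\<forall>a. \<forall>u\<in>tangent_space p. \<forall>v\<in>tangent_space p.
        h (a *\<^sub>R u) v = a * h u v \<and> h u (a *\<^sub>R v) = a * h u v) \<and>
     (\<forall>u\<in>tangent_space p. \<forall>v\<in>tangent_space p. h u v = h v u)"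

text \<open>
  Functions and vector fields are total functions in HOL; the predicates below describe
  smooth functions and smooth vector fields on an open subset \<open>W\<close> of the manifold and do not
  depend on the values outside \<open>W\<close>.
\<close>

definition smooth_fun :: "'a set \<Rightarrow> ('a \<Rightarrow> real) \<Rightarrow> bool" where
  "smooth_fun W f \<longleftrightarrow> (\<forall>c\<in>A. smooth_on (\<lambda>x. f (chart_inv c x)) (snd c ` (W \<inter> fst c)))"

definition smooth_field :: "'a set \<Rightarrow> ('a, 'n) vector_field \<Rightarrow> bool" where
  "smooth_field W X \<longleftrightarrow>
     (\<forall>p\<in>W. X p \<in> tangent_space p) \<and>
     (\<forall>c\<in>A. smooth_on (\<lambda>x. X (chart_inv c x) c) (snd c ` (W \<inter> fst c)))"

text \<open>The derivative of \<open>f\<close> at \<open>p\<close> in the direction \<open>v\<close>, computed in some chart around \<open>p\<close>.\<close>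

definition dir_deriv :: "('a \<Rightarrow> real) \<Rightarrow> 'a \<Rightarrow> ('a, 'n) tangent_vector \<Rightarrow> real" where
  "dir_deriv f p v =
     (let c = chart_at p
      in frechet_derivative (\<lambda>x. f (chart_inv c x)) (at (snd c p)) (v c))"

definition lie_bracket ::
  "('a, 'n) vector_field \<Rightarrow> ('a, 'n) vector_field \<Rightarrow> ('a, 'n) vector_field" where
  "lie_bracket X Y = (\<lambda>p c.
     if c \<in> charts_at p
     then frechet_derivative (\<lambda>x. Y (chart_inv c x) c) (at (snd c p)) (X p c)
        - frechet_derivative (\<lambda>x. X (chart_inv c x) c) (at (snd c p)) (Y p c)
     else 0)"

text \<open>
  Some smooth vector field near \<open>p\<close> with value \<open>v\<close> at \<open>p\<close>, used to evaluate
  tensorial operators on vector fields at tangent vectors; for such operators the choice of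
  the extension does not matter.
\<close>

definition extension :: "'a \<Rightarrow> ('a, 'n) tangent_vector \<Rightarrow> ('a, 'n) vector_field" where
  "extension p v = (SOME X. \<exists>W. openin M W \<and> p \<in> W \<and> smooth_field W X \<and> X p = v)"

text \<open>
  An affine connection, acting on smooth vector fields on arbitrary open subsets \<open>W\<close>. The second
  clause says that \<open>\<nabla> X Y\<close> on \<open>W\<close> only depends on \<open>X\<close> and \<open>Y\<close> on \<open>W\<close>; compatibility with
  restriction to smaller open sets is then implicit, the fields being total functions.
\<close>

definition affine_connection ::
  "(('a, 'n) vector_field \<Rightarrow> ('a, 'n) vector_field \<Rightarrow> ('a, 'n) vector_field) \<Rightarrow> bool" where
  "affine_connection nabla \<longleftrightarrow>
     (\<forall>W X Y. openin M W \<and> smooth_field W X \<and> smooth_field W Y \<longrightarrow>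
        smooth_field W (nabla X Y)) \<and>
     (\<forall>W X X' Y Y'. openin M W \<and> smooth_field W X \<and> smooth_field W Y \<and>
        (\<forall>p\<in>W. X' p = X p \<and> Y' p = Y p) \<longrightarrow> (\<forall>p\<in>W. nabla X' Y' p = nabla X Y p)) \<and>
     (\<forall>W X X' Y. openin M W \<and> smooth_field W X \<and> smooth_field W X' \<and> smooth_field W Y \<longrightarrow>
        (\<forall>p\<in>W. nabla (X + X') Y p = nabla X Y p + nabla X' Y p)) \<and>
     (\<forall>W f X Y. openin M W \<and> smooth_fun W f \<and> smooth_field W X \<and> smooth_field W Y \<longrightarrow>
        (\<forall>p\<in>W. nabla (\<lambda>q. f q *\<^sub>R X q) Y p = f p *\<^sub>R nabla X Y p)) \<and>
     (\<forall>W X Y Y'. openin M W \<and> smooth_field W X \<and> smooth_field W Y \<and> smooth_field W Y' \<longrightarrow>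
        (\<forall>p\<in>W. nabla X (Y + Y') p = nabla X Y p + nabla X Y' p)) \<and>
     (\<forall>W f X Y. openin M W \<and> smooth_fun W f \<and> smooth_field W X \<and> smooth_field W Y \<longrightarrow>
        (\<forall>p\<in>W. nabla X (\<lambda>q. f q *\<^sub>R Y q) p
               = dir_deriv f p (X p) *\<^sub>R Y p + f p *\<^sub>R nabla X Y p))"

end


section \<open>Riemannian manifolds and the Levi-Civita connection\<close>

locale riemannian_manifold = smooth_manifold M A
  for M :: "'a topology" and A :: "('a, 'n::finite) chart set" +
  fixes g :: "'a \<Rightarrow> ('a, 'n) tangent_vector \<Rightarrow> ('a, 'n) tangent_vector \<Rightarrow> real"
  assumes metric_bilinear: "\<And>p. p \<in> topspace M \<Longrightarrow> symmetric_bilinear_form p (g p)"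
    and metric_pos:
      "\<And>p v. p \<in> topspace M \<Longrightarrow> v \<in> tangent_space p \<Longrightarrow> v \<noteq> 0 \<Longrightarrow> g p v v > 0"
    and metric_smooth:
      "\<And>W X Y. openin M W \<Longrightarrow> smooth_field W X \<Longrightarrow> smooth_field W Y
        \<Longrightarrow> smooth_fun W (\<lambda>p. g p (X p) (Y p))"
begin

text \<open>The endomorphism of the tangent space corresponding to a bilinear form via the metric.\<close>

definition sharp ::
  "'a \<Rightarrow> (('a, 'n) tangent_vector \<Rightarrow> ('a, 'n) tangent_vector \<Rightarrow> real)
      \<Rightarrow> ('a, 'n) tangent_vector \<Rightarrow> ('a, 'n) tangent_vector" where
  "sharp p h u = (THE w. w \<in> tangent_space p \<and> (\<forall>v\<in>tangent_space p. g p w v = h u v))"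

definition metric_trace ::
  "'a \<Rightarrow> (('a, 'n) tangent_vector \<Rightarrow> ('a, 'n) tangent_vector \<Rightarrow> real) \<Rightarrow> real" where
  "metric_trace p h = tangent_trace p (sharp p h)"

end

locale levi_civita_connection = riemannian_manifold M A g
  for M :: "'a topology" and A :: "('a, 'n::finite) chart set" and g +
  fixes nabla :: "('a, 'n) vector_field \<Rightarrow> ('a, 'n) vector_field \<Rightarrow> ('a, 'n) vector_field"
  assumes connection: "affine_connection nabla"
    and torsion_free:
      "\<And>W X Y p. openin M W \<Longrightarrow> smooth_field W X \<Longrightarrow> smooth_field W Y \<Longrightarrow> p \<in> W
        \<Longrightarrow> nabla X Y p - nabla Y X p = lie_bracket X Y p"
    and metric_compatible:
      "\<And>W X Y Z p. openin M W \<Longrightarrow> smooth_field W X \<Longrightarrow> smooth_field W Y \<Longrightarrow> smooth_field W Z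
        \<Longrightarrow> p \<in> W
        \<Longrightarrow> dir_deriv (\<lambda>q. g q (Y q) (Z q)) p (X p)
            = g p (nabla X Y p) (Z p) + g p (Y p) (nabla X Z p)"
begin

definition curvature_field ::
  "('a, 'n) vector_field \<Rightarrow> ('a, 'n) vector_field \<Rightarrow> ('a, 'n) vector_field
      \<Rightarrow> ('a, 'n) vector_field" where
  "curvature_field X Y Z = nabla X (nabla Y Z) - nabla Y (nabla X Z) - nabla (lie_bracket X Y) Z"

definition curvature ::
  "'a \<Rightarrow> ('a, 'n) tangent_vector \<Rightarrow> ('a, 'n) tangent_vector \<Rightarrow> ('a, 'n) tangent_vector
      \<Rightarrow> ('a, 'n) tangent_vector" where
  "curvature p u v w = curvature_field (extension p u) (extension p v) (extension p w) p"

definition ricci :: "'a \<Rightarrow> ('a, 'n) tangent_vector \<Rightarrow> ('a, 'n) tangent_vector \<Rightarrow> real" where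
  "ricci p u v = tangent_trace p (\<lambda>x. curvature p x u v)"

definition scal :: "'a \<Rightarrow> real" where
  "scal p = metric_trace p (ricci p)"

text \<open>
  For a field \<open>F\<close> of endomorphisms, i.e. a 1-form with values in the tangent bundle:
  \<open>(\<nabla>\<^sub>X F)(Y)\<close> and \<open>(d\<^sup>\<nabla> F)(X, Y)\<close>.
\<close>

definition cov_deriv_endo ::
  "('a \<Rightarrow> ('a, 'n) tangent_vector \<Rightarrow> ('a, 'n) tangent_vector)
      \<Rightarrow> ('a, 'n) vector_field \<Rightarrow> ('a, 'n) vector_field \<Rightarrow> ('a, 'n) vector_field" where
  "cov_deriv_endo F X Y = nabla X (\<lambda>q. F q (Y q)) - (\<lambda>q. F q (nabla X Y q))"

definition d_nabla ::
  "('a \<Rightarrow> ('a, 'n) tangent_vector \<Rightarrow> ('a, 'n) tangent_vector)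
      \<Rightarrow> ('a, 'n) vector_field \<Rightarrow> ('a, 'n) vector_field \<Rightarrow> ('a, 'n) vector_field" where
  "d_nabla F X Y = cov_deriv_endo F X Y - cov_deriv_endo F Y X"

end


section \<open>Oriented Riemannian 3-manifolds and the Cotton tensor\<close>

text \<open>The orientation is the one determined by the oriented atlas \<open>A\<close>.\<close>

locale oriented_riemannian_3_manifold = riemannian_manifold M A g
  for M :: "'a topology" and A :: "('a, 3) chart set" and g +
  assumes oriented:
    "\<And>c d p. c \<in> A \<Longrightarrow> d \<in> A \<Longrightarrow> p \<in> fst c \<inter> fst d \<Longrightarrow> det (matrix (jacobian c d p)) > 0"
begin

definition oriented_orthonormal_frame :: "'a \<Rightarrow> (3 \<Rightarrow> ('a, 3) tangent_vector) \<Rightarrow> bool" where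
  "oriented_orthonormal_frame p S \<longleftrightarrow>
     (\<forall>i. S i \<in> tangent_space p) \<and>
     (\<forall>i j. g p (S i) (S j) = (if i = j then 1 else 0)) \<and>
     (\<forall>c\<in>charts_at p. det (\<chi> i. S i c) > 0)"

text \<open>
  The Hodge star of a 2-form \<open>\<beta>\<close> at \<open>p\<close> with values in the tangent space: in terms of
  an oriented orthonormal frame \<open>S\<close>, \<open>\<beta>\<close> is the sum of the \<open>\<beta>(S\<^sub>j, S\<^sub>k) S\<^sup>j \<and> S\<^sup>k\<close> over the
  cyclic permutations \<open>(i, j, k)\<close> of \<open>(1, 2, 3)\<close>, \<open>S\<^sup>j \<and> S\<^sup>k\<close> is mapped to \<open>S\<^sup>i\<close>, and the
  dual coframe is \<open>S\<^sup>i = g(S\<^sub>i, -)\<close>. The result is independent of the choice of \<open>S\<close>.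
\<close>

definition hodge_star_2 ::
  "'a \<Rightarrow> (('a, 3) tangent_vector \<Rightarrow> ('a, 3) tangent_vector \<Rightarrow> ('a, 3) tangent_vector)
      \<Rightarrow> ('a, 3) tangent_vector \<Rightarrow> ('a, 3) tangent_vector" where
  "hodge_star_2 p \<beta> u =
     (let S = (SOME S. oriented_orthonormal_frame p S)
      in g p (S 1) u *\<^sub>R \<beta> (S 2) (S 3)
       + g p (S 2) u *\<^sub>R \<beta> (S 3) (S 1)
       + g p (S 3) u *\<^sub>R \<beta> (S 1) (S 2))"

end

locale oriented_riemannian_3_manifold_levi_civita =
  oriented_riemannian_3_manifold M A g + levi_civita_connection M A g nabla
  for M :: "'a topology" and A :: "('a, 3) chart set" and g and nabla
begin

definition schouten :: "'a \<Rightarrow> ('a, 3) tangent_vector \<Rightarrow> ('a, 3) tangent_vector \<Rightarrow> real" where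
  "schouten p u v = ricci p u v - scal p / 4 * g p u v"

definition schouten_endo :: "'a \<Rightarrow> ('a, 3) tangent_vector \<Rightarrow> ('a, 3) tangent_vector" where
  "schouten_endo p = sharp p (schouten p)"

definition cotton_form ::
  "'a \<Rightarrow> ('a, 3) tangent_vector \<Rightarrow> ('a, 3) tangent_vector \<Rightarrow> ('a, 3) tangent_vector" where
  "cotton_form p u v = d_nabla schouten_endo (extension p u) (extension p v) p"

definition cotton_tensor ::
  "'a \<Rightarrow> ('a, 3) tangent_vector \<Rightarrow> ('a, 3) tangent_vector \<Rightarrow> real" where
  "cotton_tensor p u z = g p (hodge_star_2 p (cotton_form p) u) z"

end

end

theory Submission
  imports Defs
begin

text \<open>
  In an orthonormal frame \<open>S\<close> the Cotton tensor has the entries \<open>g(C(S\<^sub>j, S\<^sub>k), Z)\<close> with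
  \<open>C\<close> the exterior derivative of the Schouten tensor. In dimension three its skew part corresponds
  under the Hodge star to the contraction of \<open>C\<close>, the sum over \<open>i\<close> of the \<open>g(C(S\<^sub>i, Z), S\<^sub>i)\<close>, which is the
  divergence of the Schouten tensor minus the differential of its trace. The trace is a quarter of the
  scalar curvature, and the divergence is a quarter of the differential of the scalar curvature
  by the contracted Bianchi identity \<open>2 div Ric = d scal\<close>. Hence the contraction is zero
  (\<open>cotton_form_trace\<close>) and the Cotton tensor is symmetric (\<open>cotton_tensor_symmetric\<close>).

  The contracted Bianchi identity (\<open>contracted_bianchi\<close>) is the trace of the second Bianchi identity
  (\<open>second_bianchi\<close>), which in turn rests on the Jacobi identity and the vanishing torsion. Two
  principles make the computation with vector fields legitimate. Operators that are linear over
  the functions depend only on the values of fields at a point (\<open>tensorial\<close>), so that curvature and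
  Cotton form can be evaluated on a local orthonormal frame; such frames come from Gram-Schmidt
  (\<open>gram_schmidt\<close>). And second derivatives of functions along fields commute up to the bracket
  (\<open>lie_bracket_commutator\<close>), which is Schwarz's theorem (\<open>second_derivative_symmetric\<close>); this gives
  the tensoriality of the curvature, its skewness with respect to the metric, and the Jacobi
  identity.

  In an orthonormal frame of fields \<open>E\<close> traces of tensors commute with covariant derivatives, because
  the coefficients \<open>g(\<nabla>\<^sub>X E\<^sub>i, E\<^sub>j)\<close> are skew (\<open>frame_derivative_cancel\<close>).
\<close>

section \<open>Calculus of smooth maps\<close>

lemma Ck_on_subset: "Ck_on k f S \<Longrightarrow> T \<subseteq> S \<Longrightarrow> Ck_on k f T"
  by (induction k arbitrary: f) (auto intro: continuous_on_subset differentiable_on_subset)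

lemma Ck_on_Suc_has_derivative:
  assumes "Ck_on (Suc k) f S" "open S" "x \<in> S"
  shows "(f has_derivative frechet_derivative f (at x)) (at x)"
  using assms by (simp add: differentiable_on_eq_differentiable_at frechet_derivative_works)

lemma Ck_on_cong:
  assumes "open S" "\<And>x. x \<in> S \<Longrightarrow> f x = g x"
  shows "Ck_on k f S \<longleftrightarrow> Ck_on k g S"
  using assms(2)
proof (induction k arbitrary: f g)
  case 0
  then show ?case by (simp cong: continuous_on_cong)
next
  case (Suc k)
  have diff: "f differentiable_on S \<longleftrightarrow> g differentiable_on S"
    unfolding differentiable_on_def differentiable_def
    using has_derivative_transform[of _ S f g] has_derivative_transform[of _ S g f] Suc.prems
    by metis
  have "frechet_derivative f (at x) = frechet_derivative g (at x)"
    if "f differentiable_on S" "x \<in> S" for x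
    using that assms(1) Suc.prems
    by (metis differentiable_on_eq_differentiable_at frechet_derivative_transform_within_open)
  then have "f differentiable_on S \<Longrightarrow>
      Ck_on k (\<lambda>x. frechet_derivative f (at x) v) S \<longleftrightarrow>
      Ck_on k (\<lambda>x. frechet_derivative g (at x) v) S" for v
    by (intro Suc.IH) auto
  with diff show ?case by auto
qed

lemma Ck_on_SucI:
  assumes "open S" "\<And>x. x \<in> S \<Longrightarrow> (f has_derivative f' x) (at x)"
    and "\<And>v. Ck_on k (\<lambda>x. f' x v) S"
  shows "Ck_on (Suc k) f S"
proof -
  have "f' x = frechet_derivative f (at x)" if "x \<in> S" for x
    using assms(2)[OF that] by (rule frechet_derivative_at)
  then have "Ck_on k (\<lambda>x. frechet_derivative f (at x) v) S" for v
    using assms(3)[of v] Ck_on_cong[OF assms(1), of "\<lambda>x. f' x v"] by auto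
  moreover have "f differentiable_on S"
    using assms(1,2) by (auto simp: differentiable_on_eq_differentiable_at differentiable_def)
  ultimately show ?thesis by simp
qed

lemma Ck_on_SucD: "Ck_on (Suc k) f S \<Longrightarrow> Ck_on k f S"
  by (induction k arbitrary: f) (auto simp: differentiable_imp_continuous_on)

lemma Ck_on_const: "open S \<Longrightarrow> Ck_on k (\<lambda>x. a) S"
proof (induction k arbitrary: a)
  case (Suc k)
  show ?case by (rule Ck_on_SucI[where f' = "\<lambda>x v. 0"]) (use Suc in auto)
qed simp

lemma Ck_on_bounded_linear:
  assumes "open S" "bounded_linear L"
  shows "Ck_on k f S \<Longrightarrow> Ck_on k (\<lambda>x. L (f x)) S"
proof (induction k arbitrary: f)
  case 0
  then show ?case
    using bounded_linear.continuous_on[OF assms(2)] by simp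
next
  case (Suc k)
  show ?case
    using Ck_on_Suc_has_derivative[OF Suc.prems assms(1)] Suc.prems
    by (intro Ck_on_SucI[where f' = "\<lambda>x v. L (frechet_derivative f (at x) v)"] assms Suc.IH)
       (auto intro: bounded_linear.has_derivative[OF assms(2)])
qed

lemma Ck_on_add:
  "open S \<Longrightarrow> Ck_on k f S \<Longrightarrow> Ck_on k h S \<Longrightarrow> Ck_on k (\<lambda>x. f x + h x) S"
proof (induction k arbitrary: f h)
  case (Suc k)
  show ?case
    using Suc.prems Ck_on_Suc_has_derivative[of k f S] Ck_on_Suc_has_derivative[of k h S]
    by (intro Ck_on_SucI[where f' = "\<lambda>x v. frechet_derivative f (at x) v
          + frechet_derivative h (at x) v"] Suc.IH)
       (auto intro!: has_derivative_add)
qed (simp add: continuous_on_add)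

lemma Ck_on_scaleR:
  fixes f :: "'a::real_normed_vector \<Rightarrow> real"
  shows "open S \<Longrightarrow> Ck_on k f S \<Longrightarrow> Ck_on k h S \<Longrightarrow> Ck_on k (\<lambda>x. f x *\<^sub>R h x) S"
proof (induction k arbitrary: f h)
  case (Suc k)
  show ?case
    using Suc.prems Ck_on_Suc_has_derivative[of k f S] Ck_on_Suc_has_derivative[of k h S]
      Ck_on_SucD[of k f S] Ck_on_SucD[of k h S]
    by (intro Ck_on_SucI[where f' = "\<lambda>x v. f x *\<^sub>R frechet_derivative h (at x) v
          + frechet_derivative f (at x) v *\<^sub>R h x"] Ck_on_add Suc.IH)
       (auto intro!: has_derivative_scaleR)
qed (simp add: continuous_on_scaleR)

lemma Ck_on_sum:
  "open S \<Longrightarrow> (\<And>i. i \<in> I \<Longrightarrow> Ck_on k (f i) S) \<Longrightarrow> Ck_on k (\<lambda>x. \<Sum>i\<in>I. f i x) S"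
  by (induction I rule: infinite_finite_induct) (auto intro: Ck_on_const Ck_on_add)

text \<open>The chain rule expresses the derivatives of a composition as sums of products of
  derivatives of \<open>g\<close> with partial derivatives of \<open>f\<close> along \<open>g\<close>, so that the induction
  hypothesis applies to the latter.\<close>

lemma Ck_on_compose:
  fixes g :: "'a::real_normed_vector \<Rightarrow> 'b::euclidean_space"
  assumes "open S" "open T" "g ` S \<subseteq> T"
  shows "Ck_on k f T \<Longrightarrow> Ck_on k g S \<Longrightarrow> Ck_on k (\<lambda>x. f (g x)) S"
proof (induction k arbitrary: f)
  case 0
  then show ?case using assms(3) by (auto intro: continuous_on_compose2)
next
  case (Suc k)
  let ?f' = "\<lambda>x v. frechet_derivative f (at (g x)) (frechet_derivative g (at x) v)"
  let ?e = "\<lambda>x v. \<Sum>b\<in>Basis. (frechet_derivative g (at x) v \<bullet> b) *\<^sub>R frechet_derivative f (at (g x)) b"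
  have f: "(f has_derivative frechet_derivative f (at (g x))) (at (g x))" if "x \<in> S" for x
    using Ck_on_Suc_has_derivative[OF Suc.prems(1) assms(2)] that assms(3) by blast
  have g: "(g has_derivative frechet_derivative g (at x)) (at x)" if "x \<in> S" for x
    using Ck_on_Suc_has_derivative[OF Suc.prems(2) assms(1) that] .
  have e: "?f' x v = ?e x v" if "x \<in> S" for x v
  proof -
    have lin: "linear (frechet_derivative f (at (g x)))"
      using f[OF that] has_derivative_linear by blast
    have "?f' x v = frechet_derivative f (at (g x))
        (\<Sum>b\<in>Basis. (frechet_derivative g (at x) v \<bullet> b) *\<^sub>R b)"
      by (simp add: euclidean_representation)
    also have "\<dots> = ?e x v" using lin by (simp add: linear_sum linear_cmul)
    finally show ?thesis .
  qed
  have "Ck_on k (\<lambda>x. frechet_derivative g (at x) v \<bullet> b) S" for v and b :: 'b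
    using Suc.prems(2) by (intro Ck_on_bounded_linear[OF assms(1) bounded_linear_inner_left]) simp
  then have "Ck_on k (\<lambda>x. ?e x v) S" for v
    using Suc.prems Ck_on_SucD[OF Suc.prems(2)] assms(1)
    by (intro Ck_on_sum Ck_on_scaleR) (auto intro: Suc.IH)
  then have "Ck_on k (\<lambda>x. ?f' x v) S" for v
    using Ck_on_cong[OF assms(1), of "\<lambda>x. ?f' x v" "\<lambda>x. ?e x v"] e by auto
  then show ?case
    using f g by (intro Ck_on_SucI[where f' = ?f'] assms(1)) (auto intro: has_derivative_compose)
qed

lemma Ck_on_powr:
  fixes f :: "'a::real_normed_vector \<Rightarrow> real"
  assumes "open S" "\<And>x. x \<in> S \<Longrightarrow> f x > 0"
  shows "Ck_on k f S \<Longrightarrow> Ck_on k (\<lambda>x. f x powr a) S"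
proof (induction k arbitrary: a)
  case 0
  then have "continuous_on S f" by simp
  then have "continuous_on S (\<lambda>x. f x powr a)"
    by (rule continuous_on_powr) (use assms(2) in \<open>auto dest!: assms(2)\<close>)
  then show ?case by simp
next
  case (Suc k)
  have "Ck_on k (\<lambda>x. (a *\<^sub>R f x powr (a - 1)) *\<^sub>R frechet_derivative f (at x) v) S" for v
    using Suc.prems Ck_on_SucD[OF Suc.prems] assms(1)
    by (intro Ck_on_scaleR Suc.IH Ck_on_const) auto
  moreover have "((\<lambda>x. f x powr a) has_derivative
      (\<lambda>v. (a *\<^sub>R f x powr (a - 1)) *\<^sub>R frechet_derivative f (at x) v)) (at x)" if "x \<in> S" for x
  proof -
    have "((\<lambda>y. y powr a) has_derivative (*) (a * f x powr (a - 1))) (at (f x))"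
      using has_real_derivative_powr[OF assms(2)[OF that], of a]
      by (simp add: has_field_derivative_def)
    from has_derivative_compose[OF Ck_on_Suc_has_derivative[OF Suc.prems assms(1) that] this]
    show ?thesis by simp
  qed
  ultimately show ?case
    by (intro Ck_on_SucI[where f' = "\<lambda>x v. (a *\<^sub>R f x powr (a - 1)) *\<^sub>R frechet_derivative f (at x) v"]
          assms(1)) auto
qed

lemma smooth_on_subset: "smooth_on f S \<Longrightarrow> T \<subseteq> S \<Longrightarrow> smooth_on f T"
  unfolding smooth_on_def by (blast intro: Ck_on_subset)

lemma smooth_on_cong: "open S \<Longrightarrow> (\<And>x. x \<in> S \<Longrightarrow> f x = g x) \<Longrightarrow> smooth_on f S \<longleftrightarrow> smooth_on g S"
  unfolding smooth_on_def using Ck_on_cong by blast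

lemma smooth_on_transform:
  "open S \<Longrightarrow> smooth_on f S \<Longrightarrow> (\<And>x. x \<in> S \<Longrightarrow> f x = g x) \<Longrightarrow> smooth_on g S"
  using smooth_on_cong[of S f g] by blast

lemma smooth_on_has_derivative:
  "smooth_on f S \<Longrightarrow> open S \<Longrightarrow> x \<in> S \<Longrightarrow> (f has_derivative frechet_derivative f (at x)) (at x)"
  unfolding smooth_on_def using Ck_on_Suc_has_derivative by blast

lemma smooth_on_frechet_derivative:
  "smooth_on f S \<Longrightarrow> smooth_on (\<lambda>x. frechet_derivative f (at x) v) S"
  unfolding smooth_on_def by (metis Ck_on.simps(2))

lemma smooth_on_const: "open S \<Longrightarrow> smooth_on (\<lambda>x. a) S"
  by (simp add: smooth_on_def Ck_on_const)

lemma smooth_on_bounded_linear: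
  "open S \<Longrightarrow> bounded_linear L \<Longrightarrow> smooth_on f S \<Longrightarrow> smooth_on (\<lambda>x. L (f x)) S"
  by (simp add: smooth_on_def Ck_on_bounded_linear)

lemma smooth_on_nth: "open S \<Longrightarrow> smooth_on f S \<Longrightarrow> smooth_on (\<lambda>x. f x $ i) S"
  by (rule smooth_on_bounded_linear[OF _ bounded_linear_vec_nth])

lemma smooth_on_add:
  "open S \<Longrightarrow> smooth_on f S \<Longrightarrow> smooth_on h S \<Longrightarrow> smooth_on (\<lambda>x. f x + h x) S"
  by (simp add: smooth_on_def Ck_on_add)

lemma smooth_on_scaleR:
  fixes f :: "'a::real_normed_vector \<Rightarrow> real"
  shows "open S \<Longrightarrow> smooth_on f S \<Longrightarrow> smooth_on h S \<Longrightarrow> smooth_on (\<lambda>x. f x *\<^sub>R h x) S"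
  by (simp add: smooth_on_def Ck_on_scaleR)

lemma smooth_on_sum:
  "open S \<Longrightarrow> (\<And>i. i \<in> I \<Longrightarrow> smooth_on (f i) S) \<Longrightarrow> smooth_on (\<lambda>x. \<Sum>i\<in>I. f i x) S"
  by (simp add: smooth_on_def Ck_on_sum)

lemma smooth_on_compose:
  fixes g :: "'a::real_normed_vector \<Rightarrow> 'b::euclidean_space"
  shows "open S \<Longrightarrow> open T \<Longrightarrow> g ` S \<subseteq> T \<Longrightarrow> smooth_on f T \<Longrightarrow> smooth_on g S
    \<Longrightarrow> smooth_on (\<lambda>x. f (g x)) S"
  by (simp add: smooth_on_def Ck_on_compose)

lemma smooth_on_powr:
  fixes f :: "'a::real_normed_vector \<Rightarrow> real"
  shows "open S \<Longrightarrow> (\<And>x. x \<in> S \<Longrightarrow> f x > 0) \<Longrightarrow> smooth_on f S \<Longrightarrow> smooth_on (\<lambda>x. f x powr a) S"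
  by (simp add: smooth_on_def Ck_on_powr)

lemma smooth_on_imp_continuous_on: "smooth_on f S \<Longrightarrow> continuous_on S f"
  unfolding smooth_on_def by (metis Ck_on.simps(1))

lemma linear_vec_expansion:
  fixes L :: "real ^ 'n \<Rightarrow> 'b::real_vector"
  assumes "linear L"
  shows "L x = (\<Sum>i\<in>UNIV. (x $ i) *\<^sub>R L (axis i 1))"
proof -
  have "L x = L (\<Sum>i\<in>UNIV. (x $ i) *\<^sub>R axis i 1)"
    using basis_expansion[of x] by (simp add: scalar_mult_eq_scaleR)
  also have "\<dots> = (\<Sum>i\<in>UNIV. (x $ i) *\<^sub>R L (axis i 1))"
    using assms by (simp add: linear_sum linear_cmul)
  finally show ?thesis .
qed

lemma DERIV_along_line:
  assumes "(f has_derivative f') (at (p + s *\<^sub>R v))"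
  shows "((\<lambda>s. f (p + s *\<^sub>R v)) has_real_derivative f' v) (at s)"
proof -
  have "((\<lambda>s. p + s *\<^sub>R v) has_derivative (\<lambda>h. h *\<^sub>R v)) (at s)"
    by (auto intro!: derivative_eq_intros)
  from has_derivative_compose[OF this assms] show ?thesis
    using has_derivative_linear[OF assms]
    by (simp add: has_field_derivative_def linear_cmul mult_commute_abs)
qed

text \<open>The mean value theorem is applied first in the direction of \<open>v\<close> to the difference of \<open>f\<close> along
  \<open>w\<close>, then in the direction of \<open>w\<close>; the second difference itself is symmetric in \<open>v\<close> and \<open>w\<close>.\<close>

lemma second_difference_mean_value:
  fixes f :: "'a::real_normed_vector \<Rightarrow> real" and x v w :: 'a
  assumes f: "Ck_on 2 f S" and "open S" and "t > 0" and "ball x r \<subseteq> S"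
    and t: "t * (norm v + norm w) < r"
  obtains y where "dist x y \<le> t * (norm v + norm w)"
    and "f (x + t *\<^sub>R v + t *\<^sub>R w) - f (x + t *\<^sub>R v) - f (x + t *\<^sub>R w) + f x
       = t * t * frechet_derivative (\<lambda>y. frechet_derivative f (at y) v) (at y) w"
proof -
  let ?F = "\<lambda>y. frechet_derivative f (at y) v"
  let ?H = "\<lambda>y. frechet_derivative ?F (at y) w"
  have dist: "dist x (x + a *\<^sub>R v + b *\<^sub>R w) \<le> t * (norm v + norm w)"
    if "0 \<le> a" "a \<le> t" "0 \<le> b" "b \<le> t" for a b
  proof -
    have "dist x (x + a *\<^sub>R v + b *\<^sub>R w) = norm (a *\<^sub>R v + b *\<^sub>R w)"
      by (metis add.assoc add_diff_cancel_left' dist_norm norm_minus_commute)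
    also have "\<dots> \<le> norm (a *\<^sub>R v) + norm (b *\<^sub>R w)" by (rule norm_triangle_ineq)
    also have "\<dots> \<le> t * (norm v + norm w)"
      using that by (simp add: distrib_left add_mono mult_right_mono)
    finally show ?thesis .
  qed
  have S: "x + a *\<^sub>R v + b *\<^sub>R w \<in> S" if "0 \<le> a" "a \<le> t" "0 \<le> b" "b \<le> t" for a b
    using dist[OF that] t assms(4) by (auto simp: subset_iff)
  have f1: "(f has_derivative frechet_derivative f (at y)) (at y)" if "y \<in> S" for y
    using Ck_on_Suc_has_derivative[of 1 f S y] f \<open>open S\<close> that by (simp add: numeral_2_eq_2)
  have f2: "(?F has_derivative frechet_derivative ?F (at y)) (at y)" if "y \<in> S" for y
    using Ck_on_Suc_has_derivative[of 0 ?F S y] f \<open>open S\<close> that by (simp add: numeral_2_eq_2)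
  let ?\<phi> = "\<lambda>s. f ((x + t *\<^sub>R w) + s *\<^sub>R v) - f (x + s *\<^sub>R v)"
  have "\<exists>a>0. a < t \<and> ?\<phi> t - ?\<phi> 0 = (t - 0) * (?F ((x + t *\<^sub>R w) + a *\<^sub>R v) - ?F (x + a *\<^sub>R v))"
  proof (rule MVT2[OF \<open>t > 0\<close>])
    fix s :: real assume s: "0 \<le> s" "s \<le> t"
    have "(x + t *\<^sub>R w) + s *\<^sub>R v \<in> S" "x + s *\<^sub>R v \<in> S"
      using S[of s t] S[of s 0] s \<open>t > 0\<close> by (auto simp: algebra_simps)
    then show "(?\<phi> has_real_derivative ?F ((x + t *\<^sub>R w) + s *\<^sub>R v) - ?F (x + s *\<^sub>R v)) (at s)"
      by (intro DERIV_diff DERIV_along_line f1)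
  qed
  then obtain a where a: "0 < a" "a < t"
    "?\<phi> t - ?\<phi> 0 = t * (?F ((x + t *\<^sub>R w) + a *\<^sub>R v) - ?F (x + a *\<^sub>R v))" by auto
  let ?\<psi> = "\<lambda>s. ?F ((x + a *\<^sub>R v) + s *\<^sub>R w)"
  have "\<exists>b>0. b < t \<and> ?\<psi> t - ?\<psi> 0 = (t - 0) * ?H ((x + a *\<^sub>R v) + b *\<^sub>R w)"
  proof (rule MVT2[OF \<open>t > 0\<close>])
    fix s :: real assume s: "0 \<le> s" "s \<le> t"
    have "x + a *\<^sub>R v + s *\<^sub>R w \<in> S" using S[of a s] s a by auto
    then show "(?\<psi> has_real_derivative ?H ((x + a *\<^sub>R v) + s *\<^sub>R w)) (at s)"
      by (intro DERIV_along_line f2)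
  qed
  then obtain b where b: "0 < b" "b < t" "?\<psi> t - ?\<psi> 0 = t * ?H (x + a *\<^sub>R v + b *\<^sub>R w)" by auto
  have "f (x + t *\<^sub>R v + t *\<^sub>R w) - f (x + t *\<^sub>R v) - f (x + t *\<^sub>R w) + f x = ?\<phi> t - ?\<phi> 0"
    by (simp add: algebra_simps)
  also have "\<dots> = t * (?\<psi> t - ?\<psi> 0)" unfolding a(3) by (simp add: algebra_simps)
  also have "\<dots> = t * t * ?H (x + a *\<^sub>R v + b *\<^sub>R w)" unfolding b(3) by simp
  finally show thesis using that dist[of a b] a b by auto
qed

text \<open>Schwarz's theorem: both orders of differentiation arise as limits of the same second
  difference quotient.\<close>

lemma second_derivative_symmetric:
  fixes f :: "'a::real_normed_vector \<Rightarrow> real"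
  assumes f: "Ck_on 2 f S" and S: "open S" "x \<in> S"
  shows "frechet_derivative (\<lambda>y. frechet_derivative f (at y) v) (at x) w
       = frechet_derivative (\<lambda>y. frechet_derivative f (at y) w) (at x) v"
proof -
  let ?H = "\<lambda>v w y. frechet_derivative (\<lambda>y. frechet_derivative f (at y) v) (at y) w"
  have cont: "continuous_on S (?H v w)" for v w
    using f by (simp add: numeral_2_eq_2)
  have "\<bar>?H v w x - ?H w v x\<bar> \<le> 0 + e" if "e > 0" for e
  proof -
    obtain d1 where d1: "d1 > 0" "\<And>y. y \<in> S \<Longrightarrow> dist y x < d1 \<Longrightarrow> \<bar>?H v w y - ?H v w x\<bar> < e / 2"
      using cont[of v w] S(2) \<open>e > 0\<close> unfolding continuous_on_iff dist_real_def
      by (meson half_gt_zero)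
    obtain d2 where d2: "d2 > 0" "\<And>y. y \<in> S \<Longrightarrow> dist y x < d2 \<Longrightarrow> \<bar>?H w v y - ?H w v x\<bar> < e / 2"
      using cont[of w v] S(2) \<open>e > 0\<close> unfolding continuous_on_iff dist_real_def
      by (meson half_gt_zero)
    obtain r0 where r0: "r0 > 0" "ball x r0 \<subseteq> S" using S open_contains_ball by blast
    define r where "r = Min {r0, d1, d2}"
    have r: "r > 0" "ball x r \<subseteq> S" "r \<le> d1" "r \<le> d2" using r0 d1(1) d2(1) by (auto simp: r_def)
    define t where "t = r / (norm v + norm w + 1)"
    have t: "t > 0" "t * (norm v + norm w) < r"
      using r(1) add_nonneg_pos[of "norm v + norm w" 1] by (simp_all add: t_def divide_simps)
    obtain y where y: "dist x y \<le> t * (norm v + norm w)"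
      "f (x + t *\<^sub>R v + t *\<^sub>R w) - f (x + t *\<^sub>R v) - f (x + t *\<^sub>R w) + f x = t * t * ?H v w y"
      using second_difference_mean_value[OF f S(1) t(1) r(2) t(2)] .
    obtain z where z: "dist x z \<le> t * (norm w + norm v)"
      "f (x + t *\<^sub>R w + t *\<^sub>R v) - f (x + t *\<^sub>R w) - f (x + t *\<^sub>R v) + f x = t * t * ?H w v z"
      using second_difference_mean_value[OF f S(1) t(1) r(2), of w v] t(2) by (auto simp: add.commute)
    have "t * t * ?H v w y = t * t * ?H w v z"
      unfolding y(2)[symmetric] z(2)[symmetric] by (simp add: algebra_simps)
    then have "?H v w y = ?H w v z" using t(1) by simp
    moreover have "y \<in> S" "dist y x < d1" "z \<in> S" "dist z x < d2"
      using y(1) z(1) t(2) r by (auto simp: dist_commute add.commute subset_iff)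
    ultimately show ?thesis using d1(2)[of y] d2(2)[of z] by (auto simp: abs_if split: if_splits)
  qed
  then have "\<bar>?H v w x - ?H w v x\<bar> \<le> 0" by (rule field_le_epsilon)
  then show ?thesis by simp
qed

section \<open>Charts and tangent spaces\<close>

context smooth_manifold
begin

lemma charts_atD: "c \<in> charts_at p \<Longrightarrow> c \<in> A" "c \<in> charts_at p \<Longrightarrow> p \<in> fst c"
  and charts_atI: "c \<in> A \<Longrightarrow> p \<in> fst c \<Longrightarrow> c \<in> charts_at p"
  by (auto simp: charts_at_def)

lemma chart_openin: "c \<in> A \<Longrightarrow> openin M (fst c)"
  using charts by (simp add: is_chart_def)

lemma chart_subset: "c \<in> A \<Longrightarrow> fst c \<subseteq> topspace M"
  using chart_openin openin_subset by blast

lemma chart_inj: assumes "c \<in> A" shows "inj_on (snd c) (fst c)"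
proof -
  have "topspace (subtopology M (fst c)) = fst c"
    using chart_subset[OF assms] by auto
  then show ?thesis
    using charts[OF assms] homeomorphic_imp_injective_map unfolding is_chart_def by fastforce
qed

lemma open_chart_image:
  assumes "c \<in> A" "openin M W"
  shows "open (snd c ` (W \<inter> fst c))"
proof -
  have "openin (subtopology M (fst c)) (W \<inter> fst c)"
    using assms(2) by (rule openin_subtopology_Int)
  then have "openin (top_of_set (snd c ` fst c)) (snd c ` (W \<inter> fst c))"
    using charts[OF assms(1)] homeomorphic_imp_open_map unfolding is_chart_def open_map_def by blast
  then show ?thesis
    using charts[OF assms(1)] openin_open_eq unfolding is_chart_def by blast
qed

lemma chart_inv_chart: "c \<in> A \<Longrightarrow> p \<in> fst c \<Longrightarrow> chart_inv c (snd c p) = p"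
  by (simp add: chart_inv_def chart_inj inv_into_f_f)

lemma chart_at_in: assumes "p \<in> topspace M" shows "chart_at p \<in> charts_at p"
proof -
  have "\<exists>c. c \<in> charts_at p" using assms cover unfolding charts_at_def by blast
  then show ?thesis unfolding chart_at_def by (rule someI_ex)
qed

text \<open>Around \<open>p\<close> the two coordinate expressions of \<open>f\<close> differ by the transition map. The case of a
  coordinate map is the cocycle rule for Jacobians; the case of a real function shows that directional
  derivatives do not depend on the chart.\<close>

lemma has_derivative_change_chart:
  fixes f :: "'a \<Rightarrow> 'b::real_normed_vector"
  assumes c: "c \<in> charts_at p" and d: "d \<in> charts_at p"
    and f: "((\<lambda>x. f (chart_inv d x)) has_derivative D) (at (snd d p))"
  shows "((\<lambda>x. f (chart_inv c x)) has_derivative (\<lambda>h. D (jacobian c d p h))) (at (snd c p))"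
proof -
  note A = charts_atD(1)[OF c] charts_atD(1)[OF d]
  have o: "open (snd c ` (fst d \<inter> fst c))" by (rule open_chart_image[OF A(1) chart_openin[OF A(2)]])
  then have o': "open (snd c ` (fst c \<inter> fst d))" by (simp add: Int_commute)
  have p: "snd c p \<in> snd c ` (fst c \<inter> fst d)" using c d by (auto simp: charts_at_def)
  have t: "(transition c d has_derivative jacobian c d p) (at (snd c p))"
    unfolding jacobian_def by (rule smooth_on_has_derivative[OF smooth_transition[OF A] o' p])
  have "transition c d (snd c p) = snd d p"
    using A(1) c by (simp add: transition_def chart_inv_chart charts_at_def)
  then have "((\<lambda>x. f (chart_inv d (transition c d x))) has_derivative (\<lambda>h. D (jacobian c d p h)))
      (at (snd c p))"
    using has_derivative_compose[OF t] f by simp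
  then show ?thesis
  proof (rule has_derivative_transform_within_open[OF _ o' p])
    fix x assume "x \<in> snd c ` (fst c \<inter> fst d)"
    then show "f (chart_inv d (transition c d x)) = f (chart_inv c x)"
      using A by (auto simp: transition_def chart_inv_chart)
  qed
qed

lemma transition_has_derivative:
  assumes "c \<in> charts_at p" "d \<in> charts_at p"
  shows "(transition c d has_derivative jacobian c d p) (at (snd c p))"
proof -
  note A = charts_atD(1)[OF assms(1)] charts_atD(1)[OF assms(2)]
  have "open (snd c ` (fst d \<inter> fst c))" by (rule open_chart_image[OF A(1) chart_openin[OF A(2)]])
  then show ?thesis
    unfolding jacobian_def using assms
    by (intro smooth_on_has_derivative[OF smooth_transition[OF A]])
       (auto simp: Int_commute charts_at_def)
qed

lemma linear_jacobian: "c \<in> charts_at p \<Longrightarrow> d \<in> charts_at p \<Longrightarrow> linear (jacobian c d p)"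
  using transition_has_derivative has_derivative_linear by blast

lemma jacobian_cocycle:
  assumes "c \<in> charts_at p" "d \<in> charts_at p" "e \<in> charts_at p"
  shows "jacobian d e p (jacobian c d p x) = jacobian c e p x"
proof -
  have "((\<lambda>x. snd e (chart_inv d x)) has_derivative jacobian d e p) (at (snd d p))"
    using transition_has_derivative[OF assms(2,3)] by (simp add: transition_def o_def)
  from has_derivative_change_chart[OF assms(1,2) this]
  have "(transition c e has_derivative (\<lambda>h. jacobian d e p (jacobian c d p h))) (at (snd c p))"
    by (simp add: transition_def o_def)
  from has_derivative_unique[OF this transition_has_derivative[OF assms(1,3)]]
  show ?thesis by (rule fun_cong)
qed

lemma jacobian_self:
  assumes c: "c \<in> charts_at p"
  shows "jacobian c c p x = x"
proof -
  have A: "c \<in> A" using c by (rule charts_atD)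
  have "((\<lambda>x. x) has_derivative (\<lambda>x. x)) (at (snd c p))" by simp
  then have "(transition c c has_derivative (\<lambda>x. x)) (at (snd c p))"
  proof (rule has_derivative_transform_within_open)
    show "open (snd c ` (fst c \<inter> fst c))" by (rule open_chart_image[OF A chart_openin[OF A]])
  qed (use c in \<open>auto simp: transition_def chart_inv_chart charts_at_def\<close>)
  from has_derivative_unique[OF this transition_has_derivative[OF c c]] show ?thesis by (metis (full_types))
qed

lemma tangent_spaceI:
  assumes "\<And>c. c \<notin> charts_at p \<Longrightarrow> v c = 0"
    and "\<And>c d. c \<in> charts_at p \<Longrightarrow> d \<in> charts_at p \<Longrightarrow> v d = jacobian c d p (v c)"
  shows "v \<in> tangent_space p"
  unfolding tangent_space_def using assms by blast

lemma tangent_spaceD: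
  assumes "v \<in> tangent_space p"
  shows "c \<notin> charts_at p \<Longrightarrow> v c = 0"
    and "c \<in> charts_at p \<Longrightarrow> d \<in> charts_at p \<Longrightarrow> v d = jacobian c d p (v c)"
  using assms unfolding tangent_space_def by blast+

lemma tangent_space_eqI:
  assumes "c \<in> charts_at p" "u \<in> tangent_space p" "v \<in> tangent_space p" "u c = v c"
  shows "u = v"
proof
  fix d show "u d = v d"
    using tangent_spaceD[OF assms(2)] tangent_spaceD[OF assms(3)] assms(1,4) by metis
qed

lemma tangent_of_coords_in:
  "c \<in> charts_at p \<Longrightarrow> tangent_of_coords c p x \<in> tangent_space p"
  by (rule tangent_spaceI) (simp_all add: tangent_of_coords_def jacobian_cocycle)

lemma tangent_of_coords_self: "c \<in> charts_at p \<Longrightarrow> tangent_of_coords c p x c = x"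
  by (simp add: tangent_of_coords_def jacobian_self)

lemma tangent_of_coords_eq:
  "c \<in> charts_at p \<Longrightarrow> v \<in> tangent_space p \<Longrightarrow> tangent_of_coords c p (v c) = v"
  by (rule tangent_space_eqI[of c]) (simp_all add: tangent_of_coords_in tangent_of_coords_self)

lemma tangent_zero: "0 \<in> tangent_space p"
  by (rule tangent_spaceI) (simp_all add: linear_0 linear_jacobian)

lemma tangent_add: "u \<in> tangent_space p \<Longrightarrow> v \<in> tangent_space p \<Longrightarrow> u + v \<in> tangent_space p"
  by (rule tangent_spaceI)
     (simp_all add: tangent_spaceD(1) linear_add[OF linear_jacobian] tangent_spaceD(2)[symmetric])

lemma tangent_scaleR: "u \<in> tangent_space p \<Longrightarrow> a *\<^sub>R u \<in> tangent_space p"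
  by (rule tangent_spaceI)
     (simp_all add: scaleR_fun_def tangent_spaceD(1) linear_cmul[OF linear_jacobian]
        tangent_spaceD(2)[symmetric])

lemma tangent_minus: "u \<in> tangent_space p \<Longrightarrow> - u \<in> tangent_space p"
  using tangent_scaleR[of u p "-1"] by simp

lemma tangent_diff: "u \<in> tangent_space p \<Longrightarrow> v \<in> tangent_space p \<Longrightarrow> u - v \<in> tangent_space p"
  using tangent_add[OF _ tangent_minus[of v]] by simp

lemma tangent_sum: "(\<And>i. i \<in> I \<Longrightarrow> u i \<in> tangent_space p) \<Longrightarrow> (\<Sum>i\<in>I. u i) \<in> tangent_space p"
  by (induction I rule: infinite_finite_induct) (auto intro: tangent_zero tangent_add)

lemma sum_apply: "(\<Sum>i\<in>I. f i) x = (\<Sum>i\<in>I. f i x)"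
  by (induction I rule: infinite_finite_induct) auto

lemma tangent_of_coords_add:
  "c \<in> charts_at p \<Longrightarrow> tangent_of_coords c p (x + y) = tangent_of_coords c p x + tangent_of_coords c p y"
  by (auto simp: tangent_of_coords_def linear_add linear_jacobian fun_eq_iff)

lemma tangent_of_coords_scaleR:
  "c \<in> charts_at p \<Longrightarrow> tangent_of_coords c p (a *\<^sub>R x) = a *\<^sub>R tangent_of_coords c p x"
  by (auto simp: tangent_of_coords_def linear_cmul linear_jacobian fun_eq_iff scaleR_fun_def)

lemma linear_tangent_of_coords: "c \<in> charts_at p \<Longrightarrow> linear (tangent_of_coords c p)"
  by (simp add: linear_iff tangent_of_coords_add tangent_of_coords_scaleR)

lemma tangent_expansion:
  assumes "c \<in> charts_at p" "v \<in> tangent_space p"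
  shows "v = (\<Sum>i\<in>UNIV. (v c $ i) *\<^sub>R tangent_of_coords c p (axis i 1))"
  using linear_vec_expansion[OF linear_tangent_of_coords[OF assms(1)], of "v c"]
    tangent_of_coords_eq[OF assms] by simp

section \<open>Directional derivatives\<close>

lemma smooth_fun_subset: "smooth_fun W f \<Longrightarrow> W' \<subseteq> W \<Longrightarrow> smooth_fun W' f"
  unfolding smooth_fun_def by (meson smooth_on_subset Int_mono image_mono order_refl)

lemma smooth_fun_cong:
  assumes "openin M W" "\<And>q. q \<in> W \<Longrightarrow> f q = f' q"
  shows "smooth_fun W f \<longleftrightarrow> smooth_fun W f'"
proof -
  have "smooth_on (\<lambda>x. f (chart_inv c x)) (snd c ` (W \<inter> fst c)) \<longleftrightarrow>
        smooth_on (\<lambda>x. f' (chart_inv c x)) (snd c ` (W \<inter> fst c))" if "c \<in> A" for c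
    by (rule smooth_on_cong[OF open_chart_image[OF that assms(1)]])
       (auto simp: chart_inv_chart that assms(2))
  then show ?thesis unfolding smooth_fun_def by blast
qed

lemma smooth_fun_const: "openin M W \<Longrightarrow> smooth_fun W (\<lambda>q. a)"
  unfolding smooth_fun_def by (auto intro: smooth_on_const open_chart_image)

lemma smooth_fun_add:
  "openin M W \<Longrightarrow> smooth_fun W f \<Longrightarrow> smooth_fun W h \<Longrightarrow> smooth_fun W (\<lambda>q. f q + h q)"
  unfolding smooth_fun_def by (auto intro: smooth_on_add open_chart_image)

lemma smooth_fun_mult:
  assumes "openin M W" "smooth_fun W f" "smooth_fun W h"
  shows "smooth_fun W (\<lambda>q. f q * h q)"
  using assms smooth_on_scaleR[OF open_chart_image[OF _ assms(1)]] unfolding smooth_fun_def by fastforce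

lemma smooth_fun_minus:
  assumes "openin M W" "smooth_fun W f" shows "smooth_fun W (\<lambda>q. - f q)"
  using smooth_fun_mult[OF assms(1) smooth_fun_const[OF assms(1), of "-1"] assms(2)] by simp

lemma smooth_fun_diff:
  "openin M W \<Longrightarrow> smooth_fun W f \<Longrightarrow> smooth_fun W h \<Longrightarrow> smooth_fun W (\<lambda>q. f q - h q)"
  using smooth_fun_add[OF _ _ smooth_fun_minus, of W f h] by simp

lemma smooth_fun_sum:
  "openin M W \<Longrightarrow> (\<And>i. i \<in> I \<Longrightarrow> smooth_fun W (f i)) \<Longrightarrow> smooth_fun W (\<lambda>q. \<Sum>i\<in>I. f i q)"
  unfolding smooth_fun_def by (intro ballI smooth_on_sum open_chart_image) blast+

lemma smooth_fun_powr:
  assumes "openin M W" "smooth_fun W f" "\<And>q. q \<in> W \<Longrightarrow> f q > 0"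
  shows "smooth_fun W (\<lambda>q. f q powr a)"
  unfolding smooth_fun_def
proof
  fix c assume c: "c \<in> A"
  show "smooth_on (\<lambda>x. f (chart_inv c x) powr a) (snd c ` (W \<inter> fst c))"
    using assms c
    by (intro smooth_on_powr open_chart_image) (auto simp: chart_inv_chart[OF c] smooth_fun_def)
qed

text \<open>By continuity, in a chart. This is what makes the normalisation of a nonvanishing field
  possible in a whole neighbourhood.\<close>

lemma smooth_fun_pos_openin:
  assumes W: "openin M W" "p \<in> W" and f: "smooth_fun W f" "f p > 0"
  obtains W' where "openin M W'" "p \<in> W'" "W' \<subseteq> W" "\<And>q. q \<in> W' \<Longrightarrow> f q > 0"
proof -
  have "p \<in> topspace M" using W openin_subset by blast
  then obtain c where c: "c \<in> A" "p \<in> fst c" using chart_at_in charts_atD by blast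
  let ?S = "snd c ` (W \<inter> fst c)" and ?h = "\<lambda>x. f (chart_inv c x)"
  have S: "open ?S" using open_chart_image[OF c(1) W(1)] .
  have "continuous_on ?S ?h"
    using f c by (auto simp: smooth_fun_def intro: smooth_on_imp_continuous_on)
  then have U: "open (?h -` {0<..} \<inter> ?S)"
    using S by (metis continuous_on_open_vimage open_greaterThan)
  let ?W = "{q \<in> topspace (subtopology M (fst c)). snd c q \<in> ?h -` {0<..} \<inter> ?S}"
  have "openin (top_of_set (snd c ` fst c)) (?h -` {0<..} \<inter> ?S)"
    using U by (intro open_subset) auto
  then have "openin (subtopology M (fst c)) ?W"
    using charts[OF c(1)] unfolding is_chart_def
    by (intro openin_continuous_map_preimage[OF homeomorphic_imp_continuous_map]) auto
  then have "openin M ?W" by (rule openin_trans_full[OF _ chart_openin[OF c(1)]])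
  moreover have "p \<in> ?W"
    using c W f chart_subset[OF c(1)] by (auto simp: chart_inv_chart)
  moreover have "?W \<subseteq> W"
    using c chart_inj[OF c(1)] by (auto dest: inj_onD)
  moreover have "f q > 0" if "q \<in> ?W" for q
    using that c by (auto simp: chart_inv_chart dest!: inj_onD[OF chart_inj[OF c(1)]])
  ultimately show thesis using that by blast
qed

lemma smooth_fun_has_derivative:
  assumes "openin M W" "smooth_fun W f" "p \<in> W" "c \<in> charts_at p"
  shows "((\<lambda>x. f (chart_inv c x)) has_derivative
    frechet_derivative (\<lambda>x. f (chart_inv c x)) (at (snd c p))) (at (snd c p))"
  by (rule smooth_on_has_derivative[of _ "snd c ` (W \<inter> fst c)"])
     (use assms in \<open>auto simp: smooth_fun_def charts_at_def intro: open_chart_image\<close>)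

lemma dir_deriv_chart:
  assumes "openin M W" "smooth_fun W f" "p \<in> W" and c: "c \<in> charts_at p"
    and "v \<in> tangent_space p"
  shows "dir_deriv f p v = frechet_derivative (\<lambda>x. f (chart_inv c x)) (at (snd c p)) (v c)"
proof -
  let ?D = "\<lambda>c. frechet_derivative (\<lambda>x. f (chart_inv c x)) (at (snd c p))"
  have "p \<in> topspace M" using assms(1,3) openin_subset by blast
  note d = chart_at_in[OF this]
  note D = smooth_fun_has_derivative[OF assms(1-3)]
  have "?D (chart_at p) = (\<lambda>h. ?D c (jacobian (chart_at p) c p h))"
    by (rule has_derivative_unique[OF D[OF d] has_derivative_change_chart[OF d c D[OF c]]])
  moreover have "v c = jacobian (chart_at p) c p (v (chart_at p))"
    by (rule tangent_spaceD(2)[OF assms(5) d c])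
  ultimately show ?thesis by (simp add: dir_deriv_def Let_def)
qed

lemma dir_deriv_eqI:
  assumes "p \<in> topspace M"
    and "((\<lambda>x. f (chart_inv (chart_at p) x)) has_derivative D) (at (snd (chart_at p) p))"
  shows "dir_deriv f p v = D (v (chart_at p))"
  using frechet_derivative_at[OF assms(2)] by (simp add: dir_deriv_def Let_def)

lemma dir_deriv_const: "dir_deriv (\<lambda>q. a) p v = 0"
  by (simp add: dir_deriv_def Let_def)

context
  fixes W f p
  assumes W: "openin M W" "p \<in> W" and f: "smooth_fun W f"
begin

lemma dir_deriv_has_derivative:
  "((\<lambda>x. f (chart_inv (chart_at p) x)) has_derivative
     (frechet_derivative (\<lambda>x. f (chart_inv (chart_at p) x)) (at (snd (chart_at p) p))))
     (at (snd (chart_at p) p))"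
  using smooth_fun_has_derivative[OF W(1) f W(2) chart_at_in] W openin_subset by blast

lemma dir_deriv_cong:
  assumes "\<And>q. q \<in> W \<Longrightarrow> f' q = f q"
  shows "dir_deriv f' p v = dir_deriv f p v"
proof -
  have p: "p \<in> topspace M" using W openin_subset by blast
  note c = charts_atD[OF chart_at_in[OF p]]
  have "((\<lambda>x. f' (chart_inv (chart_at p) x)) has_derivative
     (frechet_derivative (\<lambda>x. f (chart_inv (chart_at p) x)) (at (snd (chart_at p) p))))
     (at (snd (chart_at p) p))"
    by (rule has_derivative_transform_within_open[OF dir_deriv_has_derivative
          open_chart_image[OF c(1) W(1)]]) (use W c assms in \<open>auto simp: chart_inv_chart\<close>)
  then show ?thesis using dir_deriv_eqI[OF p] by (simp add: dir_deriv_def Let_def)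
qed

lemma dir_deriv_add:
  assumes "smooth_fun W h"
  shows "dir_deriv (\<lambda>q. f q + h q) p v = dir_deriv f p v + dir_deriv h p v"
proof -
  have p: "p \<in> topspace M" using W openin_subset by blast
  show ?thesis
    using dir_deriv_eqI[OF p has_derivative_add[OF dir_deriv_has_derivative
          smooth_fun_has_derivative[OF W(1) assms W(2) chart_at_in[OF p]]]]
    by (simp add: dir_deriv_def Let_def)
qed

lemma dir_deriv_mult:
  assumes "smooth_fun W h"
  shows "dir_deriv (\<lambda>q. f q * h q) p v = f p * dir_deriv h p v + h p * dir_deriv f p v"
proof -
  have p: "p \<in> topspace M" using W openin_subset by blast
  note c = charts_atD[OF chart_at_in[OF p]]
  show ?thesis
    using dir_deriv_eqI[OF p has_derivative_mult[OF dir_deriv_has_derivative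
          smooth_fun_has_derivative[OF W(1) assms W(2) chart_at_in[OF p]]]]
    by (simp add: dir_deriv_def Let_def chart_inv_chart c mult.commute)
qed

lemma dir_deriv_cmult: "dir_deriv (\<lambda>q. a * f q) p v = a * dir_deriv f p v"
proof -
  have p: "p \<in> topspace M" using W openin_subset by blast
  show ?thesis
    using dir_deriv_eqI[OF p has_derivative_mult_right[OF dir_deriv_has_derivative]]
    by (simp add: dir_deriv_def Let_def)
qed

lemma dir_deriv_diff:
  assumes "smooth_fun W h"
  shows "dir_deriv (\<lambda>q. f q - h q) p v = dir_deriv f p v - dir_deriv h p v"
proof -
  have p: "p \<in> topspace M" using W openin_subset by blast
  show ?thesis
    using dir_deriv_eqI[OF p has_derivative_diff[OF dir_deriv_has_derivative
          smooth_fun_has_derivative[OF W(1) assms W(2) chart_at_in[OF p]]]]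
    by (simp add: dir_deriv_def Let_def)
qed

end

lemma dir_deriv_sum:
  assumes W: "openin M W" "p \<in> W"
  shows "(\<And>i. i \<in> I \<Longrightarrow> smooth_fun W (f i)) \<Longrightarrow>
    dir_deriv (\<lambda>q. \<Sum>i\<in>I. f i q) p v = (\<Sum>i\<in>I. dir_deriv (f i) p v)"
  by (induction I rule: infinite_finite_induct)
     (simp_all add: dir_deriv_const dir_deriv_add[OF W] smooth_fun_sum W)

section \<open>Smooth vector fields and brackets\<close>

lemma smooth_field_tangent: "smooth_field W X \<Longrightarrow> p \<in> W \<Longrightarrow> X p \<in> tangent_space p"
  by (simp add: smooth_field_def)

lemma smooth_field_coord:
  "smooth_field W X \<Longrightarrow> c \<in> A \<Longrightarrow> smooth_on (\<lambda>x. X (chart_inv c x) c) (snd c ` (W \<inter> fst c))"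
  by (simp add: smooth_field_def)

lemma smooth_field_subset: "smooth_field W X \<Longrightarrow> W' \<subseteq> W \<Longrightarrow> smooth_field W' X"
  unfolding smooth_field_def by (meson smooth_on_subset Int_mono image_mono order_refl subsetD)

lemma smooth_field_cong:
  assumes "openin M W" "\<And>q. q \<in> W \<Longrightarrow> X q = X' q"
  shows "smooth_field W X \<longleftrightarrow> smooth_field W X'"
proof -
  have "smooth_on (\<lambda>x. X (chart_inv c x) c) (snd c ` (W \<inter> fst c)) \<longleftrightarrow>
        smooth_on (\<lambda>x. X' (chart_inv c x) c) (snd c ` (W \<inter> fst c))" if "c \<in> A" for c
    by (rule smooth_on_cong[OF open_chart_image[OF that assms(1)]])
       (auto simp: chart_inv_chart that assms(2))
  then show ?thesis unfolding smooth_field_def by (simp add: assms(2))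
qed

lemma smooth_field_add:
  "openin M W \<Longrightarrow> smooth_field W X \<Longrightarrow> smooth_field W Y \<Longrightarrow> smooth_field W (X + Y)"
  unfolding smooth_field_def by (auto intro: smooth_on_add open_chart_image tangent_add)

lemma smooth_field_scaleR:
  "openin M W \<Longrightarrow> smooth_fun W f \<Longrightarrow> smooth_field W X \<Longrightarrow> smooth_field W (\<lambda>q. f q *\<^sub>R X q)"
  unfolding smooth_field_def smooth_fun_def scaleR_fun_def
  by (auto intro: smooth_on_scaleR open_chart_image tangent_scaleR[unfolded scaleR_fun_def])

lemma smooth_field_cscaleR:
  "openin M W \<Longrightarrow> smooth_field W X \<Longrightarrow> smooth_field W (\<lambda>q. a *\<^sub>R X q)"
  by (intro smooth_field_scaleR smooth_fun_const)

lemma diff_field_eq: "(X - Y :: ('a, 'n) vector_field) = X + (\<lambda>q. (-1) *\<^sub>R Y q)"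
  by (simp add: fun_eq_iff)

lemma smooth_field_diff:
  "openin M W \<Longrightarrow> smooth_field W X \<Longrightarrow> smooth_field W Y \<Longrightarrow> smooth_field W (X - Y)"
  unfolding diff_field_eq by (intro smooth_field_add smooth_field_cscaleR)

lemma smooth_field_sum:
  assumes "openin M W" "\<And>i. i \<in> I \<Longrightarrow> smooth_field W (X i)"
  shows "smooth_field W (\<lambda>q. \<Sum>i\<in>I. X i q)"
  unfolding smooth_field_def
proof (intro conjI ballI)
  fix p assume "p \<in> W"
  then show "(\<Sum>i\<in>I. X i p) \<in> tangent_space p"
    by (intro tangent_sum smooth_field_tangent[OF assms(2)])
next
  fix c assume c: "c \<in> A"
  show "smooth_on (\<lambda>x. (\<Sum>i\<in>I. X i (chart_inv c x)) c) (snd c ` (W \<inter> fst c))"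
    unfolding sum_apply
    by (intro smooth_on_sum open_chart_image c assms(1) smooth_field_coord[OF assms(2)])
qed

lemma transition_smooth_image:
  assumes "c \<in> A" "d \<in> A" "openin M W"
  shows "open (snd d ` (W \<inter> fst c \<inter> fst d))"
    and "transition d c ` (snd d ` (W \<inter> fst c \<inter> fst d)) = snd c ` (W \<inter> fst c \<inter> fst d)"
    and "smooth_on (transition d c) (snd d ` (W \<inter> fst c \<inter> fst d))"
proof -
  show "open (snd d ` (W \<inter> fst c \<inter> fst d))"
    by (rule open_chart_image[OF assms(2) openin_Int[OF assms(3) chart_openin[OF assms(1)]]])
  show "transition d c ` (snd d ` (W \<inter> fst c \<inter> fst d)) = snd c ` (W \<inter> fst c \<inter> fst d)"
    by (auto simp: image_image transition_def chart_inv_chart assms intro!: image_cong)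
  show "smooth_on (transition d c) (snd d ` (W \<inter> fst c \<inter> fst d))"
    by (rule smooth_on_subset[OF smooth_transition[OF assms(2,1)]]) auto
qed

text \<open>The coordinate expressions in the other charts are compositions with transition maps, so a single
  chart suffices.\<close>

lemma smooth_fun_chartI:
  assumes c: "c \<in> A" and W: "openin M W" "W \<subseteq> fst c"
    and f: "smooth_on (\<lambda>x. f (chart_inv c x)) (snd c ` W)"
  shows "smooth_fun W f"
  unfolding smooth_fun_def
proof
  fix d assume d: "d \<in> A"
  have W': "W \<inter> fst c = W" using W by auto
  note t = transition_smooth_image[OF c d W(1), unfolded W']
  have o: "open (snd c ` W)" using open_chart_image[OF c W(1)] W' by simp
  have "smooth_on (\<lambda>x. f (chart_inv c (transition d c x))) (snd d ` (W \<inter> fst d))"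
    by (rule smooth_on_compose[OF t(1) o _ f t(3)]) (use t(2) in auto)
  moreover have "f (chart_inv c (transition d c x)) = f (chart_inv d x)"
    if "x \<in> snd d ` (W \<inter> fst d)" for x
    using that c d W by (auto simp: transition_def chart_inv_chart)
  ultimately show "smooth_on (\<lambda>x. f (chart_inv d x)) (snd d ` (W \<inter> fst d))"
    by (rule smooth_on_transform[OF t(1)])
qed

lemma smooth_fun_component:
  assumes "c \<in> A" "openin M W" "W \<subseteq> fst c" "smooth_field W X"
  shows "smooth_fun W (\<lambda>q. X q c $ i)"
proof (rule smooth_fun_chartI[OF assms(1-3)])
  have "W \<inter> fst c = W" using assms by auto
  then show "smooth_on (\<lambda>x. X (chart_inv c x) c $ i) (snd c ` W)"
    using open_chart_image[OF assms(1,2)] smooth_field_coord[OF assms(4,1)]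
    by (auto intro: smooth_on_nth)
qed

text \<open>The components of a coordinate field in another chart are derivatives of the transition map.\<close>

lemma smooth_coordinate_field:
  assumes c: "c \<in> A"
  shows "smooth_field (fst c) (\<lambda>q. tangent_of_coords c q x)"
  unfolding smooth_field_def
proof (intro conjI ballI)
  fix p assume "p \<in> fst c"
  then show "tangent_of_coords c p x \<in> tangent_space p"
    using c by (intro tangent_of_coords_in charts_atI)
next
  fix d assume d: "d \<in> A"
  note t = transition_smooth_image[OF c d chart_openin[OF c], simplified]
  let ?D = "\<lambda>y. frechet_derivative (transition c d) (at y) x"
  have o: "open (snd c ` (fst c \<inter> fst d))"
    using open_chart_image[OF c chart_openin[OF d]] by (simp add: Int_commute)
  have "smooth_on (\<lambda>y. ?D (transition d c y)) (snd d ` (fst c \<inter> fst d))"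
    by (rule smooth_on_compose[OF t(1) o _
          smooth_on_frechet_derivative[OF smooth_transition[OF c d]] t(3)]) (use t(2) in auto)
  moreover have "?D (transition d c y) = tangent_of_coords c (chart_inv d y) x d"
    if "y \<in> snd d ` (fst c \<inter> fst d)" for y
    using that c d by (auto simp: transition_def chart_inv_chart tangent_of_coords_def
        jacobian_def charts_at_def)
  ultimately show "smooth_on (\<lambda>y. tangent_of_coords c (chart_inv d y) x d) (snd d ` (fst c \<inter> fst d))"
    by (rule smooth_on_transform[OF t(1)])
qed

lemma extension_ex:
  assumes "p \<in> topspace M" "v \<in> tangent_space p"
  obtains W where "openin M W" "p \<in> W" "smooth_field W (extension p v)" "extension p v p = v"
proof -
  note c = chart_at_in[OF assms(1)]
  have "\<exists>X W. openin M W \<and> p \<in> W \<and> smooth_field W X \<and> X p = v"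
    using smooth_coordinate_field[OF charts_atD(1)[OF c], of "v (chart_at p)"]
      tangent_of_coords_eq[OF c assms(2)] charts_atD[OF c] chart_openin by blast
  from someI_ex[OF this, folded extension_def] show thesis using that by blast
qed

lemma dir_deriv_expansion:
  assumes "openin M W" "smooth_fun W f" "p \<in> W" and c: "c \<in> charts_at p"
    and "v \<in> tangent_space p"
  shows "dir_deriv f p v = (\<Sum>i\<in>UNIV. v c $ i *
    frechet_derivative (\<lambda>x. f (chart_inv c x)) (at (snd c p)) (axis i 1))"
  unfolding dir_deriv_chart[OF assms]
  by (subst linear_vec_expansion[OF has_derivative_linear[OF smooth_fun_has_derivative[OF assms(1-4)]]])
     simp

lemma smooth_dir_deriv:
  assumes W: "openin M W" and f: "smooth_fun W f" and X: "smooth_field W X"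
  shows "smooth_fun W (\<lambda>q. dir_deriv f q (X q))"
  unfolding smooth_fun_def
proof
  fix c assume c: "c \<in> A"
  let ?S = "snd c ` (W \<inter> fst c)" and ?h = "\<lambda>x. f (chart_inv c x)"
  note S = open_chart_image[OF c W]
  have "smooth_on (\<lambda>x. \<Sum>i\<in>UNIV. (X (chart_inv c x) c $ i) *\<^sub>R frechet_derivative ?h (at x) (axis i 1)) ?S"
    using f X c S
    by (intro smooth_on_sum smooth_on_scaleR smooth_on_nth smooth_on_frechet_derivative)
       (auto simp: smooth_fun_def smooth_field_def)
  moreover have "(\<Sum>i\<in>UNIV. (X (chart_inv c x) c $ i) *\<^sub>R frechet_derivative ?h (at x) (axis i 1))
      = dir_deriv f (chart_inv c x) (X (chart_inv c x))"
    if x: "x \<in> ?S" for x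
  proof -
    obtain q where q: "q \<in> W" "q \<in> fst c" "x = snd c q" using x by blast
    then show ?thesis
      using dir_deriv_expansion[OF W f q(1) charts_atI[OF c q(2)] smooth_field_tangent[OF X q(1)]] c
      by (simp add: chart_inv_chart)
  qed
  ultimately show "smooth_on (\<lambda>x. dir_deriv f (chart_inv c x) (X (chart_inv c x))) ?S"
    by (rule smooth_on_transform[OF S])
qed

text \<open>The first-order part of both sides is the definition of the bracket; the second-order part
  cancels by the symmetry of second derivatives.\<close>

lemma lie_bracket_commutator:
  assumes W: "openin M W" and p: "p \<in> W" and f: "smooth_fun W f"
    and X: "smooth_field W X" and Y: "smooth_field W Y"
    and L: "lie_bracket X Y p \<in> tangent_space p"
  shows "dir_deriv (\<lambda>q. dir_deriv f q (Y q)) p (X p) - dir_deriv (\<lambda>q. dir_deriv f q (X q)) p (Y p)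
       = dir_deriv f p (lie_bracket X Y p)"
proof -
  have pM: "p \<in> topspace M" using W p openin_subset by blast
  define c where "c = chart_at p"
  have c: "c \<in> charts_at p" unfolding c_def by (rule chart_at_in[OF pM])
  note cA = charts_atD[OF c]
  let ?S = "snd c ` (W \<inter> fst c)" and ?h = "\<lambda>x. f (chart_inv c x)" and ?x = "snd c p"
  let ?D = "\<lambda>i x. frechet_derivative ?h (at x) (axis i 1)"
  have S: "open ?S" "?x \<in> ?S" using open_chart_image[OF cA(1) W] p cA by auto
  have h: "smooth_on ?h ?S" using f cA by (simp add: smooth_fun_def)
  have D: "((?D i) has_derivative frechet_derivative (?D i) (at ?x)) (at ?x)" for i
    by (rule smooth_on_has_derivative[OF smooth_on_frechet_derivative[OF h] S])
  have sym: "frechet_derivative (?D i) (at ?x) (axis j 1) = frechet_derivative (?D j) (at ?x) (axis i 1)"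
    for i j
    using h S unfolding smooth_on_def by (blast intro: second_derivative_symmetric)
  have main: "dir_deriv (\<lambda>q. dir_deriv f q (Z q)) p (V p) =
      frechet_derivative ?h (at ?x) (frechet_derivative (\<lambda>x. Z (chart_inv c x) c) (at ?x) (V p c))
      + (\<Sum>i\<in>UNIV. \<Sum>j\<in>UNIV. Z p c $ i * V p c $ j * frechet_derivative (?D i) (at ?x) (axis j 1))"
    if Z: "smooth_field W Z" and V: "smooth_field W V" for Z V
  proof -
    let ?z = "\<lambda>x. Z (chart_inv c x) c" and ?z' = "frechet_derivative (\<lambda>x. Z (chart_inv c x) c) (at ?x)"
    have z: "(?z has_derivative ?z') (at ?x)"
      by (rule smooth_on_has_derivative[OF smooth_field_coord[OF Z cA(1)] S])
    have zi: "((\<lambda>x. ?z x $ i) has_derivative (\<lambda>h. ?z' h $ i)) (at ?x)" for i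
      by (rule bounded_linear.has_derivative[OF bounded_linear_vec_nth z])
    have "((\<lambda>x. \<Sum>i\<in>UNIV. ?z x $ i * ?D i x) has_derivative
        (\<lambda>h. \<Sum>i\<in>UNIV. ?z ?x $ i * frechet_derivative (?D i) (at ?x) h + ?z' h $ i * ?D i ?x)) (at ?x)"
      by (intro has_derivative_sum has_derivative_mult zi D)
    then have "((\<lambda>x. dir_deriv f (chart_inv c x) (Z (chart_inv c x))) has_derivative
        (\<lambda>h. \<Sum>i\<in>UNIV. ?z ?x $ i * frechet_derivative (?D i) (at ?x) h + ?z' h $ i * ?D i ?x)) (at ?x)"
    proof (rule has_derivative_transform_within_open[OF _ S])
      fix x assume "x \<in> ?S"
      then obtain q where q: "q \<in> W" "q \<in> fst c" "x = snd c q" by blast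
      then show "(\<Sum>i\<in>UNIV. ?z x $ i * ?D i x) = dir_deriv f (chart_inv c x) (Z (chart_inv c x))"
        using dir_deriv_expansion[OF W f q(1) charts_atI[OF cA(1) q(2)] smooth_field_tangent[OF Z q(1)]] cA
        by (simp add: chart_inv_chart)
    qed
    then have "dir_deriv (\<lambda>q. dir_deriv f q (Z q)) p (V p) = (\<Sum>i\<in>UNIV. Z p c $ i *
        frechet_derivative (?D i) (at ?x) (V p c) + ?z' (V p c) $ i * ?D i ?x)"
      using dir_deriv_eqI[OF pM, folded c_def] by (simp add: chart_inv_chart cA)
    also have "\<dots> = (\<Sum>i\<in>UNIV. ?z' (V p c) $ i * ?D i ?x)
        + (\<Sum>i\<in>UNIV. Z p c $ i * frechet_derivative (?D i) (at ?x) (V p c))"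
      by (simp add: sum.distrib)
    also have "(\<Sum>i\<in>UNIV. ?z' (V p c) $ i * ?D i ?x) = frechet_derivative ?h (at ?x) (?z' (V p c))"
      using linear_vec_expansion[OF has_derivative_linear[OF smooth_on_has_derivative[OF h S]],
        of "?z' (V p c)"] by simp
    also have "(\<Sum>i\<in>UNIV. Z p c $ i * frechet_derivative (?D i) (at ?x) (V p c)) =
        (\<Sum>i\<in>UNIV. \<Sum>j\<in>UNIV. Z p c $ i * V p c $ j * frechet_derivative (?D i) (at ?x) (axis j 1))"
      by (subst linear_vec_expansion[OF has_derivative_linear[OF D]])
         (simp add: sum_distrib_left mult.assoc)
    finally show ?thesis .
  qed
  have "(\<Sum>i\<in>UNIV. \<Sum>j\<in>UNIV. Y p c $ i * X p c $ j * frechet_derivative (?D i) (at ?x) (axis j 1))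
      = (\<Sum>i\<in>UNIV. \<Sum>j\<in>UNIV. X p c $ i * Y p c $ j * frechet_derivative (?D i) (at ?x) (axis j 1))"
    by (subst sum.swap) (simp add: sym mult.commute mult.left_commute)
  then have "dir_deriv (\<lambda>q. dir_deriv f q (Y q)) p (X p) - dir_deriv (\<lambda>q. dir_deriv f q (X q)) p (Y p)
    = frechet_derivative ?h (at ?x) (frechet_derivative (\<lambda>x. Y (chart_inv c x) c) (at ?x) (X p c))
    - frechet_derivative ?h (at ?x) (frechet_derivative (\<lambda>x. X (chart_inv c x) c) (at ?x) (Y p c))"
    by (simp add: main X Y)
  also have "\<dots> = frechet_derivative ?h (at ?x) (lie_bracket X Y p c)"
    using linear_diff[OF has_derivative_linear[OF smooth_on_has_derivative[OF h S]]] c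
    by (simp add: lie_bracket_def)
  also have "\<dots> = dir_deriv f p (lie_bracket X Y p)"
    using dir_deriv_chart[OF W f p c L] by simp
  finally show ?thesis .
qed

text \<open>The components of fields in a fixed chart are smooth functions, and the coordinate formula for the
  bracket becomes a formula about directional derivatives of these functions.\<close>

lemma lie_bracket_component:
  assumes W: "openin M W" "p \<in> W" "W \<subseteq> fst c" and c: "c \<in> A"
    and X: "smooth_field W X" and Y: "smooth_field W Y"
  shows "lie_bracket X Y p c $ i =
    dir_deriv (\<lambda>q. Y q c $ i) p (X p) - dir_deriv (\<lambda>q. X q c $ i) p (Y p)"
proof -
  have cp: "c \<in> charts_at p" using W c by (auto simp: charts_at_def)
  have *: "dir_deriv (\<lambda>q. Z q c $ i) p (V p) =
      frechet_derivative (\<lambda>x. Z (chart_inv c x) c) (at (snd c p)) (V p c) $ i"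
    if Z: "smooth_field W Z" and V: "smooth_field W V" for Z V
  proof -
    have "((\<lambda>x. Z (chart_inv c x) c) has_derivative
        frechet_derivative (\<lambda>x. Z (chart_inv c x) c) (at (snd c p))) (at (snd c p))"
      using W c by (intro smooth_on_has_derivative[OF smooth_field_coord[OF Z c]] open_chart_image) auto
    from bounded_linear.has_derivative[OF bounded_linear_vec_nth this, of i]
    have "(\<lambda>h. frechet_derivative (\<lambda>x. Z (chart_inv c x) c) (at (snd c p)) h $ i)
        = frechet_derivative (\<lambda>x. Z (chart_inv c x) c $ i) (at (snd c p))"
      by (rule frechet_derivative_at)
    then show ?thesis
      using dir_deriv_chart[OF W(1) smooth_fun_component[OF c W(1,3) Z] W(2) cp
          smooth_field_tangent[OF V W(2)]] by metis
  qed
  show ?thesis using cp by (simp add: lie_bracket_def * X Y)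
qed

text \<open>In a chart the difference of \<open>X\<close> and \<open>X'\<close> is a combination of coordinate fields with coefficients
  that vanish at \<open>p\<close>. The hypotheses are restricted to neighbourhoods inside \<open>W0\<close> since the operators
  of interest have further arguments that are smooth only there.\<close>

lemma tensorial:
  fixes \<Phi> :: "('a, 'n) vector_field \<Rightarrow> 'b::real_vector"
  assumes W0: "openin M W0" "p \<in> W0"
    and add: "\<And>W X Y. openin M W \<Longrightarrow> p \<in> W \<Longrightarrow> W \<subseteq> W0 \<Longrightarrow> smooth_field W X \<Longrightarrow> smooth_field W Y
      \<Longrightarrow> \<Phi> (X + Y) = \<Phi> X + \<Phi> Y"
    and scale: "\<And>W f X. openin M W \<Longrightarrow> p \<in> W \<Longrightarrow> W \<subseteq> W0 \<Longrightarrow> smooth_fun W f \<Longrightarrow> smooth_field W X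
      \<Longrightarrow> \<Phi> (\<lambda>q. f q *\<^sub>R X q) = f p *\<^sub>R \<Phi> X"
    and loc: "\<And>W X X'. openin M W \<Longrightarrow> p \<in> W \<Longrightarrow> W \<subseteq> W0 \<Longrightarrow> smooth_field W X
      \<Longrightarrow> (\<And>q. q \<in> W \<Longrightarrow> X' q = X q) \<Longrightarrow> \<Phi> X' = \<Phi> X"
    and W1: "openin M W1" "p \<in> W1" "smooth_field W1 X"
    and W2: "openin M W2" "p \<in> W2" "smooth_field W2 X'"
    and eq: "X p = X' p"
  shows "\<Phi> X = \<Phi> X'"
proof -
  define c where "c = chart_at p"
  have c: "c \<in> charts_at p" unfolding c_def using W0 openin_subset chart_at_in by blast
  note cA = charts_atD[OF c]
  define W where "W = W0 \<inter> W1 \<inter> W2 \<inter> fst c"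
  have W: "openin M W" "p \<in> W" "W \<subseteq> W0" "W \<subseteq> fst c"
    unfolding W_def using W0 W1 W2 cA chart_openin[OF cA(1)] by auto
  have X: "smooth_field W X" "smooth_field W X'"
    by (auto simp: W_def intro: smooth_field_subset[OF W1(3)] smooth_field_subset[OF W2(3)])
  let ?Z = "X - X'" and ?e = "\<lambda>i q. tangent_of_coords c q (axis i 1)"
  have Z: "smooth_field W ?Z" by (intro smooth_field_diff W X)
  have e: "smooth_field W (?e i)" for i
    by (rule smooth_field_subset[OF smooth_coordinate_field[OF cA(1)] W(4)])
  have Ze: "smooth_field W (\<lambda>q. (?Z q c $ i) *\<^sub>R ?e i q)" for i
    by (intro smooth_field_scaleR smooth_fun_component W cA Z e)
  have sum: "\<Phi> (\<lambda>q. \<Sum>i\<in>I. (?Z q c $ i) *\<^sub>R ?e i q) = 0" if "finite I" for I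
    using that
  proof (induction I)
    case empty
    have "\<Phi> (\<lambda>q. 0 *\<^sub>R X q) = 0 *\<^sub>R \<Phi> X"
      by (rule scale[OF W(1-3) smooth_fun_const[OF W(1)] X(1)])
    then show ?case by (simp only: scaleR_zero_left sum.empty)
  next
    case (insert i I)
    have "\<Phi> (\<lambda>q. \<Sum>i\<in>insert i I. (?Z q c $ i) *\<^sub>R ?e i q) =
        \<Phi> ((\<lambda>q. (?Z q c $ i) *\<^sub>R ?e i q) + (\<lambda>q. \<Sum>i\<in>I. (?Z q c $ i) *\<^sub>R ?e i q))"
      using insert.hyps by (simp add: plus_fun_def)
    also have "\<dots> = \<Phi> (\<lambda>q. (?Z q c $ i) *\<^sub>R ?e i q) + 0"
      by (subst add[OF W(1-3) Ze smooth_field_sum[OF W(1) Ze]]) (simp only: insert.IH)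
    also have "\<Phi> (\<lambda>q. (?Z q c $ i) *\<^sub>R ?e i q) = (?Z p c $ i) *\<^sub>R \<Phi> (?e i)"
      by (rule scale[OF W(1-3) smooth_fun_component[OF cA(1) W(1,4) Z] e])
    finally show ?case by (simp add: eq)
  qed
  have "\<Phi> ?Z = \<Phi> (\<lambda>q. \<Sum>i\<in>UNIV. (?Z q c $ i) *\<^sub>R ?e i q)"
  proof (rule loc[OF W(1-3)])
    show "smooth_field W (\<lambda>q. \<Sum>i\<in>UNIV. (?Z q c $ i) *\<^sub>R ?e i q)"
      by (rule smooth_field_sum[OF W(1) Ze])
    fix q assume "q \<in> W"
    then show "?Z q = (\<Sum>i\<in>UNIV. (?Z q c $ i) *\<^sub>R ?e i q)"
      using W(4) cA by (intro tangent_expansion smooth_field_tangent[OF Z]) (auto simp: charts_at_def)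
  qed
  then have "\<Phi> ?Z = 0" using sum[of UNIV] by simp
  moreover have "\<Phi> (\<lambda>q. (-1) *\<^sub>R X' q) = (-1) *\<^sub>R \<Phi> X'"
    by (rule scale[OF W(1-3) smooth_fun_const[OF W(1)] X(2)])
  then have "\<Phi> ?Z = \<Phi> X - \<Phi> X'"
    unfolding diff_field_eq
    by (subst add[OF W(1-3) X(1) smooth_field_cscaleR[OF W(1) X(2)]]) simp
  ultimately show ?thesis by simp
qed

end

section \<open>Linear forms on tangent spaces and orthonormal frames\<close>

context smooth_manifold
begin

definition tangent_linear :: "'a \<Rightarrow> (('a, 'n) tangent_vector \<Rightarrow> 'b::real_vector) \<Rightarrow> bool" where
  "tangent_linear p F \<longleftrightarrow>
     (\<forall>u\<in>tangent_space p. \<forall>v\<in>tangent_space p. F (u + v) = F u + F v) \<and>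
     (\<forall>a. \<forall>u\<in>tangent_space p. F (a *\<^sub>R u) = a *\<^sub>R F u)"

definition tangent_bilinear ::
  "'a \<Rightarrow> (('a, 'n) tangent_vector \<Rightarrow> ('a, 'n) tangent_vector \<Rightarrow> real) \<Rightarrow> bool" where
  "tangent_bilinear p h \<longleftrightarrow>
     (\<forall>u\<in>tangent_space p. tangent_linear p (h u) \<and> tangent_linear p (\<lambda>v. h v u))"

lemma tangent_linearI:
  assumes "\<And>u v. u \<in> tangent_space p \<Longrightarrow> v \<in> tangent_space p \<Longrightarrow> F (u + v) = F u + F v"
    and "\<And>a u. u \<in> tangent_space p \<Longrightarrow> F (a *\<^sub>R u) = a *\<^sub>R F u"
  shows "tangent_linear p F"
  using assms unfolding tangent_linear_def by blast

lemma tangent_bilinearI: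
  assumes "\<And>u. u \<in> tangent_space p \<Longrightarrow> tangent_linear p (h u)"
    and "\<And>u. u \<in> tangent_space p \<Longrightarrow> tangent_linear p (\<lambda>v. h v u)"
  shows "tangent_bilinear p h"
  using assms unfolding tangent_bilinear_def by blast

lemma tangent_bilinearD:
  assumes "tangent_bilinear p h" "u \<in> tangent_space p"
  shows "tangent_linear p (h u)" "tangent_linear p (\<lambda>v. h v u)"
  using assms unfolding tangent_bilinear_def by blast+

context
  fixes p and F :: "('a, 'n) tangent_vector \<Rightarrow> 'b::real_vector"
  assumes F: "tangent_linear p F"
begin

lemma tangent_linear_add: "u \<in> tangent_space p \<Longrightarrow> v \<in> tangent_space p \<Longrightarrow> F (u + v) = F u + F v"
  and tangent_linear_scaleR: "u \<in> tangent_space p \<Longrightarrow> F (a *\<^sub>R u) = a *\<^sub>R F u"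
  using F unfolding tangent_linear_def by blast+

lemma tangent_linear_diff:
  "u \<in> tangent_space p \<Longrightarrow> v \<in> tangent_space p \<Longrightarrow> F (u - v) = F u - F v"
  using tangent_linear_add[of u "(-1) *\<^sub>R v"] tangent_linear_scaleR[of v "-1"] tangent_scaleR[of v p "-1"]
  by simp

lemma tangent_linear_minus: "u \<in> tangent_space p \<Longrightarrow> F (- u) = - F u"
  using tangent_linear_scaleR[of u "-1"] by simp

lemma tangent_linear_zero: "F 0 = 0"
  using tangent_linear_scaleR[OF tangent_zero, of 0] by simp

lemma tangent_linear_sum:
  "(\<And>i. i \<in> I \<Longrightarrow> u i \<in> tangent_space p) \<Longrightarrow> F (\<Sum>i\<in>I. u i) = (\<Sum>i\<in>I. F (u i))"
proof (induction I rule: infinite_finite_induct)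
  case (insert i I)
  have "F (\<Sum>i\<in>insert i I. u i) = F (u i + (\<Sum>i\<in>I. u i))" by (simp only: sum.insert[OF insert.hyps])
  also have "\<dots> = F (u i) + F (\<Sum>i\<in>I. u i)"
    using insert.prems by (intro tangent_linear_add tangent_sum) auto
  also have "F (\<Sum>i\<in>I. u i) = (\<Sum>i\<in>I. F (u i))"
    using insert.prems by (intro insert.IH) auto
  finally show ?case by (simp only: sum.insert[OF insert.hyps])
qed (simp_all add: tangent_linear_zero)

lemma tangent_linear_sum_scaleR:
  "(\<And>i. i \<in> I \<Longrightarrow> u i \<in> tangent_space p) \<Longrightarrow> F (\<Sum>i\<in>I. a i *\<^sub>R u i) = (\<Sum>i\<in>I. a i *\<^sub>R F (u i))"
  by (simp add: tangent_linear_sum tangent_linear_scaleR tangent_scaleR)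

end

end

context riemannian_manifold
begin

lemma metric_tangent_bilinear: "p \<in> topspace M \<Longrightarrow> tangent_bilinear p (g p)"
  using metric_bilinear[of p] unfolding symmetric_bilinear_form_def
  by (intro tangent_bilinearI tangent_linearI) simp_all

lemmas metric_linear = tangent_bilinearD[OF metric_tangent_bilinear]

lemma metric_sym:
  "p \<in> topspace M \<Longrightarrow> u \<in> tangent_space p \<Longrightarrow> v \<in> tangent_space p \<Longrightarrow> g p u v = g p v u"
  using metric_bilinear[of p] unfolding symmetric_bilinear_form_def by blast

lemma metric_nondegenerate:
  assumes p: "p \<in> topspace M" and uv: "u \<in> tangent_space p" "v \<in> tangent_space p"
    and eq: "\<And>w. w \<in> tangent_space p \<Longrightarrow> g p u w = g p v w"
  shows "u = v"
proof -
  have "g p (u - v) (u - v) = 0"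
    using eq[OF tangent_diff[OF uv]] tangent_linear_diff[OF metric_linear(2)[OF p tangent_diff[OF uv]] uv]
    by simp
  then have "u - v = 0"
    using metric_pos[OF p tangent_diff[OF uv]] by fastforce
  then show ?thesis by simp
qed

definition orthonormal_frame :: "'a \<Rightarrow> ('n \<Rightarrow> ('a, 'n) tangent_vector) \<Rightarrow> bool" where
  "orthonormal_frame p e \<longleftrightarrow> (\<forall>i. e i \<in> tangent_space p) \<and>
     (\<forall>i j. g p (e i) (e j) = (if i = j then 1 else 0))"

lemma orthonormal_frameD:
  assumes "orthonormal_frame p e"
  shows "e i \<in> tangent_space p" "g p (e i) (e j) = (if i = j then 1 else 0)"
  using assms by (auto simp: orthonormal_frame_def)

lemma metric_frame_sum:
  assumes p: "p \<in> topspace M" and e: "orthonormal_frame p e"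
  shows "g p (\<Sum>i\<in>UNIV. a i *\<^sub>R e i) (e j) = a j"
proof -
  note e = orthonormal_frameD[OF e]
  show ?thesis
    using tangent_linear_sum_scaleR[OF metric_linear(2)[OF p e(1)[of j]], of UNIV e a]
    by (simp add: e if_distrib cong: if_cong)
qed

text \<open>An orthonormal frame has as many members as the dimension, so that the linear map from
  coefficients to vectors, being injective, is also surjective.\<close>

lemma frame_expansion:
  assumes p: "p \<in> topspace M" and e: "orthonormal_frame p e" and v: "v \<in> tangent_space p"
  shows "v = (\<Sum>i\<in>UNIV. g p v (e i) *\<^sub>R e i)"
proof -
  define c where "c = chart_at p"
  have c: "c \<in> charts_at p" unfolding c_def by (rule chart_at_in[OF p])
  note e' = orthonormal_frameD[OF e]
  let ?t = "tangent_of_coords c p"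
  define T :: "real ^ 'n \<Rightarrow> real ^ 'n" where "T x = (\<chi> i. g p (?t x) (e i))" for x
  define B :: "real ^ 'n \<Rightarrow> real ^ 'n" where "B y = (\<Sum>i\<in>UNIV. y $ i *\<^sub>R e i c)" for y
  have g: "g p (?t x + ?t y) (e i) = g p (?t x) (e i) + g p (?t y) (e i)"
    "g p (a *\<^sub>R ?t x) (e i) = a * g p (?t x) (e i)" for x y i a
    using tangent_linear_add[OF metric_linear(2)[OF p e'(1)]] 
      tangent_linear_scaleR[OF metric_linear(2)[OF p e'(1)]] tangent_of_coords_in[OF c] by auto
  have T: "linear T"
    by (rule linearI)
       (simp_all add: T_def vec_eq_iff tangent_of_coords_add tangent_of_coords_scaleR c g)
  have B: "linear B"
    by (rule linearI) (simp_all add: B_def scaleR_add_left sum.distrib scaleR_sum_right)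
  have "?t (B y) = (\<Sum>i\<in>UNIV. y $ i *\<^sub>R e i)" for y
    unfolding B_def linear_sum[OF linear_tangent_of_coords[OF c]]
    by (simp add: tangent_of_coords_scaleR c tangent_of_coords_eq e')
  then have "T (B y) = y" for y
    by (simp only: T_def metric_frame_sum[OF p e] vec_lambda_eta)
  then have "T \<circ> B = id" by (simp add: fun_eq_iff)
  then have "B \<circ> T = id" using linear_inverse_left[OF T B] by simp
  then have "B (T (v c)) = v c" by (simp add: fun_eq_iff)
  then have "(\<Sum>i\<in>UNIV. g p v (e i) *\<^sub>R e i) c = v c"
    by (simp add: B_def T_def tangent_of_coords_eq c v sum_apply scaleR_fun_def)
  then show ?thesis
    by (intro tangent_space_eqI[OF c v] tangent_sum tangent_scaleR e') simp
qed

text \<open>The forms \<open>g(-, e\<^sub>j)\<close> are the basis dual to \<open>e\<close>, so the trace in a coordinate basis, expanded in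
  the frame, collapses to the trace in the frame.\<close>

lemma tangent_trace_frame:
  assumes p: "p \<in> topspace M" and e: "orthonormal_frame p e"
    and F: "tangent_linear p F" "\<And>u. u \<in> tangent_space p \<Longrightarrow> F u \<in> tangent_space p"
  shows "tangent_trace p F = (\<Sum>i\<in>UNIV. g p (F (e i)) (e i))"
proof -
  define c where "c = chart_at p"
  have c: "c \<in> charts_at p" unfolding c_def by (rule chart_at_in[OF p])
  note e' = orthonormal_frameD[OF e]
  let ?t = "\<lambda>k. tangent_of_coords c p (axis k 1)"
  have t: "?t k \<in> tangent_space p" for k by (rule tangent_of_coords_in[OF c])
  have "tangent_trace p F = (\<Sum>k\<in>UNIV. F (?t k) c $ k)"
    by (simp add: tangent_trace_def trace_def matrix_def c_def)
  also have "\<dots> = (\<Sum>k\<in>UNIV. \<Sum>j\<in>UNIV. g p (F (?t k)) (e j) * (e j c $ k))"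
  proof (rule sum.cong[OF refl])
    fix k
    have "F (?t k) c $ k = (\<Sum>j\<in>UNIV. g p (F (?t k)) (e j) *\<^sub>R e j) c $ k"
      using frame_expansion[OF p e F(2)[OF t]] by metis
    then show "F (?t k) c $ k = (\<Sum>j\<in>UNIV. g p (F (?t k)) (e j) * (e j c $ k))"
      by (simp add: sum_apply scaleR_fun_def)
  qed
  also have "\<dots> = (\<Sum>j\<in>UNIV. \<Sum>k\<in>UNIV. (e j c $ k) * g p (F (?t k)) (e j))"
    by (subst sum.swap) (simp add: mult.commute)
  also have "\<dots> = (\<Sum>j\<in>UNIV. g p (F (e j)) (e j))"
  proof (rule sum.cong[OF refl])
    fix j
    have "F (e j) = F (\<Sum>k\<in>UNIV. (e j c $ k) *\<^sub>R ?t k)"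
      using tangent_expansion[OF c e'(1)[of j]] by simp
    also have "\<dots> = (\<Sum>k\<in>UNIV. (e j c $ k) *\<^sub>R F (?t k))"
      using t by (intro tangent_linear_sum_scaleR[OF F(1)])
    finally show "(\<Sum>k\<in>UNIV. (e j c $ k) * g p (F (?t k)) (e j)) = g p (F (e j)) (e j)"
      using tangent_linear_sum_scaleR[OF metric_linear(2)[OF p e'(1)[of j]], of UNIV "\<lambda>k. F (?t k)"] t F(2)
      by simp
  qed
  finally show ?thesis .
qed

lemma sharp_frame:
  assumes p: "p \<in> topspace M" and e: "orthonormal_frame p e" and h: "tangent_linear p (h u)"
  shows "sharp p h u = (\<Sum>i\<in>UNIV. h u (e i) *\<^sub>R e i)"
  unfolding sharp_def
proof (rule the_equality)
  note e' = orthonormal_frameD[OF e]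
  let ?w = "\<Sum>i\<in>UNIV. h u (e i) *\<^sub>R e i"
  have w: "?w \<in> tangent_space p" by (intro tangent_sum tangent_scaleR e')
  have gw: "g p ?w v = h u v" if v: "v \<in> tangent_space p" for v
  proof -
    have "h u v = h u (\<Sum>i\<in>UNIV. g p v (e i) *\<^sub>R e i)"
      using frame_expansion[OF p e v] by metis
    also have "\<dots> = (\<Sum>i\<in>UNIV. h u (e i) *\<^sub>R g p (e i) v)"
      using tangent_linear_sum_scaleR[OF h, of UNIV e "\<lambda>i. g p v (e i)"] e' metric_sym[OF p e'(1) v]
      by (simp add: mult.commute)
    also have "\<dots> = g p ?w v"
      using tangent_linear_sum_scaleR[OF metric_linear(2)[OF p v], of UNIV e "\<lambda>i. h u (e i)"] e' by simp
    finally show ?thesis by simp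
  qed
  show "?w \<in> tangent_space p \<and> (\<forall>v\<in>tangent_space p. g p ?w v = h u v)"
    using w gw by blast
  fix w' assume w': "w' \<in> tangent_space p \<and> (\<forall>v\<in>tangent_space p. g p w' v = h u v)"
  then show "w' = ?w" using metric_nondegenerate[OF p, of w' ?w] w gw by simp
qed

lemma metric_trace_frame:
  assumes p: "p \<in> topspace M" and e: "orthonormal_frame p e" and h: "tangent_bilinear p h"
  shows "metric_trace p h = (\<Sum>i\<in>UNIV. h (e i) (e i))"
proof -
  note e' = orthonormal_frameD[OF e]
  have s: "sharp p h u = (\<Sum>i\<in>UNIV. h u (e i) *\<^sub>R e i)" if "u \<in> tangent_space p" for u
    by (rule sharp_frame[OF p e]) (rule tangent_bilinearD(1)[OF h that])
  have "metric_trace p h = (\<Sum>i\<in>UNIV. g p (sharp p h (e i)) (e i))"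
    unfolding metric_trace_def
  proof (rule tangent_trace_frame[OF p e])
    show "tangent_linear p (sharp p h)"
      by (rule tangent_linearI)
         (simp_all only: s tangent_add tangent_scaleR sum.distrib scaleR_sum_right scaleR_add_left
           tangent_linear_add[OF tangent_bilinearD(2)[OF h e'(1)]] scaleR_scaleR real_scaleR_def
           tangent_linear_scaleR[OF tangent_bilinearD(2)[OF h e'(1)]])
    show "sharp p h u \<in> tangent_space p" if "u \<in> tangent_space p" for u
      unfolding s[OF that] by (intro tangent_sum tangent_scaleR e')
  qed
  also have "\<dots> = (\<Sum>i\<in>UNIV. h (e i) (e i))"
    by (simp add: s e' metric_frame_sum[OF p e])
  finally show ?thesis .
qed

text \<open>Gram-Schmidt, starting from the coordinate fields. The last condition of the invariant says
  that the fields constructed so far lie in the span of the coordinate fields used so far at \<open>p\<close>;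
  it keeps the next field away from zero.\<close>

lemma gram_schmidt:
  assumes c: "c \<in> charts_at p" and "finite J"
  shows "\<exists>W E. openin M W \<and> p \<in> W \<and> W \<subseteq> fst c \<and> (\<forall>j\<in>J. smooth_field W (E j)) \<and>
    (\<forall>q\<in>W. \<forall>i\<in>J. \<forall>j\<in>J. g q (E i q) (E j q) = (if i = j then 1 else 0)) \<and>
    (\<forall>j\<in>J. \<forall>k. k \<notin> J \<longrightarrow> E j p c $ k = 0)"
  using \<open>finite J\<close>
proof (induction J)
  case empty
  show ?case using charts_atD[OF c] chart_openin by (intro exI[of _ "fst c"]) auto
next
  case (insert k J)
  obtain W E where W: "openin M W" "p \<in> W" "W \<subseteq> fst c"
    and E': "\<forall>j\<in>J. smooth_field W (E j)"
    and on': "\<forall>q\<in>W. \<forall>i\<in>J. \<forall>j\<in>J. g q (E i q) (E j q) = (if i = j then 1 else 0)"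
    and z': "\<forall>j\<in>J. \<forall>k. k \<notin> J \<longrightarrow> E j p c $ k = 0"
    using insert.IH by (elim exE conjE) (rule that, assumption+)
  note E = bspec[OF E'] and on = bspec[OF bspec[OF bspec[OF on']]]
    and z = bspec[OF z', THEN spec, THEN mp]
  have WM: "q \<in> topspace M" if "q \<in> W" for q using W(1) that openin_subset by blast
  let ?D = "\<lambda>q. tangent_of_coords c q (axis k 1)"
  have D: "smooth_field W ?D"
    by (rule smooth_field_subset[OF smooth_coordinate_field[OF charts_atD(1)[OF c]] W(3)])
  define X where "X = ?D - (\<lambda>q. \<Sum>j\<in>J. g q (?D q) (E j q) *\<^sub>R E j q)"
  have X: "smooth_field W X"
    unfolding X_def
    by (intro smooth_field_diff smooth_field_sum smooth_field_scaleR metric_smooth W D E)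
  have Xc: "X p c $ l = (if l = k then 1 else 0)" if "l \<notin> J" for l
    using that by (simp add: X_def sum_apply scaleR_fun_def tangent_of_coords_self[OF c] z axis_def)
  have "X p c $ k = 1" using Xc insert.hyps by simp
  then have "X p \<noteq> 0" by auto
  then have pos: "g p (X p) (X p) > 0"
    using metric_pos[OF WM[OF W(2)] smooth_field_tangent[OF X W(2)]] by simp
  define f where "f q = g q (X q) (X q)" for q
  have f: "smooth_fun W f" unfolding f_def by (rule metric_smooth[OF W(1) X X])
  obtain V where V: "openin M V" "p \<in> V" "V \<subseteq> W" "\<And>q. q \<in> V \<Longrightarrow> f q > 0"
    using smooth_fun_pos_openin[OF W(1,2) f] pos unfolding f_def by metis
  define N where "N q = f q powr (-1/2) *\<^sub>R X q" for q
  have N: "smooth_field V N"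
    unfolding N_def
    by (intro smooth_field_scaleR smooth_fun_powr V smooth_fun_subset[OF f] smooth_field_subset[OF X])
  have Xt: "X q \<in> tangent_space q" "\<And>j. j \<in> J \<Longrightarrow> E j q \<in> tangent_space q" "?D q \<in> tangent_space q"
    if "q \<in> W" for q
    using smooth_field_tangent[OF X that] smooth_field_tangent[OF E that] smooth_field_tangent[OF D that]
    by auto
  have NN: "g q (N q) (N q) = 1" if "q \<in> V" for q
  proof -
    have q: "q \<in> W" "q \<in> topspace M" using that V WM by auto
    have "g q (N q) (N q) = f q powr (-1/2) * f q powr (-1/2) * f q"
      unfolding N_def
      by (simp add: tangent_linear_scaleR[OF metric_linear(1)[OF q(2)]] f_def
          tangent_linear_scaleR[OF metric_linear(2)[OF q(2)]] tangent_scaleR Xt q)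
    also have "\<dots> = 1"
      using V(4)[OF that] by (simp only: powr_add[symmetric]) (simp add: powr_neg_one)
    finally show ?thesis .
  qed
  have NE: "g q (N q) (E j q) = 0" if "q \<in> V" "j \<in> J" for q j
  proof -
    have q: "q \<in> W" "q \<in> topspace M" using that V WM by auto
    note lin = metric_linear(2)[OF q(2) Xt(2)[OF q(1) that(2)]]
    have "g q (\<Sum>i\<in>J. g q (?D q) (E i q) *\<^sub>R E i q) (E j q) = (\<Sum>i\<in>J. g q (?D q) (E i q) * g q (E i q) (E j q))"
      using tangent_linear_sum_scaleR[OF lin, of J "\<lambda>i. E i q"] Xt(2)[OF q(1)] by simp
    also have "\<dots> = g q (?D q) (E j q)"
      using insert.hyps that by (simp add: on[OF q(1)] if_distrib sum.delta' cong: if_cong sum.cong)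
    finally have "g q (X q) (E j q) = 0"
      unfolding X_def
      by (simp add: tangent_linear_diff[OF lin] Xt[OF q(1)] tangent_sum tangent_scaleR)
    then show ?thesis unfolding N_def by (simp add: tangent_linear_scaleR[OF lin] Xt q)
  qed
  have EN: "g q (E j q) (N q) = 0" if "q \<in> V" "j \<in> J" for q j
  proof -
    have q: "q \<in> W" "q \<in> topspace M" using that V WM by auto
    show ?thesis
      using NE[OF that] metric_sym[OF q(2) Xt(2)[OF q(1) that(2)] smooth_field_tangent[OF N that(1)]]
      by simp
  qed
  show ?case
  proof (intro exI[of _ V] exI[of _ "E(k := N)"] conjI V)
    show "V \<subseteq> fst c" using V W by auto
    show "\<forall>j\<in>insert k J. smooth_field V ((E(k := N)) j)"
      using N smooth_field_subset[OF E V(3)] insert.hyps by auto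
    show "\<forall>q\<in>V. \<forall>i\<in>insert k J. \<forall>j\<in>insert k J.
        g q ((E(k := N)) i q) ((E(k := N)) j q) = (if i = j then 1 else 0)"
    proof (intro ballI)
      fix q i j assume "q \<in> V" "i \<in> insert k J" "j \<in> insert k J"
      moreover have "q \<in> W" using V \<open>q \<in> V\<close> by auto
      ultimately show "g q ((E(k := N)) i q) ((E(k := N)) j q) = (if i = j then 1 else 0)"
        using insert.hyps by (cases "i = k"; cases "j = k") (simp_all add: NN NE EN on)
    qed
    show "\<forall>j\<in>insert k J. \<forall>l. l \<notin> insert k J \<longrightarrow> (E(k := N)) j p c $ l = 0"
      using z Xc by (auto simp: N_def scaleR_fun_def)
  qed
qed

lemma local_orthonormal_frame:
  assumes p: "p \<in> topspace M"
  obtains W E where "openin M W" "p \<in> W" "\<And>i. smooth_field W (E i)"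
    "\<And>q. q \<in> W \<Longrightarrow> orthonormal_frame q (\<lambda>i. E i q)"
proof -
  obtain W and E :: "'n \<Rightarrow> ('a, 'n) vector_field" where W: "openin M W" "p \<in> W"
    and E: "\<forall>i\<in>UNIV. smooth_field W (E i)"
    and on: "\<forall>q\<in>W. \<forall>i\<in>UNIV. \<forall>j\<in>UNIV. g q (E i q) (E j q) = (if i = j then 1 else 0)"
    using gram_schmidt[OF chart_at_in[OF p] finite[of "UNIV :: 'n set"]]
    by (elim exE conjE) (rule that, assumption+)
  have "orthonormal_frame q (\<lambda>i. E i q)" if "q \<in> W" for q
    unfolding orthonormal_frame_def using on that smooth_field_tangent[OF E[THEN bspec, OF UNIV_I]]
    by simp
  then show thesis using that[OF W, of E] E by simp
qed

text \<open>A local frame \<open>E\<close> is rotated with the constant coefficients \<open>g(S\<^sub>i, E\<^sub>j)\<close> taken at \<open>p\<close>; the Gram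
  matrix of the rotated frame is then constant, and it is the identity at \<open>p\<close>.\<close>

lemma local_orthonormal_frame_through:
  assumes p: "p \<in> topspace M" and S: "orthonormal_frame p S"
  obtains W E where "openin M W" "p \<in> W" "\<And>i. smooth_field W (E i)"
    "\<And>q. q \<in> W \<Longrightarrow> orthonormal_frame q (\<lambda>i. E i q)" "\<And>i. E i p = S i"
proof -
  obtain W E where W: "openin M W" "p \<in> W" and E: "\<And>i. smooth_field W (E i)"
    and on: "\<And>q. q \<in> W \<Longrightarrow> orthonormal_frame q (\<lambda>i. E i q)"
    by (rule local_orthonormal_frame[OF p]) (rule that, assumption+)
  define R where "R i q = (\<Sum>j\<in>UNIV. g p (S i) (E j p) *\<^sub>R E j q)" for i q
  note S' = orthonormal_frameD[OF S]
  have Rp: "R i p = S i" for i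
    unfolding R_def by (rule frame_expansion[OF p on[OF W(2)] S'(1), symmetric])
  have R: "smooth_field W (R i)" for i
    unfolding R_def by (intro smooth_field_sum smooth_field_cscaleR W E)
  have gR: "g q (R i q) (R k q) = (\<Sum>j\<in>UNIV. g p (S i) (E j p) * g p (S k) (E j p))"
    if q: "q \<in> W" for q i k
  proof -
    have qM: "q \<in> topspace M" using q W openin_subset by blast
    note Rk = smooth_field_tangent[OF R q] and Et = smooth_field_tangent[OF E q]
    have "g q (R i q) (R k q) = (\<Sum>j\<in>UNIV. g p (S i) (E j p) *\<^sub>R g q (E j q) (R k q))"
      by (subst (1) R_def) (rule tangent_linear_sum_scaleR[OF metric_linear(2)[OF qM Rk] Et])
    moreover have "g q (E j q) (R k q) = g p (S k) (E j p)" for j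
      using metric_sym[OF qM Et Rk] metric_frame_sum[OF qM on[OF q]] unfolding R_def by simp
    ultimately show ?thesis by simp
  qed
  have "orthonormal_frame q (\<lambda>i. R i q)" if "q \<in> W" for q
    using smooth_field_tangent[OF R that] S'(2) gR[OF that] gR[OF W(2)]
    by (simp add: orthonormal_frame_def Rp)
  then show thesis using that[OF W, of R] R Rp by simp
qed

end

section \<open>The curvature of the Levi-Civita connection\<close>

context levi_civita_connection
begin

lemma topspaceI: "openin M W \<Longrightarrow> p \<in> W \<Longrightarrow> p \<in> topspace M"
  using openin_subset by blast

lemmas connection_rules = connection[unfolded affine_connection_def]

lemma smooth_nabla:
  "openin M W \<Longrightarrow> smooth_field W X \<Longrightarrow> smooth_field W Y \<Longrightarrow> smooth_field W (nabla X Y)"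
  using connection_rules[THEN conjunct1] by blast

context
  fixes W p
  assumes W: "openin M W" and p: "p \<in> W"
begin

lemma nabla_cong:
  assumes "smooth_field W X" "smooth_field W Y"
    and "\<And>q. q \<in> W \<Longrightarrow> X' q = X q" "\<And>q. q \<in> W \<Longrightarrow> Y' q = Y q"
  shows "nabla X' Y' p = nabla X Y p"
  using connection_rules[THEN conjunct2, THEN conjunct1, rule_format, of W X Y X' Y' p] W p assms by simp

lemma nabla_add_left:
  assumes "smooth_field W X" "smooth_field W X'" "smooth_field W Y"
  shows "nabla (X + X') Y p = nabla X Y p + nabla X' Y p"
  using connection_rules[THEN conjunct2, THEN conjunct2, THEN conjunct1, rule_format, of W X X' Y p]
    W p assms by simp

lemma nabla_scale_left:
  assumes "smooth_fun W f" "smooth_field W X" "smooth_field W Y"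
  shows "nabla (\<lambda>q. f q *\<^sub>R X q) Y p = f p *\<^sub>R nabla X Y p"
  using connection_rules[THEN conjunct2, THEN conjunct2, THEN conjunct2, THEN conjunct1, rule_format,
      of W f X Y p] W p assms by simp

lemma nabla_add_right:
  assumes "smooth_field W X" "smooth_field W Y" "smooth_field W Y'"
  shows "nabla X (Y + Y') p = nabla X Y p + nabla X Y' p"
  using connection_rules[THEN conjunct2, THEN conjunct2, THEN conjunct2, THEN conjunct2, THEN conjunct1,
      rule_format, of W X Y Y' p] W p assms by simp

lemma nabla_leibniz:
  assumes "smooth_fun W f" "smooth_field W X" "smooth_field W Y"
  shows "nabla X (\<lambda>q. f q *\<^sub>R Y q) p = dir_deriv f p (X p) *\<^sub>R Y p + f p *\<^sub>R nabla X Y p"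
  using connection_rules[THEN conjunct2, THEN conjunct2, THEN conjunct2, THEN conjunct2, THEN conjunct2,
      rule_format, of W f X Y p] W p assms by simp

lemma nabla_diff_left:
  assumes "smooth_field W X" "smooth_field W X'" "smooth_field W Y"
  shows "nabla (X - X') Y p = nabla X Y p - nabla X' Y p"
  unfolding diff_field_eq
  using nabla_add_left[OF assms(1) smooth_field_cscaleR[OF W assms(2), of "-1"] assms(3)]
    nabla_scale_left[OF smooth_fun_const[OF W, of "-1"] assms(2,3)] by simp

lemma nabla_diff_right:
  assumes "smooth_field W X" "smooth_field W Y" "smooth_field W Y'"
  shows "nabla X (Y - Y') p = nabla X Y p - nabla X Y' p"
  unfolding diff_field_eq
  using nabla_add_right[OF assms(1,2) smooth_field_cscaleR[OF W assms(3), of "-1"]]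
    nabla_leibniz[OF smooth_fun_const[OF W, of "-1"] assms(1,3)] by (simp add: dir_deriv_const)

lemma lie_bracket_nabla:
  assumes "smooth_field W X" "smooth_field W Y"
  shows "lie_bracket X Y p = nabla X Y p - nabla Y X p"
  using torsion_free[OF W assms p] by simp

end

text \<open>By vanishing torsion the bracket is the skew part of the connection. In particular its coordinate
  vectors in different charts are related by the Jacobians.\<close>

lemma smooth_lie_bracket:
  assumes W: "openin M W" and X: "smooth_field W X" and Y: "smooth_field W Y"
  shows "smooth_field W (lie_bracket X Y)"
proof -
  have "smooth_field W (nabla X Y - nabla Y X)"
    by (intro smooth_field_diff smooth_nabla W X Y)
  then show ?thesis
    using smooth_field_cong[OF W, of "lie_bracket X Y" "nabla X Y - nabla Y X"]
      lie_bracket_nabla[OF W _ X Y] by simp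
qed

lemma bracket_commutator:
  assumes W: "openin M W" and p: "p \<in> W" and f: "smooth_fun W f"
    and X: "smooth_field W X" and Y: "smooth_field W Y"
  shows "dir_deriv (\<lambda>q. dir_deriv f q (Y q)) p (X p) - dir_deriv (\<lambda>q. dir_deriv f q (X q)) p (Y p)
       = dir_deriv f p (lie_bracket X Y p)"
  by (rule lie_bracket_commutator[OF W p f X Y smooth_field_tangent[OF smooth_lie_bracket[OF W X Y] p]])

text \<open>In terms of the components, which are functions, the Jacobi identity is a consequence of the
  commutator formula for functions.\<close>

lemma jacobi_identity:
  assumes W: "openin M W" "p \<in> W"
    and X: "smooth_field W X" and Y: "smooth_field W Y" and Z: "smooth_field W Z"
  shows "lie_bracket (lie_bracket X Y) Z p + lie_bracket (lie_bracket Y Z) X p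
    + lie_bracket (lie_bracket Z X) Y p = 0"
proof -
  define c where "c = chart_at p"
  have c: "c \<in> charts_at p" unfolding c_def by (rule chart_at_in[OF topspaceI[OF W]])
  note cA = charts_atD[OF c]
  define V where "V = W \<inter> fst c"
  have V: "openin M V" "p \<in> V" "V \<subseteq> fst c" "V \<subseteq> W"
    unfolding V_def using W cA chart_openin[OF cA(1)] by auto
  note sub = smooth_field_subset[OF _ V(4)]
  have comp: "lie_bracket (lie_bracket X Y) Z p c $ i =
      (dir_deriv (\<lambda>q. dir_deriv (\<lambda>q. Z q c $ i) q (Y q)) p (X p)
       - dir_deriv (\<lambda>q. dir_deriv (\<lambda>q. Z q c $ i) q (X q)) p (Y p))
      - (dir_deriv (\<lambda>q. dir_deriv (\<lambda>q. Y q c $ i) q (X q)) p (Z p)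
       - dir_deriv (\<lambda>q. dir_deriv (\<lambda>q. X q c $ i) q (Y q)) p (Z p))"
    if XYZ: "smooth_field V X" "smooth_field V Y" "smooth_field V Z" for X Y Z i
  proof -
    note L = smooth_lie_bracket[OF V(1) XYZ(1,2)]
    note f = smooth_fun_component[OF cA(1) V(1,3)]
    have s: "smooth_fun V (\<lambda>q. dir_deriv (\<lambda>q. Y q c $ i) q (X q))"
      "smooth_fun V (\<lambda>q. dir_deriv (\<lambda>q. X q c $ i) q (Y q))"
      by (intro smooth_dir_deriv V f XYZ)+
    have "dir_deriv (\<lambda>q. lie_bracket X Y q c $ i) p (Z p) =
        dir_deriv (\<lambda>q. dir_deriv (\<lambda>q. Y q c $ i) q (X q) - dir_deriv (\<lambda>q. X q c $ i) q (Y q)) p (Z p)"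
      by (rule dir_deriv_cong[OF V(1,2) smooth_fun_diff[OF V(1) s]])
         (rule lie_bracket_component[OF V(1) _ V(3) cA(1) XYZ(1,2)])
    then show ?thesis
      using lie_bracket_component[OF V(1,2,3) cA(1) L XYZ(3), of i]
        bracket_commutator[OF V(1,2) f[OF XYZ(3)] XYZ(1,2)] dir_deriv_diff[OF V(1,2) s] by simp
  qed
  let ?J = "lie_bracket (lie_bracket X Y) Z p + lie_bracket (lie_bracket Y Z) X p
    + lie_bracket (lie_bracket Z X) Y p"
  have "?J c = 0 c"
    by (simp add: vec_eq_iff comp sub X Y Z)
  then show ?thesis
    using W X Y Z
    by (intro tangent_space_eqI[OF c] tangent_zero tangent_add)
       (auto intro!: smooth_field_tangent[OF smooth_lie_bracket] smooth_lie_bracket)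
qed

lemma smooth_curvature_field:
  assumes "openin M W" "smooth_field W X" "smooth_field W Y" "smooth_field W Z"
  shows "smooth_field W (curvature_field X Y Z)"
  unfolding curvature_field_def
  by (intro smooth_field_diff smooth_nabla smooth_lie_bracket assms)

context
  fixes W p X Y Z
  assumes W: "openin M W" and p: "p \<in> W"
    and X: "smooth_field W X" and Y: "smooth_field W Y" and Z: "smooth_field W Z"
begin

lemma curvature_field_apply:
  "curvature_field X Y Z p = nabla X (nabla Y Z) p - nabla Y (nabla X Z) p - nabla (lie_bracket X Y) Z p"
  by (simp add: curvature_field_def)

lemma curvature_field_skew: "curvature_field Y X Z p = - curvature_field X Y Z p"
proof -
  have "nabla (lie_bracket Y X) Z p = nabla (\<lambda>q. (-1) *\<^sub>R lie_bracket X Y q) Z p"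
    using lie_bracket_nabla[OF W _ X Y] lie_bracket_nabla[OF W _ Y X]
    by (intro nabla_cong[OF W p] smooth_field_cscaleR smooth_lie_bracket W X Y Z) simp_all
  also have "\<dots> = - nabla (lie_bracket X Y) Z p"
    using nabla_scale_left[OF W p smooth_fun_const[OF W, of "-1"] smooth_lie_bracket[OF W X Y] Z] by simp
  finally show ?thesis by (simp add: curvature_field_def)
qed

lemma curvature_field_cong:
  assumes "\<And>q. q \<in> W \<Longrightarrow> X' q = X q" "\<And>q. q \<in> W \<Longrightarrow> Y' q = Y q" "\<And>q. q \<in> W \<Longrightarrow> Z' q = Z q"
  shows "curvature_field X' Y' Z' p = curvature_field X Y Z p"
proof -
  have X': "smooth_field W X'" and Y': "smooth_field W Y'"
    using X Y assms smooth_field_cong[OF W] by blast+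
  have "nabla X' (nabla Y' Z') p = nabla X (nabla Y Z) p"
    by (intro nabla_cong[OF W p] nabla_cong[OF W] smooth_nabla W X Y Z assms)
  moreover have "nabla Y' (nabla X' Z') p = nabla Y (nabla X Z) p"
    by (intro nabla_cong[OF W p] nabla_cong[OF W] smooth_nabla W X Y Z assms)
  moreover have "nabla (lie_bracket X' Y') Z' p = nabla (lie_bracket X Y) Z p"
  proof (intro nabla_cong[OF W p] smooth_lie_bracket W X Y Z assms)
    fix q assume q: "q \<in> W"
    show "lie_bracket X' Y' q = lie_bracket X Y q"
      using lie_bracket_nabla[OF W q X' Y'] lie_bracket_nabla[OF W q X Y]
        nabla_cong[OF W q X Y assms(1,2)] nabla_cong[OF W q Y X assms(2,1)] by simp
  qed
  ultimately show ?thesis by (simp add: curvature_field_def)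
qed

lemma curvature_field_add_1:
  assumes X': "smooth_field W X'"
  shows "curvature_field (X + X') Y Z p = curvature_field X Y Z p + curvature_field X' Y Z p"
proof -
  note S = smooth_field_add[OF W X X']
  note n = smooth_nabla[OF W]
  have "nabla Y (nabla (X + X') Z) p = nabla Y (nabla X Z + nabla X' Z) p"
    by (rule nabla_cong[OF W p Y smooth_field_add[OF W n[OF X Z] n[OF X' Z]]])
       (simp_all add: nabla_add_left[OF W _ X X' Z])
  moreover have "nabla (lie_bracket (X + X') Y) Z p = nabla (lie_bracket X Y + lie_bracket X' Y) Z p"
    by (rule nabla_cong[OF W p smooth_field_add[OF W smooth_lie_bracket[OF W X Y]
            smooth_lie_bracket[OF W X' Y]] Z])
       (simp_all add: lie_bracket_nabla[OF W] S X X' Y nabla_add_left[OF W _ X X' Y]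
          nabla_add_right[OF W _ Y X X'] algebra_simps)
  ultimately show ?thesis
    using nabla_add_left[OF W p X X' n[OF Y Z]] nabla_add_right[OF W p Y n[OF X Z] n[OF X' Z]]
      nabla_add_left[OF W p smooth_lie_bracket[OF W X Y] smooth_lie_bracket[OF W X' Y] Z]
    by (simp add: curvature_field_def)
qed

text \<open>The term \<open>Y(f) \<nabla>\<^sub>X Z\<close> produced by \<open>\<nabla>\<^sub>Y\<close> cancels against the term \<open>- Y(f) X\<close> of the bracket
  \<open>[f X, Y]\<close>.\<close>

lemma curvature_field_scale_1:
  assumes f: "smooth_fun W f"
  shows "curvature_field (\<lambda>q. f q *\<^sub>R X q) Y Z p = f p *\<^sub>R curvature_field X Y Z p"
proof -
  let ?fX = "\<lambda>q. f q *\<^sub>R X q" and ?Yf = "\<lambda>q. dir_deriv f q (Y q)"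
  note S = smooth_field_scaleR[OF W f X]
  note n = smooth_nabla[OF W] and L = smooth_lie_bracket[OF W X Y]
  note Yf = smooth_dir_deriv[OF W f Y]
  have "nabla Y (nabla ?fX Z) p = nabla Y (\<lambda>q. f q *\<^sub>R nabla X Z q) p"
    by (rule nabla_cong[OF W p Y smooth_field_scaleR[OF W f n[OF X Z]]])
       (simp_all add: nabla_scale_left[OF W _ f X Z])
  moreover have "nabla (lie_bracket ?fX Y) Z p =
      nabla ((\<lambda>q. f q *\<^sub>R lie_bracket X Y q) - (\<lambda>q. ?Yf q *\<^sub>R X q)) Z p"
    by (rule nabla_cong[OF W p smooth_field_diff[OF W smooth_field_scaleR[OF W f L]
            smooth_field_scaleR[OF W Yf X]] Z])
       (simp_all add: lie_bracket_nabla[OF W] S X Y nabla_scale_left[OF W _ f X Y]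
          nabla_leibniz[OF W _ f Y X] algebra_simps)
  ultimately show ?thesis
    using nabla_scale_left[OF W p f X n[OF Y Z]] nabla_leibniz[OF W p f Y n[OF X Z]]
      nabla_diff_left[OF W p smooth_field_scaleR[OF W f L] smooth_field_scaleR[OF W Yf X] Z]
      nabla_scale_left[OF W p f L Z] nabla_scale_left[OF W p Yf X Z]
    by (simp add: curvature_field_def algebra_simps)
qed

lemma curvature_field_add_3:
  assumes Z': "smooth_field W Z'"
  shows "curvature_field X Y (Z + Z') p = curvature_field X Y Z p + curvature_field X Y Z' p"
proof -
  note n = smooth_nabla[OF W]
  have *: "nabla X (nabla Y (Z + Z')) p = nabla X (nabla Y Z) p + nabla X (nabla Y Z') p"
    if X: "smooth_field W X" and Y: "smooth_field W Y" for X Y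
  proof -
    have "nabla X (nabla Y (Z + Z')) p = nabla X (nabla Y Z + nabla Y Z') p"
      by (rule nabla_cong[OF W p X smooth_field_add[OF W n[OF Y Z] n[OF Y Z']]])
         (simp_all add: nabla_add_right[OF W _ Y Z Z'])
    also have "\<dots> = nabla X (nabla Y Z) p + nabla X (nabla Y Z') p"
      by (rule nabla_add_right[OF W p X n[OF Y Z] n[OF Y Z']])
    finally show ?thesis .
  qed
  show ?thesis
    using *[OF X Y] *[OF Y X] nabla_add_right[OF W p smooth_lie_bracket[OF W X Y] Z Z']
    by (simp add: curvature_field_def)
qed

text \<open>The mixed first-order terms are symmetric in \<open>X\<close> and \<open>Y\<close>, and the second derivatives of \<open>f\<close>
  amount to \<open>[X, Y](f)\<close>, which the last term of the curvature removes.\<close>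

lemma curvature_field_scale_3:
  assumes f: "smooth_fun W f"
  shows "curvature_field X Y (\<lambda>q. f q *\<^sub>R Z q) p = f p *\<^sub>R curvature_field X Y Z p"
proof -
  let ?fZ = "\<lambda>q. f q *\<^sub>R Z q"
  note n = smooth_nabla[OF W]
  have *: "nabla X (nabla Y ?fZ) p = dir_deriv (\<lambda>q. dir_deriv f q (Y q)) p (X p) *\<^sub>R Z p
      + dir_deriv f p (Y p) *\<^sub>R nabla X Z p + dir_deriv f p (X p) *\<^sub>R nabla Y Z p
      + f p *\<^sub>R nabla X (nabla Y Z) p"
    if X: "smooth_field W X" and Y: "smooth_field W Y" for X Y
  proof -
    note Yf = smooth_dir_deriv[OF W f Y]
    let ?A = "\<lambda>q. dir_deriv f q (Y q) *\<^sub>R Z q" and ?B = "\<lambda>q. f q *\<^sub>R nabla Y Z q"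
    have A: "smooth_field W ?A" and B: "smooth_field W ?B"
      by (intro smooth_field_scaleR W Yf f Z n Y)+
    have "nabla X (nabla Y ?fZ) p = nabla X (?A + ?B) p"
      by (rule nabla_cong[OF W p X smooth_field_add[OF W A B]])
         (simp_all add: nabla_leibniz[OF W _ f Y Z])
    also have "\<dots> = nabla X ?A p + nabla X ?B p"
      by (rule nabla_add_right[OF W p X A B])
    finally show ?thesis
      using nabla_leibniz[OF W p Yf X Z] nabla_leibniz[OF W p f X n[OF Y Z]] by simp
  qed
  show ?thesis
    using *[OF X Y] *[OF Y X] nabla_leibniz[OF W p f smooth_lie_bracket[OF W X Y] Z]
      bracket_commutator[OF W p f X Y, symmetric]
    by (simp add: curvature_field_def algebra_simps)
qed

end

end

context smooth_manifold
begin

lemma common_extension: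
  assumes p: "p \<in> topspace M" and "finite V" "V \<subseteq> tangent_space p"
  obtains W where "openin M W" "p \<in> W"
    "\<And>v. v \<in> V \<Longrightarrow> smooth_field W (extension p v)" "\<And>v. v \<in> V \<Longrightarrow> extension p v p = v"
proof -
  have "\<exists>W. openin M W \<and> p \<in> W \<and> (\<forall>v\<in>V. smooth_field W (extension p v) \<and> extension p v p = v)"
    using assms(2,3)
  proof (induction V)
    case empty
    then show ?case using p by (intro exI[of _ "topspace M"]) simp
  next
    case (insert v V)
    then obtain W where W: "openin M W" "p \<in> W"
      "\<forall>v\<in>V. smooth_field W (extension p v) \<and> extension p v p = v" by auto
    obtain U where U: "openin M U" "p \<in> U" "smooth_field U (extension p v)" "extension p v p = v"
      using extension_ex[OF p, of v] insert.prems by auto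
    have "smooth_field (W \<inter> U) (extension p v)" by (rule smooth_field_subset[OF U(3)]) simp
    moreover have "smooth_field (W \<inter> U) (extension p w)" if "w \<in> V" for w
      by (rule smooth_field_subset[of W]) (use W that in auto)
    ultimately show ?case using W U by (intro exI[of _ "W \<inter> U"]) auto
  qed
  then show thesis using that by blast
qed

end

context levi_civita_connection
begin

lemma curvature_field_tensorial:
  assumes W: "openin M W" "p \<in> W"
    and X: "smooth_field W X" "smooth_field W X'" "X p = X' p"
    and Y: "smooth_field W Y" "smooth_field W Y'" "Y p = Y' p"
    and Z: "smooth_field W Z" "smooth_field W Z'" "Z p = Z' p"
  shows "curvature_field X Y Z p = curvature_field X' Y' Z' p"
proof -
  note sub = smooth_field_subset
  have 1: "curvature_field X Y Z p = curvature_field X' Y Z p"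
    if X: "smooth_field W X" "smooth_field W X'" "X p = X' p"
      and Y: "smooth_field W Y" and Z: "smooth_field W Z" for X X' Y Z
  proof (rule tensorial[OF W _ _ _ W X(1) W X(2,3), where \<Phi> = "\<lambda>X. curvature_field X Y Z p"])
    fix V X1 X2 assume V: "openin M V" "p \<in> V" "V \<subseteq> W" and X: "smooth_field V X1"
    note YZ = sub[OF Y V(3)] sub[OF Z V(3)]
    show "curvature_field (X1 + X2) Y Z p = curvature_field X1 Y Z p + curvature_field X2 Y Z p"
      if "smooth_field V X2"
      by (rule curvature_field_add_1[OF V(1,2) X YZ that])
    show "curvature_field X2 Y Z p = curvature_field X1 Y Z p" if "\<And>q. q \<in> V \<Longrightarrow> X2 q = X1 q"
      by (rule curvature_field_cong[OF V(1,2) X YZ]) (simp_all add: that)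
    show "curvature_field (\<lambda>q. f q *\<^sub>R X1 q) Y Z p = f p *\<^sub>R curvature_field X1 Y Z p"
      if "smooth_fun V f" for f
      by (rule curvature_field_scale_1[OF V(1,2) X YZ that])
  qed
  have 3: "curvature_field X' Y' Z p = curvature_field X' Y' Z' p"
  proof (rule tensorial[OF W _ _ _ W Z(1) W Z(2,3), where \<Phi> = "\<lambda>Z. curvature_field X' Y' Z p"])
    fix V X1 X2 assume V: "openin M V" "p \<in> V" "V \<subseteq> W" and Z: "smooth_field V X1"
    note XY = sub[OF X(2) V(3)] sub[OF Y(2) V(3)]
    show "curvature_field X' Y' (X1 + X2) p = curvature_field X' Y' X1 p + curvature_field X' Y' X2 p"
      if "smooth_field V X2"
      by (rule curvature_field_add_3[OF V(1,2) XY Z that])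
    show "curvature_field X' Y' X2 p = curvature_field X' Y' X1 p" if "\<And>q. q \<in> V \<Longrightarrow> X2 q = X1 q"
      by (rule curvature_field_cong[OF V(1,2) XY Z]) (simp_all add: that)
    show "curvature_field X' Y' (\<lambda>q. f q *\<^sub>R X1 q) p = f p *\<^sub>R curvature_field X' Y' X1 p"
      if "smooth_fun V f" for f
      by (rule curvature_field_scale_3[OF V(1,2) XY Z that])
  qed
  have "curvature_field X Y Z p = curvature_field X' Y Z p" by (rule 1[OF X Y(1) Z(1)])
  also have "\<dots> = - curvature_field Y X' Z p" by (rule curvature_field_skew[OF W Y(1) X(2) Z(1)])
  also have "\<dots> = - curvature_field Y' X' Z p" by (simp only: 1[OF Y X(2) Z(1)])
  also have "\<dots> = curvature_field X' Y' Z p" by (rule curvature_field_skew[OF W Y(2) X(2) Z(1), symmetric])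
  finally show ?thesis using 3 by simp
qed

text \<open>Tensoriality in all three arguments makes the choice of the extensions in the definition of the
  curvature irrelevant.\<close>

lemma curvature_eq:
  assumes W: "openin M W" "p \<in> W"
    and X: "smooth_field W X" and Y: "smooth_field W Y" and Z: "smooth_field W Z"
  shows "curvature p (X p) (Y p) (Z p) = curvature_field X Y Z p"
proof -
  note t = smooth_field_tangent[OF _ W(2)]
  obtain U where U: "openin M U" "p \<in> U" and
    e: "\<And>v. v \<in> {X p, Y p, Z p} \<Longrightarrow> smooth_field U (extension p v)"
      "\<And>v. v \<in> {X p, Y p, Z p} \<Longrightarrow> extension p v p = v"
    using common_extension[OF topspaceI[OF W], of "{X p, Y p, Z p}"] t[OF X] t[OF Y] t[OF Z]
    by auto
  note sub = smooth_field_subset[of _ _ "W \<inter> U"]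
  show ?thesis
    unfolding curvature_def
    by (rule curvature_field_tensorial[of "W \<inter> U"]) (use W U e X Y Z sub in auto)
qed

context
  fixes p u v w
  assumes p: "p \<in> topspace M"
    and u: "u \<in> tangent_space p" and v: "v \<in> tangent_space p" and w: "w \<in> tangent_space p"
begin

lemma curvature_tangent: "curvature p u v w \<in> tangent_space p"
  and curvature_skew: "curvature p v u w = - curvature p u v w"
  and curvature_linear_1: "tangent_linear p (\<lambda>x. curvature p x v w)"
  and curvature_linear_3: "tangent_linear p (curvature p u v)"
proof -
  let ?e = "extension p"
  obtain W where W: "openin M W" "p \<in> W" and s: "\<And>x. x \<in> {u, v, w} \<Longrightarrow> smooth_field W (?e x)"
    and e: "\<And>x. x \<in> {u, v, w} \<Longrightarrow> ?e x p = x"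
    using common_extension[OF p, of "{u, v, w}"] u v w by auto
  have uvw: "curvature_field (?e u) (?e v) (?e w) p = curvature p u v w"
    by (simp add: curvature_def)
  show "curvature p u v w \<in> tangent_space p"
    unfolding uvw[symmetric]
    by (rule smooth_field_tangent[OF smooth_curvature_field[OF W(1)] W(2)]) (simp_all add: s)
  show "curvature p v u w = - curvature p u v w"
    unfolding curvature_def by (rule curvature_field_skew[OF W]) (simp_all add: s)
  have ext: "\<exists>W. openin M W \<and> p \<in> W \<and>
      (\<forall>z\<in>{u, v, w, x, y}. smooth_field W (?e z) \<and> ?e z p = z)"
    if "x \<in> tangent_space p" "y \<in> tangent_space p" for x y
    using common_extension[OF p, of "{u, v, w, x, y}"] u v w that by (metis empty_subsetI finite.simps insert_subset)
  show "tangent_linear p (\<lambda>x. curvature p x v w)"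
  proof (rule tangent_linearI)
    fix x y assume xy: "x \<in> tangent_space p" "y \<in> tangent_space p"
    obtain U where U: "openin M U" "p \<in> U"
      and s: "smooth_field U (?e v)" "smooth_field U (?e w)" "smooth_field U (?e x)" "smooth_field U (?e y)"
      and e: "?e v p = v" "?e w p = w" "?e x p = x" "?e y p = y"
      using ext[OF xy] by auto
    show "curvature p (x + y) v w = curvature p x v w + curvature p y v w"
      using curvature_eq[OF U smooth_field_add[OF U(1) s(3,4)] s(1,2)]
        curvature_field_add_1[OF U s(3,1,2,4)]
      by (simp add: e curvature_def)
  next
    fix a x assume x: "x \<in> tangent_space p"
    obtain U where U: "openin M U" "p \<in> U"
      and s: "smooth_field U (?e v)" "smooth_field U (?e w)" "smooth_field U (?e x)"
      and e: "?e v p = v" "?e w p = w" "?e x p = x"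
      using ext[OF x x] by auto
    show "curvature p (a *\<^sub>R x) v w = a *\<^sub>R curvature p x v w"
      using curvature_eq[OF U smooth_field_cscaleR[OF U(1) s(3)] s(1,2), of a]
        curvature_field_scale_1[OF U s(3,1,2) smooth_fun_const[OF U(1), of a]]
      by (simp add: e curvature_def)
  qed
  show "tangent_linear p (curvature p u v)"
  proof (rule tangent_linearI)
    fix x y assume xy: "x \<in> tangent_space p" "y \<in> tangent_space p"
    obtain U where U: "openin M U" "p \<in> U"
      and s: "smooth_field U (?e u)" "smooth_field U (?e v)" "smooth_field U (?e x)" "smooth_field U (?e y)"
      and e: "?e u p = u" "?e v p = v" "?e x p = x" "?e y p = y"
      using ext[OF xy] by auto
    show "curvature p u v (x + y) = curvature p u v x + curvature p u v y"
      using curvature_eq[OF U s(1,2) smooth_field_add[OF U(1) s(3,4)]]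
        curvature_field_add_3[OF U s(1,2,3,4)]
      by (simp add: e curvature_def)
  next
    fix a x assume x: "x \<in> tangent_space p"
    obtain U where U: "openin M U" "p \<in> U"
      and s: "smooth_field U (?e u)" "smooth_field U (?e v)" "smooth_field U (?e x)"
      and e: "?e u p = u" "?e v p = v" "?e x p = x"
      using ext[OF x x] by auto
    show "curvature p u v (a *\<^sub>R x) = a *\<^sub>R curvature p u v x"
      using curvature_eq[OF U s(1,2) smooth_field_cscaleR[OF U(1) s(3)], of a]
        curvature_field_scale_3[OF U s(1,2,3) smooth_fun_const[OF U(1), of a]]
      by (simp add: e curvature_def)
  qed
qed

end

lemma curvature_linear_2:
  assumes "p \<in> topspace M" "u \<in> tangent_space p" "w \<in> tangent_space p"
  shows "tangent_linear p (\<lambda>x. curvature p u x w)"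
proof (rule tangent_linearI)
  fix x y assume xy: "x \<in> tangent_space p" "y \<in> tangent_space p"
  show "curvature p u (x + y) w = curvature p u x w + curvature p u y w"
    using tangent_linear_add[OF curvature_linear_1[OF assms(1,2,2,3)] xy]
      curvature_skew[OF assms(1) xy(1) assms(2,3)] curvature_skew[OF assms(1) xy(2) assms(2,3)]
      curvature_skew[OF assms(1) tangent_add[OF xy] assms(2,3)] by simp
next
  fix a x assume x: "x \<in> tangent_space p"
  show "curvature p u (a *\<^sub>R x) w = a *\<^sub>R curvature p u x w"
    using tangent_linear_scaleR[OF curvature_linear_1[OF assms(1,2,2,3)] x, of a]
      curvature_skew[OF assms(1) x assms(2,3)]
      curvature_skew[OF assms(1) tangent_scaleR[OF x] assms(2,3)] by simp
qed

section \<open>Ricci and scalar curvature in an orthonormal frame\<close>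

lemma ricci_frame:
  assumes p: "p \<in> topspace M" and e: "orthonormal_frame p e"
    and u: "u \<in> tangent_space p" and v: "v \<in> tangent_space p"
  shows "ricci p u v = (\<Sum>i\<in>UNIV. g p (curvature p (e i) u v) (e i))"
  unfolding ricci_def
  by (rule tangent_trace_frame[OF p e curvature_linear_1[OF p u u v] curvature_tangent[OF p _ u v]])

lemma ricci_bilinear:
  assumes p: "p \<in> topspace M"
  shows "tangent_bilinear p (ricci p)"
proof -
  obtain W E where W: "openin M W" "p \<in> W" "orthonormal_frame p (\<lambda>i. E i p)"
    using local_orthonormal_frame[OF p] by metis
  note e = orthonormal_frameD(1)[OF W(3)] and R = ricci_frame[OF p W(3)]
  note g1 = tangent_linear_add[OF metric_linear(2)[OF p e]]
  note g2 = tangent_linear_scaleR[OF metric_linear(2)[OF p e]]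
  note c = curvature_tangent[OF p e]
  show ?thesis
  proof (intro tangent_bilinearI tangent_linearI)
    fix u v w and a :: real
    assume u: "u \<in> tangent_space p" and v: "v \<in> tangent_space p"
    show "ricci p u (a *\<^sub>R v) = a *\<^sub>R ricci p u v"
      using u v by (simp add: R tangent_scaleR g2 c sum_distrib_left
          tangent_linear_scaleR[OF curvature_linear_3[OF p e u u]])
    show "ricci p (a *\<^sub>R v) u = a *\<^sub>R ricci p v u"
      using u v by (simp add: R tangent_scaleR g2 c sum_distrib_left
          tangent_linear_scaleR[OF curvature_linear_2[OF p e u]])
    assume w: "w \<in> tangent_space p"
    show "ricci p u (v + w) = ricci p u v + ricci p u w"
      using u v w by (simp add: R tangent_add g1 c sum.distrib
          tangent_linear_add[OF curvature_linear_3[OF p e u u]] del: plus_fun_apply)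
    show "ricci p (v + w) u = ricci p v u + ricci p w u"
      using u v w by (simp add: R tangent_add g1 c sum.distrib
          tangent_linear_add[OF curvature_linear_2[OF p e u]] del: plus_fun_apply)
  qed
qed

lemma scal_frame:
  assumes "p \<in> topspace M" "orthonormal_frame p e"
  shows "scal p = (\<Sum>i\<in>UNIV. ricci p (e i) (e i))"
  unfolding scal_def by (rule metric_trace_frame[OF assms ricci_bilinear[OF assms(1)]])

section \<open>The second Bianchi identity\<close>

definition cov_deriv_curvature ::
  "('a, 'n) vector_field \<Rightarrow> ('a, 'n) vector_field \<Rightarrow> ('a, 'n) vector_field \<Rightarrow> ('a, 'n) vector_field
      \<Rightarrow> ('a, 'n) vector_field" where
  "cov_deriv_curvature X Y Z V = nabla X (curvature_field Y Z V) - curvature_field (nabla X Y) Z V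
     - curvature_field Y (nabla X Z) V - curvature_field Y Z (nabla X V)"

text \<open>Writing \<open>R(Y, Z)\<close> as \<open>[\<nabla>\<^sub>Y, \<nabla>\<^sub>Z] - \<nabla>\<^bsub>[Y, Z]\<^esub>\<close>, the cyclic sum of the triple commutators
  of \<open>\<nabla>\<^sub>X\<close>, \<open>\<nabla>\<^sub>Y\<close>, \<open>\<nabla>\<^sub>Z\<close> vanishes. The terms in which a covariant derivative enters
  \<open>R\<close> combine, by vanishing torsion, to the cyclic sum of \<open>R([X, Y], Z)\<close>; the Jacobi identity does
  the rest.\<close>

lemma second_bianchi:
  assumes W: "openin M W" "p \<in> W" and X: "smooth_field W X" and Y: "smooth_field W Y"
    and Z: "smooth_field W Z" and V: "smooth_field W V"
  shows "cov_deriv_curvature X Y Z V p + cov_deriv_curvature Y Z X V p + cov_deriv_curvature Z X Y V p = 0"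
proof -
  note n = smooth_nabla[OF W(1)] and L = smooth_lie_bracket[OF W(1)]
  note R = curvature_field_apply[OF W]
  have 1: "nabla X (curvature_field Y Z V) p =
      nabla X (nabla Y (nabla Z V)) p - nabla X (nabla Z (nabla Y V)) p - nabla X (nabla (lie_bracket Y Z) V) p"
    if "smooth_field W X" "smooth_field W Y" "smooth_field W Z" for X Y Z
    unfolding curvature_field_def
    using that V by (simp add: nabla_diff_right[OF W] n L smooth_field_diff W)
  have 2: "curvature_field (nabla X Y) Z V p + curvature_field Z (nabla Y X) V p =
      nabla (lie_bracket X Y) (nabla Z V) p - nabla Z (nabla (lie_bracket X Y) V) p
      - nabla (lie_bracket (lie_bracket X Y) Z) V p"
    if XYZ: "smooth_field W X" "smooth_field W Y" "smooth_field W Z" for X Y Z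
  proof -
    have "curvature_field (nabla X Y) Z V p = curvature_field (nabla Y X + lie_bracket X Y) Z V p"
      using XYZ V lie_bracket_nabla[OF W(1) _ XYZ(1,2)]
      by (intro curvature_field_cong[OF W]) (simp_all add: smooth_field_add n L W)
    also have "\<dots> = curvature_field (nabla Y X) Z V p + curvature_field (lie_bracket X Y) Z V p"
      by (rule curvature_field_add_1[OF W n[OF XYZ(2,1)] XYZ(3) V L[OF XYZ(1,2)]])
    finally show ?thesis
      using curvature_field_skew[OF W n[OF XYZ(2,1)] XYZ(3) V] R[OF L[OF XYZ(1,2)] XYZ(3) V] by simp
  qed
  let ?J = "lie_bracket (lie_bracket X Y) Z + lie_bracket (lie_bracket Y Z) X + lie_bracket (lie_bracket Z X) Y"
  have "nabla ?J V p = nabla (\<lambda>q. 0 *\<^sub>R X q) V p"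
    by (rule nabla_cong[OF W smooth_field_cscaleR[OF W(1) X] V])
       (simp_all add: jacobi_identity[OF W(1) _ X Y Z])
  also have "\<dots> = 0"
    using nabla_scale_left[OF W smooth_fun_const[OF W(1), of 0] X V] by simp
  finally have J: "nabla (lie_bracket (lie_bracket X Y) Z) V p + nabla (lie_bracket (lie_bracket Y Z) X) V p
      + nabla (lie_bracket (lie_bracket Z X) Y) V p = 0"
    using X Y Z V by (simp add: nabla_add_left[OF W] L smooth_field_add W del: plus_fun_apply)
  have 3: "curvature_field Y Z (nabla X V) p = nabla Y (nabla Z (nabla X V)) p - nabla Z (nabla Y (nabla X V)) p
      - nabla (lie_bracket Y Z) (nabla X V) p"
    if "smooth_field W X" "smooth_field W Y" "smooth_field W Z" for X Y Z
    by (rule R[OF that(2,3) n[OF that(1) V]])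
  let ?T = "\<lambda>X Y Z. nabla (lie_bracket X Y) (nabla Z V) p - nabla Z (nabla (lie_bracket X Y) V) p
      - (curvature_field (nabla X Y) Z V p + curvature_field Z (nabla Y X) V p)"
  have "cov_deriv_curvature X Y Z V p + cov_deriv_curvature Y Z X V p + cov_deriv_curvature Z X Y V p
      = ?T X Y Z + ?T Y Z X + ?T Z X Y"
    by (simp add: cov_deriv_curvature_def 1 3 X Y Z)
  also have "\<dots> = nabla (lie_bracket (lie_bracket X Y) Z) V p + nabla (lie_bracket (lie_bracket Y Z) X) V p
      + nabla (lie_bracket (lie_bracket Z X) Y) V p"
    unfolding 2[OF X Y Z] 2[OF Y Z X] 2[OF Z X Y] by simp
  finally show ?thesis using J by simp
qed

end

context levi_civita_connection
begin

text \<open>Skewness of \<open>R(X, Y)\<close> is the commutator formula for the function \<open>g(Z, V)\<close>, expanded by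
  metric compatibility.\<close>

lemma curvature_metric_skew:
  assumes W: "openin M W" "p \<in> W"
    and X: "smooth_field W X" and Y: "smooth_field W Y" and Z: "smooth_field W Z"
    and V: "smooth_field W V"
  shows "g p (curvature_field X Y Z p) (V p) = - g p (curvature_field X Y V p) (Z p)"
proof -
  note n = smooth_nabla[OF W(1)] and L = smooth_lie_bracket[OF W(1) X Y]
  note pM = topspaceI[OF W] and t = smooth_field_tangent[OF _ W(2)]
  let ?h = "\<lambda>q. g q (Z q) (V q)"
  have D: "dir_deriv (\<lambda>q. dir_deriv ?h q (Y q)) p (X p) =
      g p (nabla X (nabla Y Z) p) (V p) + g p (nabla Y Z p) (nabla X V p)
      + (g p (nabla X Z p) (nabla Y V p) + g p (Z p) (nabla X (nabla Y V) p))"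
    if X: "smooth_field W X" and Y: "smooth_field W Y" for X Y
  proof -
    note s = metric_smooth[OF W(1) n[OF Y Z] V] metric_smooth[OF W(1) Z n[OF Y V]]
    have "dir_deriv (\<lambda>q. dir_deriv ?h q (Y q)) p (X p) =
        dir_deriv (\<lambda>q. g q (nabla Y Z q) (V q) + g q (Z q) (nabla Y V q)) p (X p)"
      by (rule dir_deriv_cong[OF W smooth_fun_add[OF W(1) s]])
         (rule metric_compatible[OF W(1) Y Z V])
    then show ?thesis
      by (simp add: dir_deriv_add[OF W s] metric_compatible[OF W(1) X n[OF Y Z] V W(2)]
          metric_compatible[OF W(1) X Z n[OF Y V] W(2)])
  qed
  have R: "g p (curvature_field X Y S p) (T p) = g p (nabla X (nabla Y S) p) (T p)
      - g p (nabla Y (nabla X S) p) (T p) - g p (nabla (lie_bracket X Y) S p) (T p)"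
    if "smooth_field W S" "smooth_field W T" for S T
    unfolding curvature_field_apply[OF W X Y that(1)]
    using tangent_linear_diff[OF metric_linear(2)[OF pM t[OF that(2)]]] X Y L that
    by (simp add: tangent_diff t n)
  have "g p (Z p) (nabla X (nabla Y V) p) = g p (nabla X (nabla Y V) p) (Z p)"
    "g p (Z p) (nabla Y (nabla X V) p) = g p (nabla Y (nabla X V) p) (Z p)"
    "g p (Z p) (nabla (lie_bracket X Y) V p) = g p (nabla (lie_bracket X Y) V p) (Z p)"
    by (intro metric_sym[OF pM] t n X Y Z V L)+
  then show ?thesis
    using bracket_commutator[OF W metric_smooth[OF W(1) Z V] X Y] D[OF X Y] D[OF Y X]
      metric_compatible[OF W(1) L Z V W(2)] R[OF Z V] R[OF V Z]
    by simp
qed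

lemma metric_cov_deriv_curvature:
  assumes W: "openin M W" "p \<in> W"
    and X: "smooth_field W X" and Y: "smooth_field W Y" and Z: "smooth_field W Z"
    and V: "smooth_field W V" and U: "smooth_field W U"
  shows "g p (cov_deriv_curvature X Y Z V p) (U p) =
     dir_deriv (\<lambda>q. g q (curvature_field Y Z V q) (U q)) p (X p)
     - g p (curvature_field Y Z V p) (nabla X U p)
     - g p (curvature_field (nabla X Y) Z V p) (U p)
     - g p (curvature_field Y (nabla X Z) V p) (U p)
     - g p (curvature_field Y Z (nabla X V) p) (U p)"
proof -
  note n = smooth_nabla[OF W(1)] and R = smooth_curvature_field[OF W(1)]
  note pM = topspaceI[OF W] and t = smooth_field_tangent[OF _ W(2)]
  show ?thesis
    using tangent_linear_diff[OF metric_linear(2)[OF pM t[OF U]]] X Y Z V U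
    by (simp add: cov_deriv_curvature_def tangent_diff t n R
        metric_compatible[OF W(1) X R[OF Y Z V] U W(2)])
qed

context
  fixes W p X Y Z V U
  assumes W: "openin M W" "p \<in> W"
    and X: "smooth_field W X" and Y: "smooth_field W Y" and Z: "smooth_field W Z"
    and V: "smooth_field W V" and U: "smooth_field W U"
begin

lemma cov_deriv_curvature_skew:
  "g p (cov_deriv_curvature X Z Y V p) (U p) = - g p (cov_deriv_curvature X Y Z V p) (U p)"
proof -
  note n = smooth_nabla[OF W(1)] and R = smooth_curvature_field[OF W(1)]
  have skew: "g q (curvature_field Z Y V q) (u q) = - g q (curvature_field Y Z V q) (u q)"
    if "q \<in> W" "smooth_field W Y" "smooth_field W Z" "smooth_field W V" "smooth_field W u" for q Y Z V u
    using tangent_linear_minus[OF metric_linear(2)[OF topspaceI[OF W(1) that(1)]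
        smooth_field_tangent[OF that(5,1)]] smooth_field_tangent[OF R[OF that(2-4)] that(1)]]
    by (simp add: curvature_field_skew[OF W(1) that(1-4)])
  note s = metric_smooth[OF W(1) R[OF Y Z V] U]
  have "dir_deriv (\<lambda>q. g q (curvature_field Z Y V q) (U q)) p (X p)
      = dir_deriv (\<lambda>q. - 1 * g q (curvature_field Y Z V q) (U q)) p (X p)"
    by (rule dir_deriv_cong[OF W smooth_fun_mult[OF W(1) smooth_fun_const[OF W(1)] s]])
       (simp add: skew[OF _ Y Z V U])
  then have "dir_deriv (\<lambda>q. g q (curvature_field Z Y V q) (U q)) p (X p)
      = - dir_deriv (\<lambda>q. g q (curvature_field Y Z V q) (U q)) p (X p)"
    using dir_deriv_cmult[OF W s, of "-1"] by simp
  then show ?thesis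
    using skew[OF W(2) Y Z V n[OF X U]] skew[OF W(2) n[OF X Y] Z V U] skew[OF W(2) Y n[OF X Z] V U]
      skew[OF W(2) Y Z n[OF X V] U]
    by (simp add: metric_cov_deriv_curvature[OF W X Y Z V U] metric_cov_deriv_curvature[OF W X Z Y V U])
qed

lemma cov_deriv_curvature_metric_skew:
  "g p (cov_deriv_curvature X Y Z V p) (U p) = - g p (cov_deriv_curvature X Y Z U p) (V p)"
proof -
  note n = smooth_nabla[OF W(1)] and R = smooth_curvature_field[OF W(1)]
  note skew = curvature_metric_skew[OF W(1)]
  note s = metric_smooth[OF W(1) R[OF Y Z U] V]
  have "dir_deriv (\<lambda>q. g q (curvature_field Y Z V q) (U q)) p (X p)
      = dir_deriv (\<lambda>q. - 1 * g q (curvature_field Y Z U q) (V q)) p (X p)"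
    by (rule dir_deriv_cong[OF W smooth_fun_mult[OF W(1) smooth_fun_const[OF W(1)] s]])
       (simp add: skew[OF _ Y Z V U])
  then have "dir_deriv (\<lambda>q. g q (curvature_field Y Z V q) (U q)) p (X p)
      = - dir_deriv (\<lambda>q. g q (curvature_field Y Z U q) (V q)) p (X p)"
    using dir_deriv_cmult[OF W s, of "-1"] by simp
  then show ?thesis
    using skew[OF W(2) Y Z V n[OF X U]] skew[OF W(2) n[OF X Y] Z V U] skew[OF W(2) Y n[OF X Z] V U]
      skew[OF W(2) Y Z n[OF X V] U]
    by (simp add: metric_cov_deriv_curvature[OF W X Y Z V U] metric_cov_deriv_curvature[OF W X Y Z U V])
qed

end

section \<open>The contracted Bianchi identity\<close>

definition cov_deriv_ricci ::
  "'a \<Rightarrow> ('a, 'n) vector_field \<Rightarrow> ('a, 'n) vector_field \<Rightarrow> ('a, 'n) vector_field \<Rightarrow> real" where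
  "cov_deriv_ricci p X Y Z = dir_deriv (\<lambda>q. ricci q (Y q) (Z q)) p (X p)
     - ricci p (nabla X Y p) (Z p) - ricci p (Y p) (nabla X Z p)"

context
  fixes W and E :: "'n \<Rightarrow> ('a, 'n) vector_field"
  assumes W: "openin M W" and E: "\<And>i. smooth_field W (E i)"
    and on: "\<And>q. q \<in> W \<Longrightarrow> orthonormal_frame q (\<lambda>i. E i q)"
begin

lemma ricci_frame_field:
  assumes "q \<in> W" and X: "smooth_field W X" and Y: "smooth_field W Y"
  shows "ricci q (X q) (Y q) = (\<Sum>e\<in>UNIV. g q (curvature_field (E e) X Y q) (E e q))"
  by (simp add: ricci_frame[OF topspaceI[OF W \<open>q \<in> W\<close>] on[OF \<open>q \<in> W\<close>]
      smooth_field_tangent[OF X \<open>q \<in> W\<close>] smooth_field_tangent[OF Y \<open>q \<in> W\<close>]]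
      curvature_eq[OF W \<open>q \<in> W\<close> E X Y])

lemma smooth_ricci:
  assumes X: "smooth_field W X" and Y: "smooth_field W Y"
  shows "smooth_fun W (\<lambda>q. ricci q (X q) (Y q))"
proof -
  have "smooth_fun W (\<lambda>q. \<Sum>e\<in>UNIV. g q (curvature_field (E e) X Y q) (E e q))"
    by (intro smooth_fun_sum metric_smooth smooth_curvature_field W E X Y)
  then show ?thesis
    using smooth_fun_cong[OF W, of "\<lambda>q. ricci q (X q) (Y q)"] ricci_frame_field[OF _ X Y] by simp
qed

lemma smooth_scal: "smooth_fun W scal"
proof -
  have "smooth_fun W (\<lambda>q. \<Sum>a\<in>UNIV. ricci q (E a q) (E a q))"
    by (intro smooth_fun_sum smooth_ricci W E)
  then show ?thesis
    using smooth_fun_cong[OF W, of scal] scal_frame[OF topspaceI[OF W] on] by simp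
qed

text \<open>The coefficients \<open>g(\<nabla>\<^sub>X E\<^sub>i, E\<^sub>j)\<close> are skew in \<open>i\<close> and \<open>j\<close>, since \<open>g(E\<^sub>i, E\<^sub>j)\<close> is constant.
  Hence traces of tensors commute with covariant derivatives.\<close>

lemma frame_derivative_cancel:
  assumes p: "p \<in> W" and X: "smooth_field W X" and B: "tangent_bilinear p B"
  shows "(\<Sum>e\<in>UNIV. B (nabla X (E e) p) (E e p) + B (E e p) (nabla X (E e) p)) = 0"
proof -
  note pM = topspaceI[OF W p] and t = smooth_field_tangent[OF _ p]
  note n = t[OF smooth_nabla[OF W X E]] and Et = t[OF E]
  let ?\<omega> = "\<lambda>i j. g p (nabla X (E i) p) (E j p)"
  have skew: "?\<omega> i j = - ?\<omega> j i" for i j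
  proof -
    have "dir_deriv (\<lambda>q. g q (E i q) (E j q)) p (X p) = dir_deriv (\<lambda>q. if i = j then 1 else 0) p (X p)"
      by (rule dir_deriv_cong[OF W p smooth_fun_const[OF W]]) (simp add: orthonormal_frameD(2)[OF on])
    then show ?thesis
      using metric_compatible[OF W X E E p, of i j] metric_sym[OF pM Et n, of i j]
      by (simp add: dir_deriv_const)
  qed
  have x: "nabla X (E i) p = (\<Sum>j\<in>UNIV. ?\<omega> i j *\<^sub>R E j p)" for i
    by (rule frame_expansion[OF pM on[OF p] n])
  have 1: "B (nabla X (E i) p) (E i p) = (\<Sum>j\<in>UNIV. ?\<omega> i j * B (E j p) (E i p))" for i
    using tangent_linear_sum_scaleR[OF tangent_bilinearD(2)[OF B Et[of i]], of UNIV "\<lambda>j. E j p" "?\<omega> i"] Et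
    by (simp add: x[of i, symmetric])
  have 2: "B (E i p) (nabla X (E i) p) = (\<Sum>j\<in>UNIV. ?\<omega> i j * B (E i p) (E j p))" for i
    using tangent_linear_sum_scaleR[OF tangent_bilinearD(1)[OF B Et[of i]], of UNIV "\<lambda>j. E j p" "?\<omega> i"] Et
    by (simp add: x[of i, symmetric])
  have "(\<Sum>i\<in>UNIV. \<Sum>j\<in>UNIV. ?\<omega> i j * B (E i p) (E j p)) =
      (\<Sum>i\<in>UNIV. \<Sum>j\<in>UNIV. ?\<omega> j i * B (E j p) (E i p))"
    by (rule sum.swap)
  also have "\<dots> = - (\<Sum>i\<in>UNIV. \<Sum>j\<in>UNIV. ?\<omega> i j * B (E j p) (E i p))"
    unfolding sum_negf[symmetric]
  proof (intro sum.cong refl)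
    fix i j show "?\<omega> j i * B (E j p) (E i p) = - (?\<omega> i j * B (E j p) (E i p))"
      by (subst skew[of j i]) simp
  qed
  finally show ?thesis by (simp only: sum.distrib 1 2)
qed

text \<open>Both the curvature and the frame depend on the point, but the derivatives of the frame cancel,
  so the covariant derivative of the trace is the trace of the covariant derivative.\<close>

lemma cov_deriv_ricci_frame:
  assumes p: "p \<in> W" and X: "smooth_field W X" and Y: "smooth_field W Y" and Z: "smooth_field W Z"
  shows "cov_deriv_ricci p X Y Z = (\<Sum>e\<in>UNIV. g p (cov_deriv_curvature X (E e) Y Z p) (E e p))"
proof -
  note pM = topspaceI[OF W p] and t = smooth_field_tangent[OF _ p]
  note n = smooth_nabla[OF W X] and Et = t[OF E]
  note YZ = t[OF Y] t[OF Z]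
  let ?B = "\<lambda>u v. g p (curvature p u (Y p) (Z p)) v"
  have B: "tangent_bilinear p ?B"
  proof (rule tangent_bilinearI)
    fix u assume u: "u \<in> tangent_space p"
    show "tangent_linear p (?B u)"
      by (rule metric_linear(1)[OF pM curvature_tangent[OF pM u YZ]])
    show "tangent_linear p (\<lambda>v. ?B v u)"
      by (rule tangent_linearI)
         (simp_all add: tangent_linear_add[OF curvature_linear_1[OF pM u YZ]]
           tangent_linear_scaleR[OF curvature_linear_1[OF pM u YZ]] curvature_tangent[OF pM _ YZ]
           tangent_linear_add[OF metric_linear(2)[OF pM u]]
           tangent_linear_scaleR[OF metric_linear(2)[OF pM u]] del: plus_fun_apply)
  qed
  have c: "?B (V p) w = g p (curvature_field V Y Z p) w" if "smooth_field W V" for V w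
    by (simp add: curvature_eq[OF W p that Y Z])
  have cancel: "(\<Sum>e\<in>UNIV. g p (curvature_field (nabla X (E e)) Y Z p) (E e p)
      + g p (curvature_field (E e) Y Z p) (nabla X (E e) p)) = 0"
    using frame_derivative_cancel[OF p X B] by (simp add: c E n)
  have s: "smooth_fun W (\<lambda>q. g q (curvature_field (E e) Y Z q) (E e q))" for e
    by (intro metric_smooth smooth_curvature_field W E Y Z)
  have D: "dir_deriv (\<lambda>q. ricci q (Y q) (Z q)) p (X p) =
      (\<Sum>e\<in>UNIV. dir_deriv (\<lambda>q. g q (curvature_field (E e) Y Z q) (E e q)) p (X p))"
    unfolding dir_deriv_sum[OF W p s, symmetric]
    by (rule dir_deriv_cong[OF W p smooth_fun_sum[OF W s]]) (rule ricci_frame_field[OF _ Y Z])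
  show ?thesis
    unfolding cov_deriv_ricci_def D ricci_frame_field[OF p n[OF Y] Z] ricci_frame_field[OF p Y n[OF Z]]
      metric_cov_deriv_curvature[OF W p X E Y Z E]
    using cancel by (simp add: sum_subtractf sum.distrib)
qed

lemma dir_deriv_scal:
  assumes p: "p \<in> W" and X: "smooth_field W X"
  shows "dir_deriv scal p (X p) = (\<Sum>a\<in>UNIV. cov_deriv_ricci p X (E a) (E a))"
proof -
  note s = smooth_ricci[OF E E]
  have "dir_deriv scal p (X p) = (\<Sum>a\<in>UNIV. dir_deriv (\<lambda>q. ricci q (E a q) (E a q)) p (X p))"
    unfolding dir_deriv_sum[OF W p s, symmetric]
    by (rule dir_deriv_cong[OF W p smooth_fun_sum[OF W s]]) (rule scal_frame[OF topspaceI[OF W] on])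
  then show ?thesis
    using frame_derivative_cancel[OF p X ricci_bilinear[OF topspaceI[OF W p]]]
    by (simp add: cov_deriv_ricci_def sum_subtractf sum.distrib)
qed

text \<open>Let \<open>T(x, y, z, v, w) = g((\<nabla>\<^sub>x R)(y, z) v, w)\<close> on the frame. Summing the second Bianchi
  identity for \<open>T(i, e, m, i, e)\<close> over \<open>i\<close> and \<open>e\<close> gives three sums. By skewness in \<open>(y, z)\<close> and in
  \<open>(v, w)\<close>, the first two both equal the divergence of the Ricci tensor at \<open>E\<^sub>m\<close>, and the third is
  minus the derivative of the scalar curvature.\<close>

theorem contracted_bianchi:
  assumes p: "p \<in> W"
  shows "2 * (\<Sum>i\<in>UNIV. cov_deriv_ricci p (E i) (E m) (E i)) = dir_deriv scal p (E m p)"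
proof -
  let ?T = "\<lambda>x y z v w. g p (cov_deriv_curvature (E x) (E y) (E z) (E v) p) (E w p)"
  note pM = topspaceI[OF W p] and t = smooth_field_tangent[OF _ p]
  have cov: "smooth_field W (cov_deriv_curvature (E x) (E y) (E z) (E v))" for x y z v
    unfolding cov_deriv_curvature_def
    by (intro smooth_field_diff smooth_nabla smooth_curvature_field W E)
  have s12: "?T x z y v w = - ?T x y z v w" for x y z v w
    by (rule cov_deriv_curvature_skew[OF W p E E E E E])
  have s34: "?T x y z v w = - ?T x y z w v" for x y z v w
    by (rule cov_deriv_curvature_metric_skew[OF W p E E E E E])
  have bianchi: "?T x y z v w + ?T y z x v w + ?T z x y v w = 0" for x y z v w
  proof -
    note lin = metric_linear(2)[OF pM t[OF E[of w]]]
    have "?T x y z v w + ?T y z x v w + ?T z x y v w =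
        g p (cov_deriv_curvature (E x) (E y) (E z) (E v) p + cov_deriv_curvature (E y) (E z) (E x) (E v) p
          + cov_deriv_curvature (E z) (E x) (E y) (E v) p) (E w p)"
      by (simp add: tangent_linear_add[OF lin] tangent_add t cov del: plus_fun_apply)
    then show ?thesis
      using second_bianchi[OF W p E E E E, of x y z v] tangent_linear_zero[OF lin] by simp
  qed
  define d where "d = (\<Sum>i\<in>UNIV. \<Sum>e\<in>UNIV. ?T i e m i e)"
  have "(\<Sum>i\<in>UNIV. \<Sum>e\<in>UNIV. ?T e m i i e) = (\<Sum>i\<in>UNIV. \<Sum>e\<in>UNIV. ?T i m e e i)"
    by (rule sum.swap)
  also have "\<dots> = d"
    unfolding d_def by (intro sum.cong refl) (metis s12 s34 minus_minus)
  finally have 2: "(\<Sum>i\<in>UNIV. \<Sum>e\<in>UNIV. ?T e m i i e) = d" .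
  have "(\<Sum>i\<in>UNIV. \<Sum>e\<in>UNIV. ?T m i e i e) = (\<Sum>i\<in>UNIV. \<Sum>e\<in>UNIV. ?T m e i e i)"
    by (rule sum.swap)
  also have "\<dots> = - (\<Sum>i\<in>UNIV. \<Sum>e\<in>UNIV. ?T m e i i e)"
    unfolding sum_negf[symmetric] by (intro sum.cong refl) (rule s34)
  finally have 3: "(\<Sum>i\<in>UNIV. \<Sum>e\<in>UNIV. ?T m i e i e) = - (\<Sum>i\<in>UNIV. \<Sum>e\<in>UNIV. ?T m e i i e)" .
  have "(\<Sum>i\<in>UNIV. \<Sum>e\<in>UNIV. ?T i e m i e + ?T e m i i e + ?T m i e i e) = 0"
    by (simp only: bianchi sum.neutral_const)
  then have "d + d - (\<Sum>i\<in>UNIV. \<Sum>e\<in>UNIV. ?T m e i i e) = 0"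
    by (simp only: sum.distrib 2 3 d_def[symmetric] add_uminus_conv_diff)
  then show ?thesis
    by (simp add: dir_deriv_scal[OF p E] cov_deriv_ricci_frame[OF p E E E] d_def)
qed

end

end

section \<open>The Cotton form\<close>

context levi_civita_connection
begin

lemma cov_deriv_endo_apply:
  "cov_deriv_endo F X Y p = nabla X (\<lambda>q. F q (Y q)) p - F p (nabla X Y p)"
  by (simp add: cov_deriv_endo_def)

lemma d_nabla_apply: "d_nabla F X Y p = cov_deriv_endo F X Y p - cov_deriv_endo F Y X p"
  by (simp add: d_nabla_def)

text \<open>The terms with derivatives of \<open>f\<close> in \<open>\<nabla>\<^sub>Y (F (f X))\<close> and \<open>F (\<nabla>\<^sub>Y (f X))\<close> agree, and
  skewness transfers the result from the first argument to the second.\<close>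

lemma d_nabla_tensorial:
  assumes W: "openin M W" "p \<in> W"
    and lin: "\<And>q. q \<in> W \<Longrightarrow> tangent_linear q (F q)"
    and smooth: "\<And>V X. openin M V \<Longrightarrow> V \<subseteq> W \<Longrightarrow> smooth_field V X \<Longrightarrow> smooth_field V (\<lambda>q. F q (X q))"
    and X: "smooth_field W X" "smooth_field W X'" "X p = X' p"
    and Y: "smooth_field W Y" "smooth_field W Y'" "Y p = Y' p"
  shows "d_nabla F X Y p = d_nabla F X' Y' p"
proof -
  have 1: "d_nabla F X Y p = d_nabla F X' Y p"
    if X: "smooth_field W X" "smooth_field W X'" "X p = X' p" and Y: "smooth_field W Y" for X X' Y
  proof (rule tensorial[OF W _ _ _ W X(1) W X(2,3), where \<Phi> = "\<lambda>X. d_nabla F X Y p"])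
    fix V X1 X2 assume V: "openin M V" "p \<in> V" "V \<subseteq> W" and X1: "smooth_field V X1"
    note t = smooth_field_tangent[OF _ V(2)] and n = smooth_nabla[OF V(1)]
    note Y' = smooth_field_subset[OF Y V(3)]
    note FS = smooth[OF V(1,3)]
    have linV: "tangent_linear q (F q)" if "q \<in> V" for q using lin that V(3) by auto
    note linp = lin[OF W(2)]
    show "d_nabla F (X1 + X2) Y p = d_nabla F X1 Y p + d_nabla F X2 Y p" if X2: "smooth_field V X2"
    proof -
      have "nabla Y (\<lambda>q. F q ((X1 + X2) q)) p = nabla Y ((\<lambda>q. F q (X1 q)) + (\<lambda>q. F q (X2 q))) p"
        by (rule nabla_cong[OF V(1,2) Y' smooth_field_add[OF V(1) FS[OF X1] FS[OF X2]]])
           (simp_all add: tangent_linear_add[OF linV] smooth_field_tangent[OF X1] smooth_field_tangent[OF X2])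
      then show ?thesis
        unfolding d_nabla_apply cov_deriv_endo_apply
        by (simp add: nabla_add_left[OF V(1,2) X1 X2] nabla_add_right[OF V(1,2) Y'] FS Y' X1 X2
            tangent_linear_add[OF linp] t n del: plus_fun_apply)
    qed
    show "d_nabla F (\<lambda>q. f q *\<^sub>R X1 q) Y p = f p *\<^sub>R d_nabla F X1 Y p" if f: "smooth_fun V f" for f
    proof -
      have "nabla Y (\<lambda>q. F q (f q *\<^sub>R X1 q)) p = nabla Y (\<lambda>q. f q *\<^sub>R F q (X1 q)) p"
        by (rule nabla_cong[OF V(1,2) Y' smooth_field_scaleR[OF V(1) f FS[OF X1]]])
           (simp_all add: tangent_linear_scaleR[OF linV] smooth_field_tangent[OF X1])
      then show ?thesis
        unfolding d_nabla_apply cov_deriv_endo_apply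
        by (simp add: nabla_scale_left[OF V(1,2) f X1] nabla_leibniz[OF V(1,2) f Y'] FS Y' X1
            tangent_linear_add[OF linp] tangent_linear_scaleR[OF linp] tangent_scaleR t n
            del: plus_fun_apply) (simp add: algebra_simps)
    qed
    show "d_nabla F X2 Y p = d_nabla F X1 Y p" if eq: "\<And>q. q \<in> V \<Longrightarrow> X2 q = X1 q"
    proof -
      have "nabla X2 (\<lambda>q. F q (Y q)) p = nabla X1 (\<lambda>q. F q (Y q)) p"
        "nabla X2 Y p = nabla X1 Y p" "nabla Y X2 p = nabla Y X1 p"
        "nabla Y (\<lambda>q. F q (X2 q)) p = nabla Y (\<lambda>q. F q (X1 q)) p"
        by (intro nabla_cong[OF V(1,2)] X1 Y' FS; simp add: eq)+
      then show ?thesis unfolding d_nabla_apply cov_deriv_endo_apply by simp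
    qed
  qed
  have skew: "d_nabla F X Y p = - d_nabla F Y X p" for X Y by (simp add: d_nabla_def)
  have "d_nabla F X Y p = d_nabla F X' Y p" by (rule 1[OF X Y(1)])
  also have "\<dots> = - d_nabla F Y X' p" by (rule skew)
  also have "\<dots> = - d_nabla F Y' X' p" by (simp only: 1[OF Y X(2)])
  also have "\<dots> = d_nabla F X' Y' p" by (rule skew[symmetric])
  finally show ?thesis .
qed

end

context oriented_riemannian_3_manifold_levi_civita
begin

lemma schouten_bilinear:
  assumes p: "p \<in> topspace M" shows "tangent_bilinear p (schouten p)"
proof (intro tangent_bilinearI tangent_linearI)
  fix u v w and a :: real
  assume u: "u \<in> tangent_space p" and v: "v \<in> tangent_space p"
  note r = tangent_bilinearD[OF ricci_bilinear[OF p] u] and m = metric_linear[OF p u]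
  show "schouten p u (a *\<^sub>R v) = a *\<^sub>R schouten p u v" "schouten p (a *\<^sub>R v) u = a *\<^sub>R schouten p v u"
    using r[THEN tangent_linear_scaleR, OF v] m[THEN tangent_linear_scaleR, OF v]
    by (simp_all add: schouten_def algebra_simps)
  assume w: "w \<in> tangent_space p"
  show "schouten p u (v + w) = schouten p u v + schouten p u w"
    "schouten p (v + w) u = schouten p v u + schouten p w u"
    using r[THEN tangent_linear_add, OF v w] m[THEN tangent_linear_add, OF v w]
    by (simp_all only: schouten_def) (simp_all add: algebra_simps)
qed

context
  fixes p
  assumes p: "p \<in> topspace M"
begin

lemma schouten_endo_frame:
  assumes "orthonormal_frame p e" "u \<in> tangent_space p"
  shows "schouten_endo p u = (\<Sum>i\<in>UNIV. schouten p u (e i) *\<^sub>R e i)"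
  unfolding schouten_endo_def
  by (rule sharp_frame[OF p assms(1)]) (rule tangent_bilinearD(1)[OF schouten_bilinear[OF p] assms(2)])

lemma frame_exists: "\<exists>e. orthonormal_frame p e"
  using local_orthonormal_frame[OF p] by metis

lemma schouten_endo_tangent:
  assumes "u \<in> tangent_space p"
  shows "schouten_endo p u \<in> tangent_space p"
proof -
  obtain e where e: "orthonormal_frame p e" using frame_exists by blast
  show ?thesis
    unfolding schouten_endo_frame[OF e assms] by (intro tangent_sum tangent_scaleR orthonormal_frameD[OF e])
qed

lemma schouten_endo_linear: "tangent_linear p (schouten_endo p)"
proof -
  obtain e where e: "orthonormal_frame p e" using frame_exists by blast
  note s = tangent_bilinearD(2)[OF schouten_bilinear[OF p] orthonormal_frameD(1)[OF e]]
  show ?thesis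
    by (rule tangent_linearI)
       (simp_all only: schouten_endo_frame[OF e] tangent_add tangent_scaleR tangent_linear_add[OF s]
         tangent_linear_scaleR[OF s] sum.distrib scaleR_sum_right scaleR_add_left scaleR_scaleR real_scaleR_def)
qed

lemma metric_schouten_endo:
  assumes u: "u \<in> tangent_space p" and v: "v \<in> tangent_space p"
  shows "g p (schouten_endo p u) v = schouten p u v"
proof -
  obtain e where e: "orthonormal_frame p e" using frame_exists by blast
  note e' = orthonormal_frameD[OF e]
  have "g p (schouten_endo p u) v = (\<Sum>i\<in>UNIV. schouten p u (e i) * g p v (e i))"
    using tangent_linear_sum_scaleR[OF metric_linear(2)[OF p v], of UNIV e "\<lambda>i. schouten p u (e i)"] e'
      metric_sym[OF p v e'(1)]
    by (simp add: schouten_endo_frame[OF e u])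
  also have "\<dots> = schouten p u (\<Sum>i\<in>UNIV. g p v (e i) *\<^sub>R e i)"
    using tangent_linear_sum_scaleR[OF tangent_bilinearD(1)[OF schouten_bilinear[OF p] u],
        of UNIV e "\<lambda>i. g p v (e i)"] e' by (simp add: mult.commute)
  also have "(\<Sum>i\<in>UNIV. g p v (e i) *\<^sub>R e i) = v" by (rule frame_expansion[OF p e v, symmetric])
  finally show ?thesis .
qed

end

context
  fixes W and E :: "3 \<Rightarrow> ('a, 3) vector_field"
  assumes W: "openin M W" and E: "\<And>i. smooth_field W (E i)"
    and on: "\<And>q. q \<in> W \<Longrightarrow> orthonormal_frame q (\<lambda>i. E i q)"
begin

lemma smooth_schouten:
  assumes X: "smooth_field W X" and Y: "smooth_field W Y"
  shows "smooth_fun W (\<lambda>q. schouten q (X q) (Y q))"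
proof -
  have "smooth_fun W (\<lambda>q. ricci q (X q) (Y q) - (1/4 * scal q) * g q (X q) (Y q))"
    by (intro smooth_fun_diff smooth_fun_mult smooth_fun_const smooth_ricci[OF W E on]
        smooth_scal[OF W E on] metric_smooth W X Y)
  then show ?thesis by (simp add: schouten_def)
qed

lemma smooth_schouten_endo:
  assumes X: "smooth_field W X"
  shows "smooth_field W (\<lambda>q. schouten_endo q (X q))"
proof -
  have "smooth_field W (\<lambda>q. \<Sum>i\<in>UNIV. schouten q (X q) (E i q) *\<^sub>R E i q)"
    by (intro smooth_field_sum smooth_field_scaleR smooth_schouten W X E)
  then show ?thesis
    using smooth_field_cong[OF W, of "\<lambda>q. schouten_endo q (X q)"]
      schouten_endo_frame[OF topspaceI[OF W] on smooth_field_tangent[OF X]] by simp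
qed

text \<open>Lowering the index commutes with the covariant derivative, by metric compatibility. The term with
  the metric contributes only the derivative of its coefficient \<open>scal / 4\<close>, the metric being parallel.\<close>

lemma metric_cov_deriv_schouten:
  assumes p: "p \<in> W" and X: "smooth_field W X" and Y: "smooth_field W Y" and Z: "smooth_field W Z"
  shows "g p (cov_deriv_endo schouten_endo X Y p) (Z p) =
    cov_deriv_ricci p X Y Z - dir_deriv scal p (X p) / 4 * g p (Y p) (Z p)"
proof -
  note pM = topspaceI[OF W p] and t = smooth_field_tangent[OF _ p] and n = smooth_nabla[OF W X]
  note FY = smooth_schouten_endo[OF Y]
  note sr = smooth_ricci[OF W E on Y Z] and ss = smooth_scal[OF W E on] and sg = metric_smooth[OF W Y Z]
  have sm: "smooth_fun W (\<lambda>q. 1/4 * scal q)" by (intro smooth_fun_mult smooth_fun_const W ss)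
  have "dir_deriv (\<lambda>q. g q (schouten_endo q (Y q)) (Z q)) p (X p) =
      dir_deriv (\<lambda>q. ricci q (Y q) (Z q) - (1/4 * scal q) * g q (Y q) (Z q)) p (X p)"
  proof (rule dir_deriv_cong[OF W p smooth_fun_diff[OF W sr smooth_fun_mult[OF W sm sg]]])
    fix q assume q: "q \<in> W"
    have "g q (schouten_endo q (Y q)) (Z q) = schouten q (Y q) (Z q)"
      by (intro metric_schouten_endo topspaceI[OF W] smooth_field_tangent[OF Y] smooth_field_tangent[OF Z] q)
    then show "g q (schouten_endo q (Y q)) (Z q) = ricci q (Y q) (Z q) - (1/4 * scal q) * g q (Y q) (Z q)"
      by (simp add: schouten_def)
  qed
  also have "\<dots> = dir_deriv (\<lambda>q. ricci q (Y q) (Z q)) p (X p)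
      - (1/4 * scal p * (g p (nabla X Y p) (Z p) + g p (Y p) (nabla X Z p))
         + g p (Y p) (Z p) * (1/4 * dir_deriv scal p (X p)))"
    by (simp only: dir_deriv_diff[OF W p sr smooth_fun_mult[OF W sm sg]] dir_deriv_mult[OF W p sm sg]
        dir_deriv_cmult[OF W p ss] metric_compatible[OF W X Y Z p])
  finally have D: "dir_deriv (\<lambda>q. g q (schouten_endo q (Y q)) (Z q)) p (X p) = \<dots>" .
  have "g p (cov_deriv_endo schouten_endo X Y p) (Z p) =
      g p (nabla X (\<lambda>q. schouten_endo q (Y q)) p) (Z p) - g p (schouten_endo p (nabla X Y p)) (Z p)"
    using tangent_linear_diff[OF metric_linear(2)[OF pM t[OF Z]]] schouten_endo_tangent[OF pM] t n FY Y
    by (simp add: cov_deriv_endo_apply)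
  also have "g p (nabla X (\<lambda>q. schouten_endo q (Y q)) p) (Z p) =
      dir_deriv (\<lambda>q. g q (schouten_endo q (Y q)) (Z q)) p (X p) - g p (schouten_endo p (Y p)) (nabla X Z p)"
    using metric_compatible[OF W X FY Z p] by simp
  also have "g p (schouten_endo p (nabla X Y p)) (Z p) = schouten p (nabla X Y p) (Z p)"
    by (intro metric_schouten_endo pM t n Y Z)
  also have "g p (schouten_endo p (Y p)) (nabla X Z p) = schouten p (Y p) (nabla X Z p)"
    by (intro metric_schouten_endo pM t n Y Z)
  finally show ?thesis
    by (simp add: D schouten_def cov_deriv_ricci_def algebra_simps)
qed

end

context
  fixes W and E :: "3 \<Rightarrow> ('a, 3) vector_field"
  assumes W: "openin M W" and E: "\<And>i. smooth_field W (E i)"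
    and on: "\<And>q. q \<in> W \<Longrightarrow> orthonormal_frame q (\<lambda>i. E i q)"
begin

lemma cotton_form_eq:
  assumes p: "p \<in> W" and X: "smooth_field W X" and Y: "smooth_field W Y"
  shows "cotton_form p (X p) (Y p) = d_nabla schouten_endo X Y p"
proof -
  note t = smooth_field_tangent[OF _ p]
  obtain U where U: "openin M U" "p \<in> U" and
    e: "\<And>v. v \<in> {X p, Y p} \<Longrightarrow> smooth_field U (extension p v)"
      "\<And>v. v \<in> {X p, Y p} \<Longrightarrow> extension p v p = v"
    using common_extension[OF topspaceI[OF W p], of "{X p, Y p}"] t[OF X] t[OF Y] by auto
  have V: "openin M (W \<inter> U)" "p \<in> W \<inter> U" using W p U by auto
  show ?thesis
    unfolding cotton_form_def
  proof (rule d_nabla_tensorial[OF V])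
    show "tangent_linear q (schouten_endo q)" if "q \<in> W \<inter> U" for q
      using that by (intro schouten_endo_linear topspaceI[OF W]) auto
    show "smooth_field V (\<lambda>q. schouten_endo q (X q))"
      if "openin M V" "V \<subseteq> W \<inter> U" "smooth_field V X" for V X
      by (rule smooth_schouten_endo[OF that(1) smooth_field_subset[OF E] on that(3)]) (use that in auto)
  qed (auto simp: e intro: smooth_field_subset[OF X] smooth_field_subset[OF Y] smooth_field_subset[OF e(1)])
qed

text \<open>The sum is the divergence of the Schouten tensor minus the differential of its trace. The
  divergence is \<open>1/2 - 1/4\<close> times the differential of the scalar curvature, by the contracted Bianchi
  identity, and the trace is \<open>1 - 3/4\<close> times the scalar curvature, in dimension three.\<close>

lemma cotton_form_frame_trace:
  assumes p: "p \<in> W"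
  shows "(\<Sum>i\<in>UNIV. g p (cotton_form p (E i p) (E m p)) (E i p)) = 0"
proof -
  note pM = topspaceI[OF W p] and t = smooth_field_tangent[OF _ p]
  let ?s = "dir_deriv scal p (E m p)"
  have cov: "cov_deriv_endo schouten_endo (E i) (E j) p \<in> tangent_space p" for i j
    unfolding cov_deriv_endo_apply
    by (intro tangent_diff t smooth_nabla schouten_endo_tangent smooth_schouten_endo[OF W E on] W E pM)
  have cov_frame: "g p (cov_deriv_endo schouten_endo (E i) (E j) p) (E k p) =
      cov_deriv_ricci p (E i) (E j) (E k) - dir_deriv scal p (E i p) / 4 * (if j = k then 1 else 0)" for i j k
    using metric_cov_deriv_schouten[OF W E on p E[of i] E[of j] E[of k]]
      orthonormal_frameD(2)[OF on[OF p], of j k] by simp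
  have "g p (cotton_form p (E i p) (E m p)) (E i p) =
      cov_deriv_ricci p (E i) (E m) (E i) - (if m = i then dir_deriv scal p (E i p) / 4 else 0)
      - cov_deriv_ricci p (E m) (E i) (E i) + ?s / 4" for i
    unfolding cotton_form_eq[OF p E E] d_nabla_apply
      tangent_linear_diff[OF metric_linear(2)[OF pM t[OF E[of i]]] cov[of i m] cov[of m i]]
      cov_frame
    by simp
  then have "(\<Sum>i\<in>UNIV. g p (cotton_form p (E i p) (E m p)) (E i p)) =
      (\<Sum>i\<in>UNIV. cov_deriv_ricci p (E i) (E m) (E i)) - ?s / 4 - ?s + 3 * (?s / 4)"
    by (simp add: sum.distrib sum_subtractf dir_deriv_scal[OF W E on p E])
  then show ?thesis using contracted_bianchi[OF W E on p, of m] by simp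
qed

end

lemma cotton_form_trace:
  assumes p: "p \<in> topspace M" and S: "orthonormal_frame p S"
  shows "(\<Sum>i\<in>UNIV. g p (cotton_form p (S i) (S m)) (S i)) = 0"
proof -
  obtain W E where W: "openin M W" "p \<in> W" and E: "\<And>i. smooth_field W (E i)"
    and on: "\<And>q. q \<in> W \<Longrightarrow> orthonormal_frame q (\<lambda>i. E i q)" and Ep: "\<And>i. E i p = S i"
    by (rule local_orthonormal_frame_through[OF p S]) (rule that, assumption+)
  show ?thesis using cotton_form_frame_trace[OF W(1) E on W(2), of m] by (simp add: Ep)
qed

lemma cotton_form_skew: "cotton_form p v u = - cotton_form p u v"
  by (simp add: cotton_form_def d_nabla_def)

lemma cotton_form_tangent:
  assumes p: "p \<in> topspace M" and u: "u \<in> tangent_space p" and v: "v \<in> tangent_space p"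
  shows "cotton_form p u v \<in> tangent_space p"
proof -
  obtain W E where W: "openin M W" "p \<in> W" and E: "\<And>i. smooth_field W (E i)"
    and on: "\<And>q. q \<in> W \<Longrightarrow> orthonormal_frame q (\<lambda>i. E i q)"
    by (rule local_orthonormal_frame[OF p]) (rule that, assumption+)
  let ?e = "extension p"
  have "finite {u, v}" "{u, v} \<subseteq> tangent_space p" using u v by auto
  then obtain U where U: "openin M U" "p \<in> U" "\<And>x. x \<in> {u, v} \<Longrightarrow> smooth_field U (?e x)"
    by (rule common_extension[OF p]) (rule that, assumption+)
  let ?V = "W \<inter> U"
  have V: "openin M ?V" "p \<in> ?V" using W U by auto
  have e: "smooth_field ?V (?e u)" "smooth_field ?V (?e v)"
    by (rule smooth_field_subset[of U]; simp add: U)+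
  have F: "smooth_field ?V (\<lambda>q. schouten_endo q (X q))" if "smooth_field ?V X" for X
    by (rule smooth_schouten_endo[OF V(1) smooth_field_subset[OF E] on that]) auto
  show ?thesis
    unfolding cotton_form_def d_nabla_apply cov_deriv_endo_apply
    by (intro tangent_diff smooth_field_tangent[OF _ V(2)] smooth_nabla schouten_endo_tangent F V p e)
qed

section \<open>The Cotton tensor\<close>

text \<open>The matrix with rows \<open>e i c\<close> is inverted by the matrix of the coefficients with respect to
  \<open>e\<close> of the coordinate vectors.\<close>

lemma frame_det_nonzero:
  assumes p: "p \<in> topspace M" and e: "orthonormal_frame p e" and c: "c \<in> charts_at p"
  shows "det (\<chi> i. e i c) \<noteq> 0"
proof -
  note e' = orthonormal_frameD[OF e]
  define Q :: "real ^ 3 ^ 3" where "Q = (\<chi> k j. g p (tangent_of_coords c p (axis k 1)) (e j))"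
  have "(\<Sum>k\<in>UNIV. e i c $ k * g p (tangent_of_coords c p (axis k 1)) (e j)) = (if i = j then 1 else 0)" for i j
  proof -
    have "g p (e i) (e j) = g p (\<Sum>k\<in>UNIV. (e i c $ k) *\<^sub>R tangent_of_coords c p (axis k 1)) (e j)"
      using tangent_expansion[OF c e'(1)[of i]] by simp
    also have "\<dots> = (\<Sum>k\<in>UNIV. (e i c $ k) *\<^sub>R g p (tangent_of_coords c p (axis k 1)) (e j))"
      by (rule tangent_linear_sum_scaleR[OF metric_linear(2)[OF p e'(1)] tangent_of_coords_in[OF c]])
    finally show ?thesis by (simp add: e')
  qed
  then have "(\<chi> i. e i c) ** Q = mat 1"
    by (simp add: matrix_matrix_mult_def Q_def mat_def vec_eq_iff)
  then have "det (\<chi> i. e i c) * det Q = 1"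
    by (metis det_mul det_I)
  then show ?thesis by auto
qed

lemma frame_det_change_chart:
  assumes e: "orthonormal_frame p e" and c: "c \<in> charts_at p" and d: "d \<in> charts_at p"
  shows "det (\<chi> i. e i d) = det (\<chi> i. e i c) * det (matrix (jacobian c d p))"
proof -
  have "e i d = (\<Sum>j\<in>UNIV. (e i c $ j) *\<^sub>R jacobian c d p (axis j 1))" for i
    using tangent_spaceD(2)[OF orthonormal_frameD(1)[OF e] c d]
      linear_vec_expansion[OF linear_jacobian[OF c d], of "e i c"] by simp
  then have "(\<chi> i. e i d) = (\<chi> i. e i c) ** transpose (matrix (jacobian c d p))"
    by (simp add: vec_eq_iff matrix_matrix_mult_def matrix_def transpose_def)
  then show ?thesis by (simp add: det_mul)
qed

text \<open>The sign of the determinant does not depend on the chart, the atlas being oriented, and in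
  odd dimension it is reversed by replacing every vector of the frame with its opposite.\<close>

lemma oriented_frame_exists:
  assumes p: "p \<in> topspace M"
  shows "\<exists>S. oriented_orthonormal_frame p S"
proof -
  define c where "c = chart_at p"
  have c: "c \<in> charts_at p" unfolding c_def by (rule chart_at_in[OF p])
  have oriented_if: "oriented_orthonormal_frame p S"
    if S: "orthonormal_frame p S" and pos: "det (\<chi> i. S i c) > 0" for S
    unfolding oriented_orthonormal_frame_def
  proof (intro conjI allI ballI)
    fix d assume d: "d \<in> charts_at p"
    show "det (\<chi> i. S i d) > 0"
      unfolding frame_det_change_chart[OF S c d]
      using pos oriented[of c d p] c d by (simp add: charts_at_def)
  qed (simp_all add: orthonormal_frameD[OF S])
  obtain e where e: "orthonormal_frame p e" using frame_exists[OF p] by blast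
  note e' = orthonormal_frameD[OF e]
  have "g p (- e i) (- e j) = g p (e i) (e j)" for i j
    using tangent_linear_minus[OF metric_linear(2)[OF p tangent_minus[OF e'(1)]] e'(1)]
      tangent_linear_minus[OF metric_linear(1)[OF p e'(1)] e'(1)] by simp
  then have me: "orthonormal_frame p (\<lambda>i. - e i)"
    using e' by (simp add: orthonormal_frame_def tangent_minus)
  have "det (\<chi> i. (- e i) c) = - det (\<chi> i. e i c)"
    by (simp add: det_3)
  then show ?thesis
    using oriented_if[OF e] oriented_if[OF me] frame_det_nonzero[OF p e c]
    by (cases "det (\<chi> i. e i c) > 0") (auto simp: not_less)
qed

text \<open>With \<open>C\<close> the Cotton form, the difference of the entries \<open>(i, j)\<close> and \<open>(j, i)\<close> of the Cotton
  tensor is, up to sign, the contraction of \<open>C\<close> with the third vector of the frame. For instance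
  \<open>g(C(S\<^sub>2, S\<^sub>3), S\<^sub>2) - g(C(S\<^sub>3, S\<^sub>1), S\<^sub>1)\<close> is the sum of all \<open>g(C(S\<^sub>i, S\<^sub>3), S\<^sub>i)\<close>.\<close>

theorem cotton_tensor_symmetric:
  assumes p: "p \<in> topspace M"
  shows "symmetric_bilinear_form p (cotton_tensor p)"
proof -
  define S where "S = (SOME S. oriented_orthonormal_frame p S)"
  have "oriented_orthonormal_frame p S"
    unfolding S_def by (rule someI_ex[OF oriented_frame_exists[OF p]])
  then have S: "orthonormal_frame p S"
    by (simp add: oriented_orthonormal_frame_def orthonormal_frame_def)
  note S' = orthonormal_frameD(1)[OF S]
  let ?C = "\<lambda>i j. cotton_form p (S i) (S j)"
  note C = cotton_form_tangent[OF p S' S']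
  note g1 = metric_linear(2)[OF p] and g2 = metric_linear(1)[OF p]
  have cotton: "cotton_tensor p u z =
      g p (S 1) u * g p (?C 2 3) z + g p (S 2) u * g p (?C 3 1) z + g p (S 3) u * g p (?C 1 2) z"
    if "z \<in> tangent_space p" for u z
    using tangent_linear_add[OF g1[OF that]] tangent_linear_scaleR[OF g1[OF that]]
    by (simp add: cotton_tensor_def hodge_star_2_def Let_def S_def[symmetric] C tangent_add
        tangent_scaleR del: plus_fun_apply)
  have skew: "g p (?C j i) (S k) = - g p (?C i j) (S k)" for i j k
    unfolding cotton_form_skew[of p "S j" "S i"] by (rule tangent_linear_minus[OF g1[OF S'] C])
  have diag: "g p (?C i i) (S k) = 0" for i k using skew[of i i k] by simp
  have trace: "g p (?C 1 m) (S 1) + g p (?C 2 m) (S 2) + g p (?C 3 m) (S 3) = 0" for m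
    using cotton_form_trace[OF p S, of m] by (simp add: sum_3)
  have sym: "g p (?C 2 3) (S 2) = g p (?C 3 1) (S 1)" "g p (?C 2 3) (S 3) = g p (?C 1 2) (S 1)"
    "g p (?C 3 1) (S 3) = g p (?C 1 2) (S 2)"
    using trace[of 3] trace[of 2] trace[of 1] skew[of 1 3 1] skew[of 3 2 3] skew[of 2 1 2]
    by (simp_all add: diag)
  have expand: "g p (?C i j) z = g p (S 1) z * g p (?C i j) (S 1) + g p (S 2) z * g p (?C i j) (S 2)
      + g p (S 3) z * g p (?C i j) (S 3)" if z: "z \<in> tangent_space p" for i j z
  proof -
    have "g p (?C i j) z = g p (?C i j) (\<Sum>k\<in>UNIV. g p z (S k) *\<^sub>R S k)"
      using frame_expansion[OF p S z] by metis
    also have "\<dots> = (\<Sum>k\<in>UNIV. g p z (S k) *\<^sub>R g p (?C i j) (S k))"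
      by (rule tangent_linear_sum_scaleR[OF g2[OF C] S'])
    finally show ?thesis by (simp add: sum_3 metric_sym[OF p z S'])
  qed
  show ?thesis
    unfolding symmetric_bilinear_form_def
  proof (intro conjI ballI allI)
    fix u v assume u: "u \<in> tangent_space p" and v: "v \<in> tangent_space p"
    show "cotton_tensor p u v = cotton_tensor p v u"
      unfolding cotton[OF u] cotton[OF v] expand[OF u] expand[OF v] sym
      by (simp add: algebra_simps)
    fix a :: real
    show "cotton_tensor p (a *\<^sub>R u) v = a * cotton_tensor p u v"
      using tangent_linear_scaleR[OF g2[OF S'] u] by (simp add: cotton[OF v] algebra_simps)
    show "cotton_tensor p u (a *\<^sub>R v) = a * cotton_tensor p u v"
      using tangent_linear_scaleR[OF g2[OF C] v] by (simp add: cotton v tangent_scaleR algebra_simps)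
  next
    fix u v w assume u: "u \<in> tangent_space p" and v: "v \<in> tangent_space p" and w: "w \<in> tangent_space p"
    show "cotton_tensor p (u + v) w = cotton_tensor p u w + cotton_tensor p v w"
      unfolding cotton[OF w] tangent_linear_add[OF g2[OF S'] u v] by (simp add: algebra_simps)
    show "cotton_tensor p u (v + w) = cotton_tensor p u v + cotton_tensor p u w"
      unfolding cotton[OF v] cotton[OF w] cotton[OF tangent_add[OF v w]] tangent_linear_add[OF g2[OF C] v w]
      by (simp add: algebra_simps)
  qed
qed

end

theorem proposition12:
  fixes M :: "'a topology" and A :: "('a, 3) chart set"
    and g :: "'a \<Rightarrow> ('a, 3) tangent_vector \<Rightarrow> ('a, 3) tangent_vector \<Rightarrow> real"
    and nabla :: "('a, 3) vector_field \<Rightarrow> ('a, 3) vector_field \<Rightarrow> ('a, 3) vector_field"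
  assumes "oriented_riemannian_3_manifold M A g"
    and "levi_civita_connection M A g nabla"
  shows "\<forall>p\<in>topspace M. smooth_manifold.symmetric_bilinear_form A p
    (oriented_riemannian_3_manifold_levi_civita.cotton_tensor M A g nabla p)"
proof -
  interpret oriented_riemannian_3_manifold_levi_civita M A g nabla
    by (intro oriented_riemannian_3_manifold_levi_civita.intro assms)
  show ?thesis using cotton_tensor_symmetric by blast
qed

end
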